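(* Fix $0<\delta<1$. Suppose $m\ge\delta n$, $n\ge\delta m$ and $\delta\tau\le\zeta_{jk}\le\tau$ for all $j,k$ and some $\tau>\delta$. Let $$\mathcal U=\left\{(s,t)\in\Pi_0:\ |s_j|,|t_k|\le\frac{\ln(m+n)}{\tau\sqrt{m+n}}\ \text{for all } j,k\right\},\qquad \Xi=\int_{\mathbb R^{m+n-1}}e^{-q}\,ds\,dt,$$ and, for the Gaussian probability measure on $\mathbb R^{m+n-1}$ (the hyperplane $t_n=0$) with density $\Xi^{-1}e^{-q}$, let $\mu=\mathbf Ef^2$ and $\nu=\mathbf Eh$. Then, with constants $\gamma(\delta)>0$ depending only on $\delta$: (1) $\Xi\ge\dfrac{(2\pi)^{(m+n-1)/2}}{m^{(n-1)/2}n^{(m-1)/2}(\tau+\tau^2)^{(m+n-1)/2}}$; (2) $0\le\mu,\nu\le\gamma(\delta)$; (3) for any $0<\epsilon\le1/2$, $\left|\int_{\mathcal U}F(s,t)\,ds\,dt-\exp\{-\mu/2+\nu\}\,\Xi\right|\le\epsilon\,\Xi$ provided $m+n\ge(1/\epsilon)^{\gamma(\delta)}$; (4) for any $0<\epsilon\le1/2$, $\left|\int_{\mathcal U}|F(s,t)|\,ds\,dt-\exp\{\nu\}\,\Xi\right|\le\epsilon\,\Xi$ provided $m+n\ge(1/\epsilon)^{\gamma(\delta)}$.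
   Context: $R=(r_1,\dots,r_m)$, $C=(c_1,\dots,c_n)$ are positive integer margins with equal sums, and $Z=(\zeta_{jk})$ is their typical matrix: the unique maximizer of $g(X)=\sum_{j,k}((x_{jk}+1)\ln(x_{jk}+1)-x_{jk}\ln x_{jk})$ over real non-negative $m\times n$ matrices with row sums $R$, column sums $C$ (entries positive). For $(s,t)=(s_1,\dots,s_m;t_1,\dots,t_n)$: $F(s,t)=\exp\{-i\sum_jr_js_j-i\sum_kc_kt_k\}\prod_{j,k}(1+\zeta_{jk}-\zeta_{jk}e^{i(s_j+t_k)})^{-1}$; $q(s,t)=\frac12\sum_{j,k}(\zeta_{jk}^2+\zeta_{jk})(s_j+t_k)^2$; $f(s,t)=\frac16\sum_{j,k}\zeta_{jk}(\zeta_{jk}+1)(2\zeta_{jk}+1)(s_j+t_k)^3$; $h(s,t)=\frac1{24}\sum_{j,k}\zeta_{jk}(\zeta_{jk}+1)(6\zeta_{jk}^2+6\zeta_{jk}+1)(s_j+t_k)^4$. $\mathbb R^{m+n-1}$ is identified with the hyperplane $t_n=0$ in $\mathbb R^{m+n}$ (on which $q$ is positive definite), and $\Pi_0$ is the set of points of this hyperplane with $-\pi\le s_j,t_k\le\pi$ for all $j,k$; $ds\,dt$ is Lebesgue measure on $\mathbb R^{m+n-1}$. *)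

theory Defs
  imports "HOL-Analysis.Analysis"
begin

(* Vectors and matrices are functions on the index ranges {1..m} and {1..n}; values outside
   these ranges are never inspected. *)

definition transportation_polytope ::
  "nat \<Rightarrow> nat \<Rightarrow> (nat \<Rightarrow> nat) \<Rightarrow> (nat \<Rightarrow> nat) \<Rightarrow> (nat \<Rightarrow> nat \<Rightarrow> real) set" where
  "transportation_polytope m n R C =
    {X. (\<forall>j\<in>{1..m}. \<forall>k\<in>{1..n}. 0 \<le> X j k) \<and>
        (\<forall>j\<in>{1..m}. (\<Sum>k=1..n. X j k) = real (R j)) \<and>
        (\<forall>k\<in>{1..n}. (\<Sum>j=1..m. X j k) = real (C k))}"

(* At x = 0 the library value 0 * ln 0 = 0 is the usual continuous extension of x ln x. *)
definition g_entropy :: "nat \<Rightarrow> nat \<Rightarrow> (nat \<Rightarrow> nat \<Rightarrow> real) \<Rightarrow> real" where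
  "g_entropy m n X =
    (\<Sum>j=1..m. \<Sum>k=1..n. (X j k + 1) * ln (X j k + 1) - X j k * ln (X j k))"

(* A relation rather than a choice of representative: by strict concavity of the objective,
   the maximizer is unique on {1..m} x {1..n}, and Z is arbitrary outside. *)
definition typical_matrix ::
  "nat \<Rightarrow> nat \<Rightarrow> (nat \<Rightarrow> nat) \<Rightarrow> (nat \<Rightarrow> nat) \<Rightarrow> (nat \<Rightarrow> nat \<Rightarrow> real) \<Rightarrow> bool" where
  "typical_matrix m n R C Z \<longleftrightarrow>
    is_arg_max (g_entropy m n) (\<lambda>X. X \<in> transportation_polytope m n R C) Z"

type_synonym point = "(nat \<Rightarrow> real) \<times> (nat \<Rightarrow> real)"

definition F_integrand ::
  "nat \<Rightarrow> nat \<Rightarrow> (nat \<Rightarrow> nat) \<Rightarrow> (nat \<Rightarrow> nat) \<Rightarrow> (nat \<Rightarrow> nat \<Rightarrow> real) \<Rightarrow> point \<Rightarrow> complex" where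
  "F_integrand m n R C Z = (\<lambda>(s, t).
    exp (- \<i> * (\<Sum>j=1..m. of_nat (R j) * of_real (s j))
         - \<i> * (\<Sum>k=1..n. of_nat (C k) * of_real (t k))) *
    (\<Prod>j=1..m. \<Prod>k=1..n.
      inverse (1 + of_real (Z j k) - of_real (Z j k) * exp (\<i> * of_real (s j + t k)))))"

definition q_form :: "nat \<Rightarrow> nat \<Rightarrow> (nat \<Rightarrow> nat \<Rightarrow> real) \<Rightarrow> point \<Rightarrow> real" where
  "q_form m n Z = (\<lambda>(s, t).
    1/2 * (\<Sum>j=1..m. \<Sum>k=1..n. ((Z j k)^2 + Z j k) * (s j + t k)^2))"

definition f_form :: "nat \<Rightarrow> nat \<Rightarrow> (nat \<Rightarrow> nat \<Rightarrow> real) \<Rightarrow> point \<Rightarrow> real" where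
  "f_form m n Z = (\<lambda>(s, t).
    1/6 * (\<Sum>j=1..m. \<Sum>k=1..n. Z j k * (Z j k + 1) * (2 * Z j k + 1) * (s j + t k)^3))"

definition h_form :: "nat \<Rightarrow> nat \<Rightarrow> (nat \<Rightarrow> nat \<Rightarrow> real) \<Rightarrow> point \<Rightarrow> real" where
  "h_form m n Z = (\<lambda>(s, t).
    1/24 * (\<Sum>j=1..m. \<Sum>k=1..n.
      Z j k * (Z j k + 1) * (6 * (Z j k)^2 + 6 * Z j k + 1) * (s j + t k)^4))"

(* Lebesgue measure in the m + n - 1 coordinates s_1, ..., s_m, t_1, ..., t_{n-1}, transported
   to the hyperplane t_n = 0 of R^(m+n). *)
definition hyperplane_lebesgue :: "nat \<Rightarrow> nat \<Rightarrow> point measure" where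
  "hyperplane_lebesgue m n =
    distr ((\<Pi>\<^sub>M j\<in>{1..m}. lborel) \<Otimes>\<^sub>M (\<Pi>\<^sub>M k\<in>{1..<n}. lborel))
          ((\<Pi>\<^sub>M j\<in>{1..m}. lborel) \<Otimes>\<^sub>M (\<Pi>\<^sub>M k\<in>{1..n}. lborel))
          (\<lambda>(s, t). (s, t(n := 0)))"

definition Pi0 :: "nat \<Rightarrow> nat \<Rightarrow> point set" where
  "Pi0 m n = {(s, t) \<in> space (hyperplane_lebesgue m n). t n = 0 \<and>
     (\<forall>j\<in>{1..m}. - pi \<le> s j \<and> s j \<le> pi) \<and> (\<forall>k\<in>{1..n}. - pi \<le> t k \<and> t k \<le> pi)}"

definition U_region :: "nat \<Rightarrow> nat \<Rightarrow> real \<Rightarrow> point set" where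
  "U_region m n \<tau> = {(s, t) \<in> Pi0 m n.
     (\<forall>j\<in>{1..m}. \<bar>s j\<bar> \<le> ln (real (m + n)) / (\<tau> * sqrt (real (m + n)))) \<and>
     (\<forall>k\<in>{1..n}. \<bar>t k\<bar> \<le> ln (real (m + n)) / (\<tau> * sqrt (real (m + n))))}"

definition Xi :: "nat \<Rightarrow> nat \<Rightarrow> (nat \<Rightarrow> nat \<Rightarrow> real) \<Rightarrow> real" where
  "Xi m n Z = (LINT p|hyperplane_lebesgue m n. exp (- q_form m n Z p))"

definition gaussian_measure :: "nat \<Rightarrow> nat \<Rightarrow> (nat \<Rightarrow> nat \<Rightarrow> real) \<Rightarrow> point measure" where
  "gaussian_measure m n Z =
    density (hyperplane_lebesgue m n) (\<lambda>p. ennreal (exp (- q_form m n Z p) / Xi m n Z))"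

definition mu :: "nat \<Rightarrow> nat \<Rightarrow> (nat \<Rightarrow> nat \<Rightarrow> real) \<Rightarrow> real" where
  "mu m n Z = (LINT p|gaussian_measure m n Z. (f_form m n Z p)^2)"

definition nu :: "nat \<Rightarrow> nat \<Rightarrow> (nat \<Rightarrow> nat \<Rightarrow> real) \<Rightarrow> real" where
  "nu m n Z = (LINT p|gaussian_measure m n Z. h_form m n Z p)"

end

theory Submission
  imports Defs "HOL-Probability.Probability"
begin

text \<open>All functions involved depend on \<open>(s, t)\<close> only through the sums \<open>s\<^sub>j + t\<^sub>k\<close>. Hence the Gaussian
measure on the hyperplane is the image of a Gaussian measure on all of \<open>\<real>\<^sup>m\<^sup>+\<^sup>n\<close>, whose form is \<open>q\<close> plus a multiple of
\<open>(\<Sum>s - \<Sum>t)\<^sup>2\<close>. With \<open>N = m + n\<close> and after scaling by \<open>\<tau> \<surd>N\<close>, the Hessian of this form is bounded below by a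
constant \<open>\<kappa>(\<delta>)\<close> and its off-diagonal entries are \<open>O(1/N)\<close>; so the same is true of the off-diagonal covariances.

Gaussian integration by parts does the rest. It yields the Wick recursion and a decorrelation inequality, which
bound \<open>\<mu>\<close> and \<open>\<nu>\<close> and give \<open>Var h = O(1/N)\<close>. For the cubic form it yields \<open>E (f g(f)) = E (T g'(f))\<close> for a polynomial
\<open>T\<close> with \<open>E T = \<mu>\<close> and \<open>Var T = O(1/N)\<close>; taking \<open>g\<close> trigonometric and solving the resulting differential equation in
\<open>\<lambda>\<close> for \<open>E (exp (\<i> \<lambda> f))\<close> gives \<open>E (exp (-\<i> f)) = exp (-\<mu>/2) + O(N\<^sup>-\<^sup>1\<^sup>/\<^sup>2)\<close>.

A Taylor expansion gives \<open>F = exp (-q - \<i> f + h + R)\<close> with \<open>R = O(N\<^sup>-\<^sup>1\<^sup>/\<^sup>4)\<close> on the truncated region. There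
\<open>exp (2 h)\<close> is dominated by \<open>\<Prod>\<^sub>i (1 + C cosh x\<^sub>i / N)\<close>, whose expectation is bounded, so \<open>exp h\<close> may be replaced by
\<open>exp \<nu>\<close> at the cost of the standard deviation of \<open>h\<close>. The lower bound for \<open>\<Xi>\<close> follows by comparison with constant
\<open>\<zeta> = \<tau>\<close>, where the Gaussian integral is explicit.\<close>

section \<open>Lebesgue measure on finite products\<close>

text \<open>Pinning \<open>t n = 0\<close> gives the coordinates of the hyperplane Gaussian a common
  fluctuation as large as their own standard deviations, so their covariances do not decay; this is
  why the hyperplane is left. The added square penalises the null direction of \<open>q\<close>,
  along which the pulled-back integrands are constant, and makes the Hessian well conditioned, so
  that its inverse can be estimated entry by entry.

  A positive quartic form has no exponential moment under a Gaussian, so \<open>exp h\<close> can be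
  integrated only after truncation. The logarithmic size of the region serves both sides: its
  complement has probability O(1/N), and on it each coordinate adds a bounded amount to the
  exponent. The fifth-order Taylor remainder is of order ln(N)^5 / sqrt N; all errors are therefore
  measured in the slower rate N^(-1/4), which absorbs the logarithms.

  All moment bounds are expressed by a coercivity constant, a largest variance and a largest
  absolute row sum of covariances. In the scaled coordinates these are, apart from explicit powers
  of N, functions of \<delta> alone.\<close>

interpretation lb: product_sigma_finite "\<lambda>_::'i. lborel :: real measure"
  by standard

abbreviation lebPi :: "'i set \<Rightarrow> ('i \<Rightarrow> real) measure" where
  "lebPi I \<equiv> (\<Pi>\<^sub>M i\<in>I. (lborel :: real measure))"

abbreviation lebPair :: "nat \<Rightarrow> nat \<Rightarrow> point measure" where
  "lebPair m n \<equiv> lebPi {1..m} \<Otimes>\<^sub>M lebPi {1..n}"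

lemma nn_integral_lborel_affine:
  fixes u :: "real \<Rightarrow> ennreal"
  assumes [measurable]: "u \<in> borel_measurable borel" and c: "0 < c"
  shows "ennreal c * (\<integral>\<^sup>+x. u (t + c * x) \<partial>lborel) = (\<integral>\<^sup>+x. u x \<partial>lborel)"
proof -
  have "(\<integral>\<^sup>+x. u x \<partial>lborel) = (\<integral>\<^sup>+x. u x \<partial>density (distr lborel borel (\<lambda>x. t + c * x)) (\<lambda>_. ennreal (abs c)))"
    using lborel_real_affine[of c t] c by simp
  also have "\<dots> = (\<integral>\<^sup>+x. ennreal c * u (t + c * x) \<partial>lborel)"
    using c by (simp add: nn_integral_density nn_integral_distr)
  also have "\<dots> = ennreal c * (\<integral>\<^sup>+x. u (t + c * x) \<partial>lborel)"
    by (simp add: nn_integral_cmult)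
  finally show ?thesis by simp
qed

lemma measurable_affine_lebPi [measurable]:
  "(\<lambda>x. \<lambda>i\<in>I. v i + c * x i) \<in> lebPi I \<rightarrow>\<^sub>M lebPi I"
  by (rule measurable_restrict) simp

text \<open>Compared on boxes, the claim is the one-dimensional change of variables in each
  coordinate, which produces the Jacobian \<open>c ^ card I\<close>.\<close>

lemma lebPi_affine:
  fixes v :: "'i \<Rightarrow> real"
  assumes I: "finite I" and c: "0 < c"
  shows "density (distr (lebPi I) (lebPi I) (\<lambda>x. \<lambda>i\<in>I. v i + c * x i)) (\<lambda>_. ennreal (c ^ card I)) = lebPi I"
proof (rule lb.PiM_eqI[OF I])
  fix A :: "'i \<Rightarrow> real set" assume A: "\<And>i. i \<in> I \<Longrightarrow> A i \<in> sets lborel"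
  have box: "Pi\<^sub>E I A \<in> sets (lebPi I)"
    using A I by (intro sets_PiM_I_finite) auto
  have vm: "(\<lambda>y. v i + c * y) -` A i \<in> sets lborel" if "i \<in> I" for i
  proof -
    have "(\<lambda>y. v i + c * y) -` A i \<inter> space lborel \<in> sets lborel"
      using A[OF that] by (intro measurable_sets[where A = borel]) auto
    then show ?thesis by simp
  qed
  have one: "ennreal c * emeasure lborel ((\<lambda>y. v i + c * y) -` A i) = emeasure lborel (A i)" if "i \<in> I" for i
  proof -
    have "(\<lambda>y. indicator (A i) (v i + c * y)) = (indicator ((\<lambda>y. v i + c * y) -` A i) :: real \<Rightarrow> ennreal)"
      by (auto simp: fun_eq_iff indicator_def)
    then show ?thesis
      using nn_integral_lborel_affine[of "indicator (A i)" c "v i"] A[OF that] c vm[OF that]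
      by (simp only: nn_integral_indicator sets_lborel borel_measurable_indicator)
  qed
  have "emeasure (density (distr (lebPi I) (lebPi I) (\<lambda>x. \<lambda>i\<in>I. v i + c * x i)) (\<lambda>_. ennreal (c ^ card I))) (Pi\<^sub>E I A)
     = ennreal (c ^ card I) * emeasure (lebPi I) ((\<lambda>x. \<lambda>i\<in>I. v i + c * x i) -` Pi\<^sub>E I A \<inter> space (lebPi I))"
    using box by (subst emeasure_density_const) (auto simp: emeasure_distr)
  also have "(\<lambda>x. \<lambda>i\<in>I. v i + c * x i) -` Pi\<^sub>E I A \<inter> space (lebPi I) = Pi\<^sub>E I (\<lambda>i. (\<lambda>y. v i + c * y) -` A i)"
    by (auto simp: space_PiM PiE_iff)
  also have "emeasure (lebPi I) \<dots> = (\<Prod>i\<in>I. emeasure lborel ((\<lambda>y. v i + c * y) -` A i))"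
    using vm by (intro lb.emeasure_PiM[OF I])
  also have "ennreal (c ^ card I) * \<dots> = (\<Prod>i\<in>I. ennreal c * emeasure lborel ((\<lambda>y. v i + c * y) -` A i))"
    using c by (simp add: prod.distrib ennreal_power)
  also have "\<dots> = (\<Prod>i\<in>I. emeasure lborel (A i))"
    using one by (intro prod.cong) auto
  finally show "emeasure (density (distr (lebPi I) (lebPi I) (\<lambda>x. \<lambda>i\<in>I. v i + c * x i)) (\<lambda>_. ennreal (c ^ card I))) (Pi\<^sub>E I A)
     = (\<Prod>i\<in>I. emeasure lborel (A i))" .
qed simp

lemma nn_integral_lebPi_affine:
  fixes u :: "('i \<Rightarrow> real) \<Rightarrow> ennreal"
  assumes "finite I" and [measurable]: "u \<in> borel_measurable (lebPi I)" and c: "0 < c"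
  shows "ennreal (c ^ card I) * (\<integral>\<^sup>+x. u (\<lambda>i\<in>I. v i + c * x i) \<partial>lebPi I) = (\<integral>\<^sup>+x. u x \<partial>lebPi I)"
proof -
  have "(\<integral>\<^sup>+x. u x \<partial>lebPi I) = (\<integral>\<^sup>+x. u x \<partial>density (distr (lebPi I) (lebPi I) (\<lambda>x. \<lambda>i\<in>I. v i + c * x i)) (\<lambda>_. ennreal (c ^ card I)))"
    by (simp add: lebPi_affine[OF assms(1) c])
  also have "\<dots> = ennreal (c ^ card I) * (\<integral>\<^sup>+x. u (\<lambda>i\<in>I. v i + c * x i) \<partial>lebPi I)"
    by (simp add: nn_integral_density nn_integral_distr nn_integral_cmult)
  finally show ?thesis by simp
qed

lemma integrable_exp_abs_quadratic:
  fixes A k :: real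
  assumes "0 < k"
  shows "integrable lborel (\<lambda>y. exp (A * \<bar>y\<bar> - k * y\<^sup>2))"
proof (rule Bochner_Integration.integrable_bound)
  define s where "s = sqrt (1 / k)"
  have s: "0 < s" "s\<^sup>2 = 1 / k" using assms by (auto simp: s_def)
  have ex: "exp (- (k * y\<^sup>2) / 2) = sqrt (2 * pi * s\<^sup>2) * normal_density 0 s y" for y
    using assms s by (simp add: normal_density_def)
  show "integrable lborel (\<lambda>y. exp (A\<^sup>2 / (2 * k)) * exp (- (k * y\<^sup>2) / 2))"
    unfolding ex using s by (intro integrable_mult_right integrable_normal_density) auto
  have "A * \<bar>y\<bar> - k * y\<^sup>2 \<le> A\<^sup>2 / (2 * k) + - (k * y\<^sup>2) / 2" for y
  proof -
    have "0 \<le> (A - k * \<bar>y\<bar>)\<^sup>2 / (2 * k)" using assms by simp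
    also have "(A - k * \<bar>y\<bar>)\<^sup>2 / (2 * k) = A\<^sup>2 / (2 * k) - A * \<bar>y\<bar> + k * y\<^sup>2 / 2"
      using assms by (simp add: power2_diff power_mult_distrib field_simps power2_eq_square)
    finally show ?thesis by (simp add: field_simps)
  qed
  then show "AE y in lborel. norm (exp (A * \<bar>y\<bar> - k * y\<^sup>2)) \<le> norm (exp (A\<^sup>2 / (2 * k)) * exp (- (k * y\<^sup>2) / 2))"
    by (auto simp: exp_add[symmetric])
qed auto

lemma tendsto_exp_abs_quadratic:
  fixes A k :: real
  assumes "0 < k"
  shows "((\<lambda>y. exp (A * y - k * y\<^sup>2)) \<longlongrightarrow> 0) at_top"
  using assms by real_asymp

text \<open>The boundary values at r and -r tend to zero under the Gaussian envelope, and the same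
  envelope makes \<open>F'\<close> integrable. This is the one-dimensional core of Gaussian
  integration by parts.\<close>

lemma integral_lborel_derivative_eq_0:
  fixes F F' :: "real \<Rightarrow> real"
  assumes deriv: "\<And>y. (F has_real_derivative F' y) (at y)"
    and [measurable]: "F' \<in> borel_measurable borel"
    and k: "0 < k"
    and F: "\<And>y. \<bar>F y\<bar> \<le> C * exp (A * \<bar>y\<bar> - k * y\<^sup>2)"
    and F': "\<And>y. \<bar>F' y\<bar> \<le> C * exp (A * \<bar>y\<bar> - k * y\<^sup>2)"
  shows "(\<integral>y. F' y \<partial>lborel) = 0"
proof -
  have int: "integrable lborel F'"
    by (rule Bochner_Integration.integrable_bound[OF integrable_mult_right[OF integrable_exp_abs_quadratic[OF k], of C A]])
      (use F' in \<open>auto intro: order.trans[OF _ abs_ge_self]\<close>)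
  have I: "(\<integral>y. indicator {-real r..real r} y * F' y \<partial>lborel) = F (real r) - F (- real r)" for r :: nat
  proof -
    have "(F' has_integral (F (real r) - F (- real r))) {-real r..real r}"
      by (rule fundamental_theorem_of_calculus)
        (use deriv in \<open>auto simp: has_real_derivative_iff_has_vector_derivative[symmetric] intro: DERIV_subset\<close>)
    moreover have "set_integrable lborel {-real r..real r} F'"
      unfolding set_integrable_def using int by (intro integrable_mult_indicator) auto
    ultimately show ?thesis
      using set_borel_integral_eq_integral(2)[of "{-real r..real r}" F'] 
      by (simp add: set_lebesgue_integral_def integral_unique)
  qed
  have lim1: "(\<lambda>r. \<integral>y. indicator {-real r..real r} y * F' y \<partial>lborel) \<longlonglongrightarrow> (\<integral>y. F' y \<partial>lborel)"
  proof (rule integral_dominated_convergence[where w = "\<lambda>y. norm (F' y)"])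
    show "AE y in lborel. (\<lambda>r. indicator {-real r..real r} y * F' y) \<longlonglongrightarrow> F' y"
    proof (rule AE_I2, rule tendsto_eventually)
      fix y :: real
      obtain r0 :: nat where "\<bar>y\<bar> \<le> real r0" using real_arch_simple by blast
      then show "\<forall>\<^sub>F r in sequentially. indicator {-real r..real r} y * F' y = F' y"
        by (intro eventually_sequentiallyI[of r0]) (auto simp: indicator_def)
    qed
  qed (use int in \<open>auto simp: indicator_def\<close>)
  have dec: "(\<lambda>r. C * exp (A * real r - k * (real r)\<^sup>2)) \<longlonglongrightarrow> 0"
    using tendsto_mult[OF tendsto_const filterlim_compose[OF tendsto_exp_abs_quadratic[OF k] filterlim_real_sequentially], of C A] by simp
  have "(\<lambda>r. F (real r)) \<longlonglongrightarrow> 0"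
    by (rule Lim_null_comparison[OF _ dec]) (use F[of "real _"] in auto)
  moreover have "(\<lambda>r. F (- real r)) \<longlonglongrightarrow> 0"
    by (rule Lim_null_comparison[OF _ dec]) (use F[of "- real _"] in auto)
  ultimately have "(\<lambda>r. F (real r) - F (- real r)) \<longlonglongrightarrow> 0"
    using tendsto_diff by fastforce
  then show ?thesis using lim1 I LIMSEQ_unique by fastforce
qed

section \<open>Gaussian measures and integration by parts\<close>

text \<open>Positive definiteness is quantitative: the coercivity constant \<kappa> controls the
  covariances, and the estimates refer to it instead of to the inverse matrix.\<close>

locale gaussian_form =
  fixes I :: "'i set" and H :: "'i \<Rightarrow> 'i \<Rightarrow> real" and \<kappa> :: real
  assumes finite_I [simp, intro]: "finite I"
    and H_sym: "\<And>i j. i \<in> I \<Longrightarrow> j \<in> I \<Longrightarrow> H i j = H j i"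
    and \<kappa>_pos: "0 < \<kappa>"
    and H_coercive: "\<And>x. \<kappa> * (\<Sum>i\<in>I. (x i)\<^sup>2) \<le> (\<Sum>i\<in>I. \<Sum>j\<in>I. H i j * x i * x j)"
begin

definition Q :: "('i \<Rightarrow> real) \<Rightarrow> real" where
  "Q x = (\<Sum>i\<in>I. \<Sum>j\<in>I. H i j * x i * x j) / 2"

lemma Q_lower: "\<kappa> / 2 * (\<Sum>i\<in>I. (x i)\<^sup>2) \<le> Q x"
  using H_coercive[of x] by (simp add: Q_def)

lemma measurable_Q [measurable]: "Q \<in> borel_measurable (lebPi I)"
  unfolding Q_def[abs_def] by measurable

text \<open>At most exponential growth in the l1 norm: a class closed under sums and products,
  integrable against the Gaussian weight, and large enough for polynomials, bounded functions and
  exponentials of linear forms.\<close>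

definition tame :: "(('i \<Rightarrow> real) \<Rightarrow> real) \<Rightarrow> bool" where
  "tame G \<longleftrightarrow> G \<in> borel_measurable (lebPi I) \<and>
    (\<exists>C A. 0 \<le> C \<and> 0 \<le> A \<and> (\<forall>x. \<bar>G x\<bar> \<le> C * exp (A * (\<Sum>i\<in>I. \<bar>x i\<bar>))))"

lemma tameI:
  assumes "G \<in> borel_measurable (lebPi I)" "0 \<le> C" "0 \<le> A"
    and "\<And>x. \<bar>G x\<bar> \<le> C * exp (A * (\<Sum>i\<in>I. \<bar>x i\<bar>))"
  shows "tame G"
  using assms unfolding tame_def by blast

lemma tame_measurable: "tame G \<Longrightarrow> G \<in> borel_measurable (lebPi I)"
  by (simp add: tame_def)

lemma abs_sum_coords_nonneg: "0 \<le> (\<Sum>i\<in>I. \<bar>x i\<bar>)" for x :: "'i \<Rightarrow> real"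
  by (simp add: sum_nonneg)

lemma tame_const [simp, intro]: "tame (\<lambda>_. c)"
  by (rule tameI[of _ "\<bar>c\<bar>" 0]) auto

lemma tame_coord [simp, intro]:
  assumes "i \<in> I" shows "tame (\<lambda>x. x i)"
proof (rule tameI[of _ 1 1])
  fix x :: "'i \<Rightarrow> real"
  have "\<bar>x i\<bar> \<le> (\<Sum>j\<in>I. \<bar>x j\<bar>)"
    using assms by (intro member_le_sum) auto
  also have "\<dots> \<le> exp (\<Sum>j\<in>I. \<bar>x j\<bar>)"
    using exp_ge_add_one_self[of "\<Sum>j\<in>I. \<bar>x j\<bar>"] by linarith
  finally show "\<bar>x i\<bar> \<le> 1 * exp (1 * (\<Sum>j\<in>I. \<bar>x j\<bar>))" by simp
qed (use assms in auto)

lemma tame_common: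
  assumes "tame G1" "tame G2"
  obtains C A where "0 \<le> C" "0 \<le> A" "\<And>x. \<bar>G1 x\<bar> \<le> C * exp (A * (\<Sum>i\<in>I. \<bar>x i\<bar>))"
    "\<And>x. \<bar>G2 x\<bar> \<le> C * exp (A * (\<Sum>i\<in>I. \<bar>x i\<bar>))"
proof -
  obtain C1 A1 where 1: "0 \<le> C1" "0 \<le> A1" "\<And>x. \<bar>G1 x\<bar> \<le> C1 * exp (A1 * (\<Sum>i\<in>I. \<bar>x i\<bar>))"
    using assms(1) unfolding tame_def by blast
  obtain C2 A2 where 2: "0 \<le> C2" "0 \<le> A2" "\<And>x. \<bar>G2 x\<bar> \<le> C2 * exp (A2 * (\<Sum>i\<in>I. \<bar>x i\<bar>))"
    using assms(2) unfolding tame_def by blast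
  show ?thesis
  proof (rule that[of "C1 + C2" "A1 + A2"])
    fix x
    have "C1 * exp (A1 * (\<Sum>i\<in>I. \<bar>x i\<bar>)) \<le> (C1 + C2) * exp ((A1 + A2) * (\<Sum>i\<in>I. \<bar>x i\<bar>))"
      using 1 2 abs_sum_coords_nonneg[of x] by (intro mult_mono) (auto simp: mult_right_mono)
    then show "\<bar>G1 x\<bar> \<le> (C1 + C2) * exp ((A1 + A2) * (\<Sum>i\<in>I. \<bar>x i\<bar>))"
      using 1(3)[of x] by linarith
    have "C2 * exp (A2 * (\<Sum>i\<in>I. \<bar>x i\<bar>)) \<le> (C1 + C2) * exp ((A1 + A2) * (\<Sum>i\<in>I. \<bar>x i\<bar>))"
      using 1 2 abs_sum_coords_nonneg[of x] by (intro mult_mono) (auto simp: mult_right_mono)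
    then show "\<bar>G2 x\<bar> \<le> (C1 + C2) * exp ((A1 + A2) * (\<Sum>i\<in>I. \<bar>x i\<bar>))"
      using 2(3)[of x] by linarith
  qed (use 1 2 in auto)
qed

lemma tame_add [simp, intro]:
  assumes "tame G1" "tame G2" shows "tame (\<lambda>x. G1 x + G2 x)"
proof -
  from assms obtain C A where *: "0 \<le> C" "0 \<le> A" "\<And>x. \<bar>G1 x\<bar> \<le> C * exp (A * (\<Sum>i\<in>I. \<bar>x i\<bar>))"
    "\<And>x. \<bar>G2 x\<bar> \<le> C * exp (A * (\<Sum>i\<in>I. \<bar>x i\<bar>))"
    using tame_common by blast
  show ?thesis
  proof (rule tameI[of _ "2 * C" A])
    fix x
    show "\<bar>G1 x + G2 x\<bar> \<le> 2 * C * exp (A * (\<Sum>i\<in>I. \<bar>x i\<bar>))"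
      using *(3,4)[of x] by linarith
    show "(\<lambda>x. G1 x + G2 x) \<in> borel_measurable (lebPi I)"
      using assms[THEN tame_measurable] by measurable
  qed (use * in auto)
qed

lemma tame_mult [simp, intro]:
  assumes "tame G1" "tame G2" shows "tame (\<lambda>x. G1 x * G2 x)"
proof -
  from assms obtain C A where *: "0 \<le> C" "0 \<le> A" "\<And>x. \<bar>G1 x\<bar> \<le> C * exp (A * (\<Sum>i\<in>I. \<bar>x i\<bar>))"
    "\<And>x. \<bar>G2 x\<bar> \<le> C * exp (A * (\<Sum>i\<in>I. \<bar>x i\<bar>))"
    using tame_common by blast
  show ?thesis
  proof (rule tameI[of _ "C * C" "A + A"])
    fix x
    have "\<bar>G1 x * G2 x\<bar> \<le> (C * exp (A * (\<Sum>i\<in>I. \<bar>x i\<bar>))) * (C * exp (A * (\<Sum>i\<in>I. \<bar>x i\<bar>)))"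
      unfolding abs_mult using * by (intro mult_mono) auto
    also have "\<dots> = C * C * exp ((A + A) * (\<Sum>i\<in>I. \<bar>x i\<bar>))"
      by (simp add: exp_add[symmetric] distrib_right)
    finally show "\<bar>G1 x * G2 x\<bar> \<le> C * C * exp ((A + A) * (\<Sum>i\<in>I. \<bar>x i\<bar>))" .
    show "(\<lambda>x. G1 x * G2 x) \<in> borel_measurable (lebPi I)"
      using assms[THEN tame_measurable] by measurable
  qed (use * in auto)
qed

lemma tame_uminus [simp, intro]: "tame G \<Longrightarrow> tame (\<lambda>x. - G x)"
  using tame_mult[of "\<lambda>_. -1" G] by simp

lemma tame_diff [simp, intro]: "tame G1 \<Longrightarrow> tame G2 \<Longrightarrow> tame (\<lambda>x. G1 x - G2 x)"
  using tame_add[of G1 "\<lambda>x. - G2 x"] by simp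

lemma tame_divide [simp, intro]: "tame G \<Longrightarrow> tame (\<lambda>x. G x / c)"
  using tame_mult[of "\<lambda>_. 1 / c" G] by simp

lemma tame_sum [simp, intro]: "(\<And>a. a \<in> A \<Longrightarrow> tame (G a)) \<Longrightarrow> tame (\<lambda>x. \<Sum>a\<in>A. G a x)"
  by (induction A rule: infinite_finite_induct) auto

lemma tame_power [simp, intro]: "tame G \<Longrightarrow> tame (\<lambda>x. G x ^ p)"
  by (induction p) auto

lemma tame_bounded:
  assumes "G \<in> borel_measurable (lebPi I)" "\<And>x. \<bar>G x\<bar> \<le> b"
  shows "tame G"
  using assms abs_ge_zero[THEN order_trans, OF assms(2)] by (intro tameI[of _ b 0]) auto

lemma tame_dominated:
  assumes "G \<in> borel_measurable (lebPi I)" "tame G'" "\<And>x. \<bar>G x\<bar> \<le> G' x"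
  shows "tame G"
proof -
  obtain C A where "0 \<le> C" "0 \<le> A" "\<And>x. \<bar>G' x\<bar> \<le> C * exp (A * (\<Sum>i\<in>I. \<bar>x i\<bar>))"
    using assms(2) unfolding tame_def by blast
  moreover from this have "\<bar>G x\<bar> \<le> C * exp (A * (\<Sum>i\<in>I. \<bar>x i\<bar>))" for x
    using assms(3)[of x] by (meson abs_ge_self order_trans)
  ultimately show ?thesis
    using assms(1) by (intro tameI[of _ C A])
qed

lemma tame_abs [simp, intro]: "tame G \<Longrightarrow> tame (\<lambda>x. \<bar>G x\<bar>)"
  unfolding tame_def by auto

text \<open>The envelope factorises over the coordinates, so integrability, and later integration by
  parts, reduce to dimension one.\<close>

lemma tame_exp_bound:
  assumes "0 \<le> C" "0 \<le> A" "\<bar>G\<bar> \<le> C * exp (A * (\<Sum>i\<in>I. \<bar>x i\<bar>))"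
  shows "\<bar>G * exp (- Q x)\<bar> \<le> C * (\<Prod>i\<in>I. exp (A * \<bar>x i\<bar> - \<kappa> / 2 * (x i)\<^sup>2))"
proof -
  have "\<bar>G * exp (- Q x)\<bar> \<le> C * exp (A * (\<Sum>i\<in>I. \<bar>x i\<bar>)) * exp (- (\<kappa> / 2 * (\<Sum>i\<in>I. (x i)\<^sup>2)))"
    unfolding abs_mult using assms Q_lower[of x] by (intro mult_mono) auto
  also have "\<dots> = C * exp (\<Sum>i\<in>I. A * \<bar>x i\<bar> - \<kappa> / 2 * (x i)\<^sup>2)"
    by (simp add: mult.assoc exp_add[symmetric] sum_subtractf sum_distrib_left)
  finally show ?thesis by (simp add: exp_sum)
qed

lemma integrable_tame:
  assumes "tame G"
  shows "integrable (lebPi I) (\<lambda>x. G x * exp (- Q x))"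
proof -
  obtain C A where *: "0 \<le> C" "0 \<le> A" "\<And>x. \<bar>G x\<bar> \<le> C * exp (A * (\<Sum>i\<in>I. \<bar>x i\<bar>))"
    using assms unfolding tame_def by blast
  have [measurable]: "G \<in> borel_measurable (lebPi I)" using assms by (rule tame_measurable)
  show ?thesis
  proof (rule Bochner_Integration.integrable_bound)
    show "integrable (lebPi I) (\<lambda>x. C * (\<Prod>i\<in>I. exp (A * \<bar>x i\<bar> - \<kappa> / 2 * (x i)\<^sup>2)))"
      using \<kappa>_pos by (intro integrable_mult_right lb.product_integrable_prod integrable_exp_abs_quadratic) auto
    show "AE x in lebPi I. norm (G x * exp (- Q x)) \<le> norm (C * (\<Prod>i\<in>I. exp (A * \<bar>x i\<bar> - \<kappa> / 2 * (x i)\<^sup>2)))"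
      using tame_exp_bound[OF *(1,2) *(3)] by (auto intro: order_trans[OF _ abs_ge_self])
  qed measurable
qed

section \<open>Normalisation and the Gaussian probability measure\<close>

definition Zc :: real where "Zc = (\<integral>x. exp (- Q x) \<partial>lebPi I)"

lemma emeasure_lebPi_space_ne_0: "emeasure (lebPi I) (space (lebPi I)) \<noteq> 0"
proof -
  have "emeasure (lebPi I) (space (lebPi I)) = (\<Prod>i\<in>I. emeasure lborel (UNIV::real set))"
    unfolding space_PiM by (subst lb.emeasure_PiM) auto
  also have "\<dots> \<noteq> 0" by (induction I rule: infinite_finite_induct) auto
  finally show ?thesis .
qed

lemma integrable_exp_Q: "integrable (lebPi I) (\<lambda>x. exp (- Q x))"
  using integrable_tame[of "\<lambda>_. 1"] by simp

lemma Zc_pos: "0 < Zc"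
proof -
  have "Zc \<noteq> 0"
  proof
    assume "Zc = 0"
    then have "AE x in lebPi I. exp (- Q x) = 0"
      unfolding Zc_def using integrable_exp_Q by (subst (asm) integral_nonneg_eq_0_iff_AE) auto
    then have "AE x in lebPi I. False" by simp
    then show False using emeasure_lebPi_space_ne_0 
      by (simp add: AE_iff_measurable[OF sets.top])
  qed
  moreover have "0 \<le> Zc" unfolding Zc_def by (intro Bochner_Integration.integral_nonneg) auto
  ultimately show ?thesis by simp
qed

definition P :: "('i \<Rightarrow> real) measure" where
  "P = density (lebPi I) (\<lambda>x. ennreal (exp (- Q x) / Zc))"

lemma space_P [simp]: "space P = space (lebPi I)"
  and sets_P [simp, measurable_cong]: "sets P = sets (lebPi I)"
  by (auto simp: P_def)

abbreviation E :: "(('i \<Rightarrow> real) \<Rightarrow> real) \<Rightarrow> real" where "E G \<equiv> integral\<^sup>L P G"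

lemma E_eq: "G \<in> borel_measurable (lebPi I) \<Longrightarrow> E G = (\<integral>x. G x * exp (- Q x) \<partial>lebPi I) / Zc"
  unfolding P_def using Zc_pos by (subst integral_density) (auto simp: mult.commute)

lemma integrable_P:
  assumes "tame G" shows "integrable P G"
proof -
  have [measurable]: "G \<in> borel_measurable (lebPi I)" using assms by (rule tame_measurable)
  have "integrable (lebPi I) (\<lambda>x. (exp (- Q x) / Zc) *\<^sub>R G x)"
    using integrable_divide[OF integrable_tame[OF assms], of Zc] by (simp add: mult.commute)
  then show ?thesis
    unfolding P_def using Zc_pos by (subst integrable_density) auto
qed

sublocale prob_space P
proof
  have "emeasure P (space P) = (\<integral>\<^sup>+x. ennreal (exp (- Q x) / Zc) \<partial>lebPi I)"
    unfolding P_def by (simp add: emeasure_density cong: nn_integral_cong)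
  also have "\<dots> = ennreal (\<integral>x. exp (- Q x) / Zc \<partial>lebPi I)"
    using integrable_exp_Q Zc_pos by (intro nn_integral_eq_integral) auto
  also have "(\<integral>x. exp (- Q x) / Zc \<partial>lebPi I) = 1"
    using Zc_pos by (simp add: Zc_def)
  finally show "emeasure P (space P) = 1" by simp
qed

text \<open>Partial derivatives along coordinate updates are enough, because integration by parts is
  carried out in one coordinate at a time after Fubini.\<close>

definition has_grad :: "(('i \<Rightarrow> real) \<Rightarrow> real) \<Rightarrow> (('i \<Rightarrow> real) \<Rightarrow> 'i \<Rightarrow> real) \<Rightarrow> bool" where
  "has_grad G D \<longleftrightarrow> tame G \<and> (\<forall>i\<in>I. tame (\<lambda>x. D x i)) \<and>
    (\<forall>x. \<forall>i\<in>I. ((\<lambda>y. G (x(i := y))) has_real_derivative D x i) (at (x i)))"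

lemma has_gradD:
  assumes "has_grad G D"
  shows "tame G" "i \<in> I \<Longrightarrow> tame (\<lambda>x. D x i)"
    and has_grad_deriv: "i \<in> I \<Longrightarrow> ((\<lambda>y. G (x(i := y))) has_real_derivative D (x(i := y)) i) (at y)"
proof -
  show "tame G" "i \<in> I \<Longrightarrow> tame (\<lambda>x. D x i)"
    using assms by (auto simp: has_grad_def)
  assume "i \<in> I"
  then have "((\<lambda>z. G ((x(i := y))(i := z))) has_real_derivative D (x(i := y)) i) (at ((x(i := y)) i))"
    using assms unfolding has_grad_def by blast
  then show "((\<lambda>y. G (x(i := y))) has_real_derivative D (x(i := y)) i) (at y)" by simp
qed

lemma has_grad_const: "has_grad (\<lambda>_. c) (\<lambda>x i. 0)"
  by (auto simp: has_grad_def)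

lemma has_grad_add: "has_grad F D \<Longrightarrow> has_grad G D' \<Longrightarrow> has_grad (\<lambda>x. F x + G x) (\<lambda>x i. D x i + D' x i)"
  unfolding has_grad_def by (auto intro!: DERIV_add)

lemma has_grad_mult: "has_grad F D \<Longrightarrow> has_grad G D' \<Longrightarrow>
    has_grad (\<lambda>x. F x * G x) (\<lambda>x i. D x i * G x + F x * D' x i)"
  unfolding has_grad_def by (auto intro!: derivative_eq_intros)

lemma has_grad_cmult: "has_grad G D \<Longrightarrow> has_grad (\<lambda>x. c * G x) (\<lambda>x i. c * D x i)"
  using has_grad_mult[OF has_grad_const[of c], of G D] by simp

lemma has_grad_sum:
  assumes "\<And>a. a \<in> A \<Longrightarrow> has_grad (F a) (D a)"
  shows "has_grad (\<lambda>x. \<Sum>a\<in>A. F a x) (\<lambda>x i. \<Sum>a\<in>A. D a x i)"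
  using assms
  by (induction A rule: infinite_finite_induct) (auto simp: has_grad_const intro!: has_grad_add)

definition lin :: "('i \<Rightarrow> real) \<Rightarrow> ('i \<Rightarrow> real) \<Rightarrow> real" where
  "lin v x = (\<Sum>i\<in>I. v i * x i)"

lemma tame_lin [simp, intro]: "tame (lin v)"
  unfolding lin_def[abs_def] by auto

lemma has_grad_coord:
  assumes "j \<in> I" shows "has_grad (\<lambda>x. x j) (\<lambda>x i. of_bool (i = j))"
  unfolding has_grad_def using assms by (auto intro!: derivative_eq_intros)

lemma has_grad_lin: "has_grad (lin v) (\<lambda>x i. if i \<in> I then v i else 0)"
proof -
  have "has_grad (\<lambda>x. \<Sum>j\<in>I. v j * x j) (\<lambda>x i. \<Sum>j\<in>I. v j * of_bool (i = j))"
    by (intro has_grad_sum has_grad_cmult has_grad_coord)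
  also have "(\<lambda>(x::'i \<Rightarrow> real) i. \<Sum>j\<in>I. v j * of_bool (i = j)) = (\<lambda>x i. if i \<in> I then v i else 0)"
    by (auto simp: fun_eq_iff)
  finally show ?thesis by (simp add: lin_def[abs_def])
qed

lemma Q_deriv:
  assumes "i \<in> I"
  shows "((\<lambda>y. Q (x(i := y))) has_real_derivative (\<Sum>j\<in>I. H i j * (x(i := y)) j)) (at y)"
proof -
  have d: "((\<lambda>y. (x(i := y)) a) has_real_derivative of_bool (a = i)) (at y)" for a
    by (cases "a = i") auto
  let ?x = "x(i := y)"
  have "((\<lambda>y. Q (x(i := y))) has_real_derivative
      (\<Sum>a\<in>I. \<Sum>b\<in>I. H a b * ?x a * of_bool (b = i) + H a b * of_bool (a = i) * ?x b) / 2) (at y)"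
    unfolding Q_def by (intro DERIV_cdivide DERIV_sum DERIV_mult' DERIV_cmult d)
  also have "(\<Sum>a\<in>I. \<Sum>b\<in>I. H a b * ?x a * of_bool (b = i) + H a b * of_bool (a = i) * ?x b)
     = (\<Sum>b\<in>I. H i b * ?x b) + (\<Sum>a\<in>I. H a i * ?x a)"
  proof -
    have "(\<Sum>a\<in>I. \<Sum>b\<in>I. H a b * of_bool (a = i) * ?x b) = (\<Sum>a\<in>I. if a = i then \<Sum>b\<in>I. H a b * ?x b else 0)"
      by (intro sum.cong refl) auto
    moreover have "(\<Sum>a\<in>I. \<Sum>b\<in>I. H a b * ?x a * of_bool (b = i)) = (\<Sum>a\<in>I. \<Sum>b\<in>I. if b = i then H a b * ?x a else 0)"
      by (intro sum.cong refl) auto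
    ultimately show ?thesis using assms by (simp add: sum.distrib)
  qed
  also have "(\<Sum>a\<in>I. H a i * ?x a) = (\<Sum>b\<in>I. H i b * ?x b)"
    using assms by (intro sum.cong refl) (metis H_sym)
  finally show ?thesis by (simp del: fun_upd_apply)
qed

text \<open>The partial derivative of \<open>G * exp (- Q)\<close> in direction i is
  \<open>W * exp (- Q)\<close>. Integrating coordinate i first gives zero on every line, which is
  the identity.\<close>

lemma ibp_coord:
  assumes G: "has_grad G D" and i: "i \<in> I"
  shows "E (\<lambda>x. (\<Sum>j\<in>I. H i j * x j) * G x) = E (\<lambda>x. D x i)"
proof -
  define J where "J = I - {i}"
  have J: "finite J" "i \<notin> J" and IJ: "I = insert i J" using i by (auto simp: J_def)
  define W where "W x = D x i - (\<Sum>j\<in>I. H i j * x j) * G x" for x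
  have tG: "tame G" and tD: "tame (\<lambda>x. D x i)" using G i by (auto dest: has_gradD)
  have tW: "tame W" unfolding W_def[abs_def] using tG tD by auto
  obtain C A where CA: "0 \<le> C" "0 \<le> A" "\<And>x. \<bar>G x\<bar> \<le> C * exp (A * (\<Sum>i\<in>I. \<bar>x i\<bar>))"
    "\<And>x. \<bar>W x\<bar> \<le> C * exp (A * (\<Sum>i\<in>I. \<bar>x i\<bar>))"
    using tame_common[OF tG tW] by blast
  have [measurable]: "W \<in> borel_measurable (lebPi I)" using tW by (rule tame_measurable)
  have inner: "(\<integral>y. W (x(i := y)) * exp (- Q (x(i := y))) \<partial>lborel) = 0" if x: "x \<in> space (lebPi J)" for x
  proof (rule integral_lborel_derivative_eq_0)
    let ?C = "C * (\<Prod>j\<in>J. exp (A * \<bar>x j\<bar> - \<kappa> / 2 * (x j)\<^sup>2))"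
    show "((\<lambda>y. G (x(i := y)) * exp (- Q (x(i := y)))) has_real_derivative
        W (x(i := y)) * exp (- Q (x(i := y)))) (at y)" for y
      by (rule derivative_eq_intros has_grad_deriv[OF G i] Q_deriv[OF i] refl)+
        (simp add: W_def algebra_simps)
    have [measurable]: "(\<lambda>y. x(i := y)) \<in> borel \<rightarrow>\<^sub>M lebPi I"
      using measurable_component_update[OF x J(2)] by (simp add: IJ)
    show "(\<lambda>y. W (x(i := y)) * exp (- Q (x(i := y)))) \<in> borel_measurable borel"
      by measurable
    \<comment> \<open>With the other coordinates frozen, their part of the envelope is a constant,
      and what remains is the one-dimensional envelope in y.\<close>
    have split: "(\<Prod>j\<in>I. exp (A * \<bar>(x(i := y)) j\<bar> - \<kappa> / 2 * ((x(i := y)) j)\<^sup>2)) =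
        (\<Prod>j\<in>J. exp (A * \<bar>x j\<bar> - \<kappa> / 2 * (x j)\<^sup>2)) * exp (A * \<bar>y\<bar> - \<kappa> / 2 * y\<^sup>2)" for y
    proof -
      have "(\<Prod>j\<in>J. exp (A * \<bar>(x(i := y)) j\<bar> - \<kappa> / 2 * ((x(i := y)) j)\<^sup>2)) =
        (\<Prod>j\<in>J. exp (A * \<bar>x j\<bar> - \<kappa> / 2 * (x j)\<^sup>2))"
        using J by (intro prod.cong) auto
      then show ?thesis unfolding IJ using J by (simp add: mult.commute)
    qed
    show "\<bar>G (x(i := y)) * exp (- Q (x(i := y)))\<bar> \<le> ?C * exp (A * \<bar>y\<bar> - \<kappa> / 2 * y\<^sup>2)" for y
      using tame_exp_bound[OF CA(1,2) CA(3)[of "x(i := y)"]] unfolding split by (simp add: mult.assoc del: fun_upd_apply)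
    show "\<bar>W (x(i := y)) * exp (- Q (x(i := y)))\<bar> \<le> ?C * exp (A * \<bar>y\<bar> - \<kappa> / 2 * y\<^sup>2)" for y
      using tame_exp_bound[OF CA(1,2) CA(4)[of "x(i := y)"]] unfolding split by (simp add: mult.assoc del: fun_upd_apply)
  qed (use \<kappa>_pos in auto)
  have "(\<integral>x. W x * exp (- Q x) \<partial>lebPi I) = (\<integral>x. (\<integral>y. W (x(i := y)) * exp (- Q (x(i := y))) \<partial>lborel) \<partial>lebPi J)"
    using integrable_tame[OF tW] unfolding IJ by (intro lb.product_integral_insert J) auto
  also have "\<dots> = 0" using inner by (simp cong: Bochner_Integration.integral_cong)
  finally have "E W = 0" by (subst E_eq) auto
  moreover have "E W = E (\<lambda>x. D x i) - E (\<lambda>x. (\<Sum>j\<in>I. H i j * x j) * G x)"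
    unfolding W_def using tG tD by (intro Bochner_Integration.integral_diff integrable_P) auto
  ultimately show ?thesis by simp
qed

section \<open>The covariance matrix as the inverse Hessian\<close>

definition K :: "'i \<Rightarrow> 'i \<Rightarrow> real" where "K i j = E (\<lambda>x. x i * x j)"

lemma K_sym: "K i j = K j i"
  by (simp add: K_def mult.commute)

text \<open>Integration by parts with \<open>G x = x j\<close>; the derivative of a coordinate is
  the Kronecker delta.\<close>

lemma HK: 
  assumes "i \<in> I" "j \<in> I"
  shows "(\<Sum>l\<in>I. H i l * K l j) = of_bool (i = j)"
proof -
  have "(\<Sum>l\<in>I. H i l * K l j) = E (\<lambda>x. \<Sum>l\<in>I. H i l * (x l * x j))"
    unfolding K_def using assms by (simp add: integrable_P)
  also have "\<dots> = E (\<lambda>x. (\<Sum>l\<in>I. H i l * x l) * x j)"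
    by (simp add: sum_distrib_right mult.assoc)
  also have "\<dots> = of_bool (i = j)"
    using assms by (subst ibp_coord[OF has_grad_coord]) (auto simp: prob_space[unfolded space_P])
  finally show ?thesis .
qed

lemma KH: 
  assumes "i \<in> I" "j \<in> I"
  shows "(\<Sum>l\<in>I. K i l * H l j) = of_bool (i = j)"
proof -
  have "(\<Sum>l\<in>I. K i l * H l j) = (\<Sum>l\<in>I. H j l * K l i)"
    using assms by (intro sum.cong refl) (metis H_sym K_sym mult.commute)
  then show ?thesis using HK[OF assms(2,1)] by auto
qed

definition cov :: "('i \<Rightarrow> real) \<Rightarrow> ('i \<Rightarrow> real) \<Rightarrow> real" where
  "cov v w = (\<Sum>i\<in>I. \<Sum>j\<in>I. v i * K i j * w j)"

text \<open>Since \<open>K\<close> inverts \<open>H\<close>, every linear form is a combination of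
  the partial derivatives of \<open>Q\<close>; this extends \<open>ibp_coord\<close> to arbitrary
  linear factors.\<close>

lemma lin_eq_Hessian: "lin v x = (\<Sum>i\<in>I. (\<Sum>j\<in>I. v j * K j i) * (\<Sum>l\<in>I. H i l * x l))"
proof -
  have "(\<Sum>i\<in>I. (\<Sum>j\<in>I. v j * K j i) * (\<Sum>l\<in>I. H i l * x l))
      = (\<Sum>i\<in>I. \<Sum>j\<in>I. \<Sum>l\<in>I. v j * (K j i * H i l) * x l)"
    by (simp add: sum_product mult.assoc)
  also have "\<dots> = (\<Sum>j\<in>I. \<Sum>i\<in>I. \<Sum>l\<in>I. v j * (K j i * H i l) * x l)"
    by (rule sum.swap)
  also have "\<dots> = (\<Sum>j\<in>I. \<Sum>l\<in>I. \<Sum>i\<in>I. v j * (K j i * H i l) * x l)"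
    by (intro sum.cong refl sum.swap)
  also have "\<dots> = (\<Sum>j\<in>I. \<Sum>l\<in>I. v j * (\<Sum>i\<in>I. K j i * H i l) * x l)"
    by (simp add: sum_distrib_left sum_distrib_right)
  also have "\<dots> = (\<Sum>j\<in>I. \<Sum>l\<in>I. if l = j then v j * x l else 0)"
    by (intro sum.cong refl) (auto simp: KH)
  also have "\<dots> = lin v x" by (simp add: lin_def)
  finally show ?thesis by simp
qed

lemma ibp:
  assumes G: "has_grad G D"
  shows "E (\<lambda>x. lin v x * G x) = E (\<lambda>x. \<Sum>i\<in>I. (\<Sum>j\<in>I. v j * K j i) * D x i)"
proof -
  have tG: "tame G" and tD: "\<And>i. i \<in> I \<Longrightarrow> tame (\<lambda>x. D x i)" using G by (auto dest: has_gradD)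
  have "E (\<lambda>x. lin v x * G x) = E (\<lambda>x. \<Sum>i\<in>I. (\<Sum>j\<in>I. v j * K j i) * ((\<Sum>l\<in>I. H i l * x l) * G x))"
    by (simp add: lin_eq_Hessian sum_distrib_right mult.assoc)
  also have "\<dots> = (\<Sum>i\<in>I. (\<Sum>j\<in>I. v j * K j i) * E (\<lambda>x. (\<Sum>l\<in>I. H i l * x l) * G x))"
    using tG by (simp add: integrable_P)
  also have "\<dots> = (\<Sum>i\<in>I. (\<Sum>j\<in>I. v j * K j i) * E (\<lambda>x. D x i))"
    by (intro sum.cong refl) (simp add: ibp_coord[OF G])
  also have "\<dots> = E (\<lambda>x. \<Sum>i\<in>I. (\<Sum>j\<in>I. v j * K j i) * D x i)"
    using tD by (simp add: integrable_P)
  finally show ?thesis .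
qed

end

section \<open>Wick recursion and decorrelation\<close>

text \<open>All ways of taking one element out, the rest kept in order. In the Wick recursion these
  are the possible partners of the leading factor; positions and not values are counted, since
  factors may repeat.\<close>

fun splits :: "'a list \<Rightarrow> ('a \<times> 'a list) list" where
  "splits [] = []"
| "splits (x # xs) = (x, xs) # map (\<lambda>(z, zs). (z, x # zs)) (splits xs)"

lemma length_splits [simp]: "length (splits xs) = length xs"
  by (induction xs) auto

lemma set_splitsD: "(z, zs) \<in> set (splits xs) \<Longrightarrow> z \<in> set xs \<and> set zs \<subseteq> set xs \<and> length xs = Suc (length zs)"
  by (induction xs arbitrary: zs) fastforce+

lemma splits_append: "splits (xs @ ys) =
    map (\<lambda>(z, zs). (z, zs @ ys)) (splits xs) @ map (\<lambda>(z, zs). (z, xs @ zs)) (splits ys)"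
  by (induction xs) (auto simp: comp_def case_prod_beta)

lemma sum_list_splits:
  fixes f :: "'a \<Rightarrow> 'b :: comm_monoid_add"
  shows "(z, zs) \<in> set (splits xs) \<Longrightarrow> sum_list (map f xs) = f z + sum_list (map f zs)"
  by (induction xs arbitrary: zs) (auto simp: ac_simps)

lemma map_fst_splits: "map fst (splits xs) = xs"
  by (induction xs) (auto simp: comp_def case_prod_beta)

lemma abs_sum_list_le:
  fixes f g :: "'a \<Rightarrow> real"
  assumes "\<And>x. x \<in> set xs \<Longrightarrow> \<bar>f x\<bar> \<le> g x"
  shows "\<bar>sum_list (map f xs)\<bar> \<le> sum_list (map g xs)"
  using assms by (induction xs) (auto intro!: order_trans[OF abs_triangle_ineq] add_mono)

context gaussian_form
begin

definition lprod :: "('i \<Rightarrow> real) list \<Rightarrow> ('i \<Rightarrow> real) \<Rightarrow> real" where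
  "lprod L x = prod_list (map (\<lambda>v. lin v x) L)"

lemma lprod_Nil [simp]: "lprod [] = (\<lambda>_. 1)"
  and lprod_Cons: "lprod (v # L) = (\<lambda>x. lin v x * lprod L x)"
  and lprod_append: "lprod (L @ M) = (\<lambda>x. lprod L x * lprod M x)"
  by (auto simp: lprod_def fun_eq_iff)

lemma tame_lprod [simp, intro]: "tame (lprod L)"
  by (induction L) (auto simp: lprod_Cons)

lemma has_grad_lprod:
  "has_grad (lprod L) (\<lambda>x i. \<Sum>(w, M)\<leftarrow>splits L. (if i \<in> I then w i else 0) * lprod M x)"
proof (induction L)
  case Nil
  then show ?case using has_grad_const[of 1] by simp
next
  case (Cons v L)
  have eq: "(\<Sum>(w, M)\<leftarrow>splits (v # L). (if i \<in> I then w i else 0) * lprod M x) =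
    (if i \<in> I then v i else 0) * lprod L x + lin v x * (\<Sum>(w, M)\<leftarrow>splits L. (if i \<in> I then w i else 0) * lprod M x)"
    for x i
    by (simp add: comp_def case_prod_beta lprod_Cons sum_list_const_mult[symmetric] mult.left_commute)
  show ?case
    unfolding eq lprod_Cons by (rule has_grad_mult[OF has_grad_lin Cons.IH])
qed

lemma sum_weighted_lin: "(\<Sum>i\<in>I. (\<Sum>j\<in>I. v j * K j i) * (if i \<in> I then w i else 0)) = cov v w"
proof -
  have "(\<Sum>i\<in>I. (\<Sum>j\<in>I. v j * K j i) * (if i \<in> I then w i else 0)) = (\<Sum>i\<in>I. \<Sum>j\<in>I. v j * K j i * w i)"
    by (simp add: sum_distrib_right)
  also have "\<dots> = cov v w" unfolding cov_def by (rule sum.swap)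
  finally show ?thesis .
qed

lemma sum_sum_list_swap:
  fixes f :: "'x \<Rightarrow> 'y \<Rightarrow> real"
  shows "(\<Sum>i\<in>A. \<Sum>y\<leftarrow>ys. f i y) = (\<Sum>y\<leftarrow>ys. \<Sum>i\<in>A. f i y)"
  by (induction ys) (auto simp: sum.distrib)

text \<open>Integration by parts against the leading factor: by the Leibniz rule the gradient of
  \<open>lprod L\<close> deletes one factor at a time, and each deleted factor leaves a
  covariance.\<close>

lemma wick: "E (\<lambda>x. lin v x * lprod L x) = (\<Sum>(w, M)\<leftarrow>splits L. cov v w * E (lprod M))"
proof -
  have "E (\<lambda>x. lin v x * lprod L x) =
    E (\<lambda>x. \<Sum>i\<in>I. (\<Sum>j\<in>I. v j * K j i) * (\<Sum>(w, M)\<leftarrow>splits L. (if i \<in> I then w i else 0) * lprod M x))"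
    by (rule ibp[OF has_grad_lprod])
  also have "\<dots> = E (\<lambda>x. \<Sum>(w, M)\<leftarrow>splits L. cov v w * lprod M x)"
  proof (rule arg_cong[where f = E], rule ext)
    fix x
    show "(\<Sum>i\<in>I. (\<Sum>j\<in>I. v j * K j i) * (\<Sum>(w, M)\<leftarrow>splits L. (if i \<in> I then w i else 0) * lprod M x))
       = (\<Sum>(w, M)\<leftarrow>splits L. cov v w * lprod M x)"
      unfolding sum_weighted_lin[symmetric] sum_list_const_mult[symmetric] sum_sum_list_swap
      by (simp add: case_prod_unfold sum_distrib_right mult.assoc cong: sum.cong)
  qed
  also have "\<dots> = (\<Sum>(w, M)\<leftarrow>splits L. cov v w * E (lprod M))"
  proof -
    have "integrable P (\<lambda>x. \<Sum>(w, M)\<leftarrow>ys. cov v w * lprod M x) \<and>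
       E (\<lambda>x. \<Sum>(w, M)\<leftarrow>ys. cov v w * lprod M x) = (\<Sum>(w, M)\<leftarrow>ys. cov v w * E (lprod M))" for ys
      by (induction ys) (auto simp: integrable_P)
    then show ?thesis by blast
  qed
  finally show ?thesis .
qed

lemma E_lin_lin: "E (\<lambda>x. lin v x * lin w x) = cov v w"
  using wick[of v "[w]"] by (simp add: lprod_Cons prob_space[unfolded space_P])

section \<open>Covariance inequalities and the Laplace transform\<close>

lemma cov_sym: "cov v w = cov w v"
  unfolding E_lin_lin[symmetric] by (simp add: mult.commute)

lemma cov_nonneg: "0 \<le> cov v v"
  unfolding E_lin_lin[symmetric] by (intro Bochner_Integration.integral_nonneg) auto

text \<open>The arithmetic mean suffices in place of the Cauchy-Schwarz bound, because the diagonal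
  values are always estimated by one common constant.\<close>

lemma abs_cov_le: "\<bar>cov v w\<bar> \<le> (cov v v + cov w w) / 2"
proof -
  have "\<bar>cov v w\<bar> \<le> E (\<lambda>x. \<bar>lin v x * lin w x\<bar>)"
    unfolding E_lin_lin[symmetric] by (rule integral_abs_bound)
  also have "\<dots> \<le> E (\<lambda>x. (lin v x * lin v x + lin w x * lin w x) / 2)"
  proof (intro integral_mono integrable_P)
    fix x
    have "0 \<le> (\<bar>lin v x\<bar> - \<bar>lin w x\<bar>)\<^sup>2" by simp
    then show "\<bar>lin v x * lin w x\<bar> \<le> (lin v x * lin v x + lin w x * lin w x) / 2"
      by (simp add: power2_eq_square algebra_simps abs_mult)
  qed auto
  also have "\<dots> = (cov v v + cov w w) / 2"
    unfolding E_lin_lin[symmetric] by (simp add: integrable_P)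
  finally show ?thesis .
qed

lemma lin_dual: "lin v (\<lambda>i. \<Sum>j\<in>I. w j * K j i) = cov w v"
proof -
  have "lin v (\<lambda>i. \<Sum>j\<in>I. w j * K j i) = (\<Sum>i\<in>I. \<Sum>j\<in>I. w j * K j i * v i)"
    by (simp add: lin_def sum_distrib_left mult.commute)
  also have "\<dots> = cov w v" unfolding cov_def by (rule sum.swap)
  finally show ?thesis .
qed

lemma Q_dual: "2 * Q (\<lambda>i. \<Sum>j\<in>I. v j * K j i) = cov v v"
proof -
  let ?w = "\<lambda>i. \<Sum>j\<in>I. v j * K j i"
  have "2 * Q w = (\<Sum>i\<in>I. w i * (\<Sum>l\<in>I. H i l * w l))" for w
    by (simp add: Q_def sum_distrib_left mult.commute mult.left_commute)
  then have "2 * Q ?w = (\<Sum>i\<in>I. ?w i * (\<Sum>l\<in>I. H i l * ?w l))" .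
  also have "\<dots> = cov v v"
    unfolding lin_eq_Hessian[symmetric] by (rule lin_dual)
  finally show ?thesis .
qed

text \<open>This bounds the operator norm of the covariance. For w the product of \<open>K\<close>
  with v, \<open>cov v v\<close> is the pairing of v with w and also twice \<open>Q w\<close>;
  coercivity bounds the norm of w by \<open>cov v v / \<kappa>\<close>, Cauchy-Schwarz closes the
  loop, and one factor \<open>cov v v\<close> cancels.\<close>

lemma cov_le: "cov v v \<le> (\<Sum>i\<in>I. (v i)\<^sup>2) / \<kappa>"
proof (cases "cov v v = 0")
  case True
  then show ?thesis using \<kappa>_pos by (simp add: sum_nonneg)
next
  case False
  then have pos: "0 < cov v v" using cov_nonneg[of v] by simp
  let ?w = "\<lambda>i. \<Sum>j\<in>I. v j * K j i"
  have "cov v v * cov v v = (lin v ?w)\<^sup>2"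
    by (simp add: lin_dual power2_eq_square)
  also have "\<dots> \<le> (\<Sum>i\<in>I. (v i)\<^sup>2) * (\<Sum>i\<in>I. (?w i)\<^sup>2)"
    unfolding lin_def by (rule Cauchy_Schwarz_ineq_sum)
  also have "\<dots> \<le> (\<Sum>i\<in>I. (v i)\<^sup>2) * (cov v v / \<kappa>)"
    using Q_lower[of ?w] Q_dual[of v] \<kappa>_pos by (intro mult_left_mono) (auto simp: field_simps sum_nonneg)
  finally have "cov v v * cov v v \<le> cov v v * ((\<Sum>i\<in>I. (v i)\<^sup>2) / \<kappa>)" by (simp add: mult.commute)
  then show ?thesis using pos by (rule mult_left_le_imp_le)
qed

lemma tame_exp_lin [simp, intro]: "tame (\<lambda>x. exp (lin v x))"
proof (rule tameI[of _ 1 "\<Sum>i\<in>I. \<bar>v i\<bar>"])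
  fix x
  have "lin v x \<le> (\<Sum>i\<in>I. (\<Sum>k\<in>I. \<bar>v k\<bar>) * \<bar>x i\<bar>)"
    unfolding lin_def
  proof (rule sum_mono)
    fix i assume "i \<in> I"
    then have "\<bar>v i\<bar> \<le> (\<Sum>k\<in>I. \<bar>v k\<bar>)" by (intro member_le_sum) auto
    then have "\<bar>v i\<bar> * \<bar>x i\<bar> \<le> (\<Sum>k\<in>I. \<bar>v k\<bar>) * \<bar>x i\<bar>" by (intro mult_right_mono) auto
    then show "v i * x i \<le> (\<Sum>k\<in>I. \<bar>v k\<bar>) * \<bar>x i\<bar>"
      using abs_ge_self[of "v i * x i"] by (simp add: abs_mult)
  qed
  then show "\<bar>exp (lin v x)\<bar> \<le> 1 * exp ((\<Sum>i\<in>I. \<bar>v i\<bar>) * (\<Sum>i\<in>I. \<bar>x i\<bar>))"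
    by (simp add: sum_distrib_left)
qed (auto simp: lin_def sum_nonneg)

lemma measurable_lin [measurable]: "lin v \<in> borel_measurable (lebPi I)"
  by (rule tame_measurable) auto

text \<open>Completing the square: after translation by the dual vector w the exponent
  \<open>- Q + lin v\<close> becomes \<open>- Q\<close> plus half the variance.\<close>

lemma E_exp_lin: "E (\<lambda>x. exp (lin v x)) = exp (cov v v / 2)"
proof -
  define w where "w i = (\<Sum>j\<in>I. v j * K j i)" for i
  have shift: "Q (\<lambda>i\<in>I. w i + 1 * x i) = Q x + lin v x + cov v v / 2" for x
  proof -
    have l: "lin v x = (\<Sum>i\<in>I. \<Sum>j\<in>I. H i j * w i * x j)"
      unfolding lin_eq_Hessian w_def[symmetric] by (simp add: sum_distrib_left mult.commute mult.left_commute)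
    also have "\<dots> = (\<Sum>i\<in>I. \<Sum>j\<in>I. H i j * x i * w j)"
      by (subst sum.swap) (intro sum.cong refl, metis H_sym mult.commute mult.assoc)
    finally have l': "lin v x = (\<Sum>i\<in>I. \<Sum>j\<in>I. H i j * x i * w j)" .
    have "2 * Q (\<lambda>i\<in>I. w i + 1 * x i) = (\<Sum>i\<in>I. \<Sum>j\<in>I. H i j * (w i + x i) * (w j + x j))"
      by (simp add: Q_def cong: sum.cong)
    also have "\<dots> = 2 * Q w + lin v x + lin v x + 2 * Q x"
    proof -
      have "2 * Q w + lin v x + lin v x + 2 * Q x = 2 * Q w + (\<Sum>i\<in>I. \<Sum>j\<in>I. H i j * w i * x j) 
         + (\<Sum>i\<in>I. \<Sum>j\<in>I. H i j * x i * w j) + 2 * Q x"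
        using l l' by simp
      also have "\<dots> = (\<Sum>i\<in>I. \<Sum>j\<in>I. H i j * (w i + x i) * (w j + x j))"
        by (simp add: Q_def sum.distrib[symmetric] algebra_simps)
      finally show ?thesis by simp
    qed
    also have "2 * Q w = cov v v" using Q_dual[of v] by (simp add: w_def[abs_def])
    finally have "2 * Q (\<lambda>i\<in>I. w i + 1 * x i) = 2 * (Q x + lin v x + cov v v / 2)"
      by (simp only: algebra_simps)
    then show ?thesis by (simp only: mult_left_cancel[OF zero_neq_numeral[symmetric]])
  qed
  have "density (distr (lebPi I) (lebPi I) (\<lambda>x. \<lambda>i\<in>I. w i + 1 * x i)) (\<lambda>_. 1) = lebPi I"
    using lebPi_affine[OF finite_I, of 1 w] by simp
  then have d: "distr (lebPi I) (lebPi I) (\<lambda>x. \<lambda>i\<in>I. w i + 1 * x i) = lebPi I"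
    by (simp add: density_1)
  have mQ: "(\<lambda>x. exp (- Q x + lin v x)) \<in> borel_measurable (lebPi I)" by measurable
  have lw: "lin v (\<lambda>i\<in>I. w i + 1 * x i) = cov v v + lin v x" for x
  proof -
    have "lin v w = cov v v" using lin_dual[of v v] by (simp add: w_def[abs_def])
    moreover have "lin v (\<lambda>i\<in>I. w i + 1 * x i) = lin v w + lin v x"
      by (simp add: lin_def sum.distrib algebra_simps cong: sum.cong)
    ultimately show ?thesis by simp
  qed
  have "(\<integral>x. exp (- Q x + lin v x) \<partial>lebPi I) = (\<integral>x. exp (- Q x + lin v x) \<partial>distr (lebPi I) (lebPi I) (\<lambda>x. \<lambda>i\<in>I. w i + 1 * x i))"
    by (simp only: d)
  also have "\<dots> = (\<integral>x. exp (- Q (\<lambda>i\<in>I. w i + 1 * x i) + lin v (\<lambda>i\<in>I. w i + 1 * x i)) \<partial>lebPi I)"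
    by (subst integral_distr) (use mQ in auto)
  also have "\<dots> = (\<integral>x. exp (cov v v / 2) * exp (- Q x) \<partial>lebPi I)"
    unfolding shift lw by (simp add: exp_add[symmetric] algebra_simps)
  also have "\<dots> = exp (cov v v / 2) * Zc" by (simp add: Zc_def)
  finally have "(\<integral>x. exp (lin v x) * exp (- Q x) \<partial>lebPi I) = exp (cov v v / 2) * Zc"
    by (simp add: exp_add[symmetric] algebra_simps)
  then show ?thesis using Zc_pos by (subst E_eq) auto
qed

text \<open>Counting the Wick pairings crudely by a factorial, and using \<open>1 \<le> S\<close> to
  raise exponents, treats even and odd lengths alike.\<close>

lemma abs_E_lprod_le:
  assumes "1 \<le> S" "\<And>v. v \<in> set L \<Longrightarrow> cov v v \<le> S"
  shows "\<bar>E (lprod L)\<bar> \<le> fact (length L) * S ^ length L"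
  using assms(2)
proof (induction L rule: length_induct)
  case (1 L)
  show ?case
  proof (cases L)
    case Nil
    then show ?thesis by (simp add: prob_space[unfolded space_P])
  next
    case (Cons v L')
    show ?thesis
    proof (cases "L' = []")
      case True
      then show ?thesis using Cons wick[of v "[]"] assms(1) by (simp add: lprod_Cons)
    next
      case False
      then obtain p where p: "length L' = Suc p" by (cases L') auto
      have "\<bar>E (lprod L)\<bar> \<le> (\<Sum>(w, M)\<leftarrow>splits L'. S * (fact p * S ^ p))"
        unfolding Cons lprod_Cons wick
      proof (rule abs_sum_list_le)
        fix z assume z: "z \<in> set (splits L')"
        obtain w M where [simp]: "z = (w, M)" by (cases z)
        have M: "w \<in> set L'" "set M \<subseteq> set L'" "length M = p"
          using set_splitsD[of w M L'] z p by auto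
        have "\<bar>cov v w\<bar> \<le> S"
          using abs_cov_le[of v w] "1.prems"[of v] "1.prems"[of w] M Cons by auto
        moreover have "\<bar>E (lprod M)\<bar> \<le> fact p * S ^ p"
        proof -
          have "length M < length L" "\<And>x. x \<in> set M \<Longrightarrow> cov x x \<le> S"
            using M p Cons "1.prems" by auto
          then show ?thesis using "1.IH" M(3) by auto
        qed
        ultimately show "\<bar>case z of (w, M) \<Rightarrow> cov v w * E (lprod M)\<bar> \<le> (case z of (w, M) \<Rightarrow> S * (fact p * S ^ p))"
          using assms(1) by (auto simp: abs_mult intro!: mult_mono)
      qed
      also have "\<dots> = real (Suc p) * (S * (fact p * S ^ p))"
        by (simp add: case_prod_unfold sum_list_triv p algebra_simps)
      also have "\<dots> = fact (Suc p) * S ^ Suc p" by simp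
      also have "\<dots> \<le> fact (Suc (Suc p)) * S ^ Suc (Suc p)"
        using assms(1) by (intro mult_mono fact_mono power_increasing) auto
      finally show ?thesis by (simp add: Cons p)
    qed
  qed
qed

definition cross :: "('i \<Rightarrow> real) list \<Rightarrow> ('i \<Rightarrow> real) list \<Rightarrow> real" where
  "cross L M = (\<Sum>v\<leftarrow>L. \<Sum>w\<leftarrow>M. \<bar>cov v w\<bar>)"

lemma cross_nonneg: "0 \<le> cross L M"
  unfolding cross_def by (auto intro!: sum_list_nonneg)

lemma cross_Cons: "cross (v # L) M = (\<Sum>w\<leftarrow>M. \<bar>cov v w\<bar>) + cross L M"
  by (simp add: cross_def)

text \<open>Wick applied to the leading factor of L. A partner inside L leaves a shorter instance of
  the same difference; a partner in M leaves a covariance between the two blocks, times a bounded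
  moment. In the product of expectations only partners inside L occur, so the terms of the second
  kind are the whole error.\<close>

lemma decorrelation:
  assumes S: "1 \<le> S" and "\<And>v. v \<in> set L \<union> set M \<Longrightarrow> cov v v \<le> S"
  shows "\<bar>E (lprod (L @ M)) - E (lprod L) * E (lprod M)\<bar>
    \<le> fact (length L + length M) * S ^ (length L + length M) * cross L M"
  using assms(2)
proof (induction L rule: length_induct)
  case (1 L)
  show ?case
  proof (cases L)
    case Nil
    then show ?thesis by (simp add: prob_space[unfolded space_P] cross_def)
  next
    case (Cons v L')
    define c where "c p = fact p * S ^ p" for p :: nat
    have cpos: "0 \<le> c p" for p using S by (simp add: c_def)
    have cmono: "p \<le> q \<Longrightarrow> c p \<le> c q" for p q
      unfolding c_def using S by (intro mult_mono fact_mono power_increasing) auto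
    define p where "p = length L' + length M"
    \<comment> \<open>The number of partners in \<open>L'\<close> is absorbed by the factorial. The
      truncated value of \<open>p - 1\<close> at \<open>p = 0\<close> is harmless, since then
      \<open>L'\<close> is empty.\<close>
    have step: "real (length L') * (S * c (p - 1)) \<le> c p"
    proof (cases "L' = []")
      case False
      then obtain q where q: "p = Suc q" and l: "length L' \<le> Suc q" unfolding p_def by (cases L') auto
      have "real (length L') * (S * c q) \<le> real (Suc q) * (S * c q)"
        using S cpos l by (intro mult_right_mono) auto
      then show ?thesis by (simp add: q c_def algebra_simps)
    qed (use cpos in simp)
    define X where "X =
      (\<Sum>(z, Z)\<leftarrow>splits L'. cov v z * (E (lprod (Z @ M)) - E (lprod Z) * E (lprod M)))
      + (\<Sum>(w, W)\<leftarrow>splits M. cov v w * E (lprod (L' @ W)))"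
    have X: "E (lprod (L @ M)) - E (lprod L) * E (lprod M) = X"
      unfolding X_def Cons append_Cons lprod_Cons wick splits_append
      by (simp only: case_prod_unfold right_diff_distrib sum_list_subtractf map_append sum_list_append map_map comp_def
          sum_list_mult_const[symmetric] mult.assoc fst_conv snd_conv)
    have "\<bar>X\<bar> \<le> (\<Sum>(z, Z)\<leftarrow>splits L'. S * (c (p - 1) * cross L' M)) 
        + (\<Sum>(w, W)\<leftarrow>splits M. \<bar>cov v w\<bar> * c p)"
      unfolding X_def
    proof (rule order_trans[OF abs_triangle_ineq], rule add_mono; rule abs_sum_list_le)
      fix x assume x: "x \<in> set (splits L')"
      obtain z Z where [simp]: "x = (z, Z)" by (cases x)
      have Z: "z \<in> set L'" "set Z \<subseteq> set L'" "length L' = Suc (length Z)"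
        using set_splitsD[of z Z L'] x by auto
      have "\<bar>cov v z\<bar> \<le> S"
        using abs_cov_le[of v z] "1.prems"[of v] "1.prems"[of z] Z Cons by auto
      moreover have "\<bar>E (lprod (Z @ M)) - E (lprod Z) * E (lprod M)\<bar> \<le> c (p - 1) * cross Z M"
      proof -
        have "length Z < length L" using Z Cons by simp
        moreover have "\<And>v. v \<in> set Z \<union> set M \<Longrightarrow> cov v v \<le> S" using "1.prems" Z Cons by auto
        ultimately show ?thesis using "1.IH" Z by (auto simp: c_def p_def)
      qed
      moreover have "cross Z M \<le> cross L' M"
        unfolding cross_def using sum_list_splits[of z Z L' "\<lambda>v. \<Sum>w\<leftarrow>M. \<bar>cov v w\<bar>"] x
        by (auto intro!: sum_list_nonneg)
      ultimately have "\<bar>cov v z\<bar> * \<bar>E (lprod (Z @ M)) - E (lprod Z) * E (lprod M)\<bar> \<le> S * (c (p - 1) * cross L' M)"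
        using S cpos[of "p - 1"] cross_nonneg[of L' M]
        by (intro mult_mono) (auto intro: order_trans mult_left_mono)
      then show "\<bar>case x of (z, Z) \<Rightarrow> cov v z * (E (lprod (Z @ M)) - E (lprod Z) * E (lprod M))\<bar>
        \<le> (case x of (z, Z) \<Rightarrow> S * (c (p - 1) * cross L' M))"
        by (simp add: abs_mult)
    next
      fix x assume x: "x \<in> set (splits M)"
      obtain w W where [simp]: "x = (w, W)" by (cases x)
      have W: "w \<in> set M" "set W \<subseteq> set M" "length M = Suc (length W)"
        using set_splitsD[of w W M] x by auto
      have "\<bar>E (lprod (L' @ W))\<bar> \<le> c (length (L' @ W))"
        unfolding c_def by (rule abs_E_lprod_le[OF S]) (use "1.prems" W Cons in auto)
      also have "\<dots> \<le> c p" by (rule cmono) (use W in \<open>auto simp: p_def\<close>)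
      finally show "\<bar>case x of (w, W) \<Rightarrow> cov v w * E (lprod (L' @ W))\<bar> \<le> (case x of (w, W) \<Rightarrow> \<bar>cov v w\<bar> * c p)"
        by (simp add: abs_mult mult_left_mono)
    qed
    also have "(\<Sum>(w, W)\<leftarrow>splits M. \<bar>cov v w\<bar> * c p) = (\<Sum>w\<leftarrow>M. \<bar>cov v w\<bar>) * c p"
    proof -
      have "(\<Sum>(w, W)\<leftarrow>splits M. \<bar>cov v w\<bar> * c p) = (\<Sum>w\<leftarrow>map fst (splits M). \<bar>cov v w\<bar> * c p)"
        by (simp only: case_prod_unfold map_map comp_def)
      then show ?thesis by (simp only: map_fst_splits sum_list_mult_const)
    qed
    also have "(\<Sum>(z, Z)\<leftarrow>splits L'. S * (c (p - 1) * cross L' M)) = real (length L') * (S * c (p - 1)) * cross L' M"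
      by (simp add: case_prod_unfold sum_list_triv algebra_simps)
    also have "\<dots> + (\<Sum>w\<leftarrow>M. \<bar>cov v w\<bar>) * c p \<le> c p * cross L' M + (\<Sum>w\<leftarrow>M. \<bar>cov v w\<bar>) * c p"
      using step cross_nonneg[of L' M] cpos by (intro add_mono mult_right_mono) auto
    also have "\<dots> = c p * cross L M" by (simp add: Cons cross_Cons algebra_simps)
    also have "\<dots> \<le> c (length L + length M) * cross L M"
      using cross_nonneg[of L M] by (intro mult_right_mono cmono) (auto simp: p_def Cons)
    finally show ?thesis by (simp add: c_def X)
  qed
qed

end

section \<open>Stein's method for cubic forms\<close>

text \<open>A remainder bound for every increment permits differentiating an expectation in a
  parameter without a limit theorem.\<close>

lemma has_real_derivative_quadratic_remainder:
  fixes F :: "real \<Rightarrow> real"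
  assumes "\<And>h. \<bar>F (x + h) - F x - h * D\<bar> \<le> C * h\<^sup>2"
  shows "(F has_real_derivative D) (at x)"
  unfolding DERIV_def
proof (rule LIM_zero_cancel, rule Lim_null_comparison)
  show "\<forall>\<^sub>F h in at 0. norm ((F (x + h) - F x) / h - D) \<le> C * \<bar>h\<bar>"
  proof (rule eventually_neq_at_within[THEN eventually_mono])
    fix h :: real assume h: "h \<noteq> 0"
    then have "(F (x + h) - F x) / h - D = (F (x + h) - F x - h * D) / h" by (auto simp: field_simps)
    then have "norm ((F (x + h) - F x) / h - D) = \<bar>F (x + h) - F x - h * D\<bar> / \<bar>h\<bar>" by simp
    also have "\<dots> \<le> C * h\<^sup>2 / \<bar>h\<bar>" using assms by (intro divide_right_mono) auto
    also have "\<dots> = C * \<bar>h\<bar>" using h by (auto simp: power2_eq_square divide_simps abs_if)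
    finally show "norm ((F (x + h) - F x) / h - D) \<le> C * \<bar>h\<bar>" .
  qed
  show "((\<lambda>h. C * \<bar>h\<bar>) \<longlongrightarrow> 0) (at 0)"
    by (auto intro!: tendsto_eq_intros)
qed

text \<open>The two inequalities are the real and the imaginary part of one remainder, that of exp(i
  b), rotated by the unit number exp(i a).\<close>

lemma cos_sin_taylor1:
  fixes a b :: real
  shows "\<bar>cos (a + b) - cos a + b * sin a\<bar> \<le> b\<^sup>2 / 2"
    and "\<bar>sin (a + b) - sin a - b * cos a\<bar> \<le> b\<^sup>2 / 2"
proof -
  define z where "z = iexp b - 1 - \<i> * b"
  have "cmod (iexp b - (\<Sum>k\<le>1. (\<i> * b)^k / fact k)) \<le> \<bar>b\<bar> ^ Suc 1 / fact (Suc 1)"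
    by (rule iexp_approx1)
  then have "cmod z \<le> b\<^sup>2 / 2" by (simp add: z_def power2_eq_square algebra_simps)
  then have z: "cmod (iexp a * z) \<le> b\<^sup>2 / 2" by (simp add: norm_mult)
  have "Re (iexp a * z) = cos (a + b) - cos a + b * sin a" "Im (iexp a * z) = sin (a + b) - sin a - b * cos a"
    by (auto simp: z_def Re_exp Im_exp cos_add sin_add algebra_simps)
  then show "\<bar>cos (a + b) - cos a + b * sin a\<bar> \<le> b\<^sup>2 / 2" "\<bar>sin (a + b) - sin a - b * cos a\<bar> \<le> b\<^sup>2 / 2"
    using z abs_Re_le_cmod[of "iexp a * z"] abs_Im_le_cmod[of "iexp a * z"] by auto
qed

context gaussian_form
begin

lemma has_grad_comp:
  assumes "has_grad F D" "\<And>y. (g has_real_derivative g' y) (at y)"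
    "tame (\<lambda>x. g (F x))" "tame (\<lambda>x. g' (F x))"
  shows "has_grad (\<lambda>x. g (F x)) (\<lambda>x i. g' (F x) * D x i)"
  unfolding has_grad_def
proof (intro conjI ballI allI)
  fix i x assume i: "i \<in> I"
  show "tame (\<lambda>x. g' (F x) * D x i)"
    using assms(1,4) i by (auto dest: has_gradD)
  have "((\<lambda>y. F (x(i := y))) has_real_derivative D x i) (at (x i))"
    using assms(1) i by (auto simp: has_grad_def)
  moreover have "(g has_real_derivative g' (F (x(i := x i)))) (at (F (x(i := x i))))"
    by (rule assms(2))
  ultimately show "((\<lambda>y. g (F (x(i := y)))) has_real_derivative g' (F x) * D x i) (at (x i))"
    using DERIV_chain2[of g _ "\<lambda>y. F (x(i := y))" "x i"] by auto
qed (use assms in auto)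

lemma has_grad_power:
  assumes "has_grad F D"
  shows "has_grad (\<lambda>x. F x ^ p) (\<lambda>x i. real p * F x ^ (p - 1) * D x i)"
proof (rule has_grad_comp[OF assms])
  show "((\<lambda>y. y ^ p) has_real_derivative real p * y ^ (p - 1)) (at y)" for y :: real
    by (auto intro!: derivative_eq_intros)
qed (use assms in \<open>auto dest: has_gradD\<close>)

lemma E_abs_le_sqrt:
  assumes "tame G" "E (\<lambda>x. (G x)\<^sup>2) \<le> s"
  shows "E (\<lambda>x. \<bar>G x\<bar>) \<le> sqrt s"
proof -
  have "0 \<le> variance (\<lambda>x. \<bar>G x\<bar>)" by (rule variance_positive)
  also have "variance (\<lambda>x. \<bar>G x\<bar>) = E (\<lambda>x. (G x)\<^sup>2) - (E (\<lambda>x. \<bar>G x\<bar>))\<^sup>2"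
    using assms(1) by (subst variance_eq) (auto intro!: integrable_P)
  finally have "(E (\<lambda>x. \<bar>G x\<bar>))\<^sup>2 \<le> s" using assms(2) by linarith
  then show ?thesis by (rule real_le_rsqrt)
qed

lemma E_mono: "tame F \<Longrightarrow> tame G \<Longrightarrow> (\<And>x. F x \<le> G x) \<Longrightarrow> E F \<le> E G"
  by (intro integral_mono integrable_P)

lemma variance_lprod_sum:
  assumes "finite \<Lambda>"
  shows "E (\<lambda>x. (\<Sum>l\<in>\<Lambda>. w l * (lprod (L l) x - E (lprod (L l))))\<^sup>2) =
    (\<Sum>l\<in>\<Lambda>. \<Sum>k\<in>\<Lambda>. w l * w k * (E (lprod (L l @ L k)) - E (lprod (L l)) * E (lprod (L k))))"
proof -
  have cv: "E (\<lambda>x. (lprod (L l) x - E (lprod (L l))) * (lprod (L k) x - E (lprod (L k)))) =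
      E (lprod (L l @ L k)) - E (lprod (L l)) * E (lprod (L k))" for l k
    by (simp add: algebra_simps lprod_append integrable_P prob_space[unfolded space_P])
  have "E (\<lambda>x. (\<Sum>l\<in>\<Lambda>. w l * (lprod (L l) x - E (lprod (L l))))\<^sup>2) =
    E (\<lambda>x. \<Sum>l\<in>\<Lambda>. \<Sum>k\<in>\<Lambda>. w l * w k * ((lprod (L l) x - E (lprod (L l))) * (lprod (L k) x - E (lprod (L k)))))"
    by (simp add: power2_eq_square sum_product mult_ac)
  also have "\<dots> = (\<Sum>l\<in>\<Lambda>. \<Sum>k\<in>\<Lambda>. w l * w k * (E (lprod (L l @ L k)) - E (lprod (L l)) * E (lprod (L k))))"
    by (simp add: integrable_P cv)
  finally show ?thesis .
qed

end

text \<open>The row sum \<rho> expresses weak dependence. In the application the index set has about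
  N^2 elements while \<rho> is only of order N, so every covariance in a multiple sum saves a factor
  N.\<close>

locale gaussian_family = gaussian_form I H \<kappa> for I :: "'i set" and H \<kappa> +
  fixes A :: "'a set" and v :: "'a \<Rightarrow> 'i \<Rightarrow> real" and S \<rho> :: real
  assumes finite_A [simp, intro]: "finite A"
    and S_ge_1: "1 \<le> S"
    and cov_diag_le: "\<And>a. a \<in> A \<Longrightarrow> cov (v a) (v a) \<le> S"
    and cov_row_le: "\<And>a. a \<in> A \<Longrightarrow> (\<Sum>b\<in>A. \<bar>cov (v a) (v b)\<bar>) \<le> \<rho>"
begin

abbreviation y :: "'a \<Rightarrow> ('i \<Rightarrow> real) \<Rightarrow> real" where "y a \<equiv> lin (v a)"
abbreviation k :: "'a \<Rightarrow> 'a \<Rightarrow> real" where "k a b \<equiv> cov (v a) (v b)"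

lemma k_col_le: "b \<in> A \<Longrightarrow> (\<Sum>a\<in>A. \<bar>k a b\<bar>) \<le> \<rho>"
  using cov_row_le[of b] by (simp add: cov_sym)

lemma \<rho>_nonneg: "a \<in> A \<Longrightarrow> 0 \<le> \<rho>"
  using cov_row_le[of a] by (meson abs_ge_zero order_trans sum_nonneg)

definition cubic :: "('a \<Rightarrow> real) \<Rightarrow> ('i \<Rightarrow> real) \<Rightarrow> real" where
  "cubic c x = (\<Sum>a\<in>A. c a * y a x ^ 3)"

text \<open>The gradient of the cubic form paired with the gradient of its preimage under the (negative)
  Ornstein-Uhlenbeck operator of the Gaussian measure.\<close>
definition stein :: "('a \<Rightarrow> real) \<Rightarrow> ('i \<Rightarrow> real) \<Rightarrow> real" where
  "stein c x = (\<Sum>a\<in>A. c a * ((y a x ^ 2 + 2 * k a a) * (\<Sum>b\<in>A. 3 * c b * k a b * y b x ^ 2)))"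

lemma tame_cubic [simp, intro]: "tame (cubic c)"
  unfolding cubic_def[abs_def] by auto

lemma tame_stein [simp, intro]: "tame (stein c)"
  unfolding stein_def[abs_def] by auto

lemma has_grad_cubic: "has_grad (cubic c) (\<lambda>x i. \<Sum>b\<in>A. c b * (real 3 * y b x ^ (3 - 1) * (if i \<in> I then v b i else 0)))"
  unfolding cubic_def[abs_def] by (intro has_grad_sum has_grad_cmult has_grad_power has_grad_lin)

lemma weighted_gradient_sum:
  fixes P G q G' :: real
  shows "(\<Sum>i\<in>I. W i * ((P * d i) * G + q * (G' * (\<Sum>b\<in>B. c b * (r b * e b i))))) =
    P * (\<Sum>i\<in>I. W i * d i) * G + q * (G' * (\<Sum>b\<in>B. c b * (r b * (\<Sum>i\<in>I. W i * e b i))))"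
proof -
  have "(\<Sum>i\<in>I. W i * ((P * d i) * G + q * (G' * (\<Sum>b\<in>B. c b * (r b * e b i))))) =
    (\<Sum>i\<in>I. W i * ((P * d i) * G)) + (\<Sum>i\<in>I. W i * (q * (G' * (\<Sum>b\<in>B. c b * (r b * e b i)))))"
    by (simp only: distrib_left sum.distrib)
  moreover have "(\<Sum>i\<in>I. W i * ((P * d i) * G)) = P * (\<Sum>i\<in>I. W i * d i) * G"
    by (simp add: sum_distrib_left sum_distrib_right mult_ac)
  moreover have "(\<Sum>i\<in>I. W i * (q * (G' * (\<Sum>b\<in>B. c b * (r b * e b i))))) =
      (\<Sum>i\<in>I. \<Sum>b\<in>B. q * (G' * (c b * (r b * (W i * e b i)))))"
    by (simp add: sum_distrib_left mult_ac)
  moreover have "\<dots> = q * (G' * (\<Sum>b\<in>B. c b * (r b * (\<Sum>i\<in>I. W i * e b i))))"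
    by (subst sum.swap) (simp add: sum_distrib_left)
  ultimately show ?thesis by simp
qed

lemma ibp_cubic:
  assumes g: "\<And>y. (g has_real_derivative g' y) (at y)"
    and tame: "tame (\<lambda>x. g (cubic c x))" "tame (\<lambda>x. g' (cubic c x))"
  shows "E (\<lambda>x. lin u x * (lin w x ^ p * g (cubic c x))) =
    E (\<lambda>x. real p * lin w x ^ (p - 1) * cov u w * g (cubic c x)
      + lin w x ^ p * (g' (cubic c x) * (\<Sum>b\<in>A. 3 * c b * cov u (v b) * y b x ^ 2)))"
proof -
  define W where "W i = (\<Sum>j\<in>I. u j * K j i)" for i
  have W: "(\<Sum>i\<in>I. W i * (if i \<in> I then w i else 0)) = cov u w" for w
    unfolding W_def by (rule sum_weighted_lin)
  have "E (\<lambda>x. lin u x * (lin w x ^ p * g (cubic c x))) = E (\<lambda>x. \<Sum>i\<in>I. W i *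
     ((real p * lin w x ^ (p - 1) * (if i \<in> I then w i else 0)) * g (cubic c x) +
      lin w x ^ p * (g' (cubic c x) * (\<Sum>b\<in>A. c b * (real 3 * y b x ^ (3 - 1) * (if i \<in> I then v b i else 0))))))"
    unfolding W_def
    by (rule ibp, rule has_grad_mult[OF has_grad_power[OF has_grad_lin] has_grad_comp[OF has_grad_cubic g tame]])
  also have "\<dots> = E (\<lambda>x. real p * lin w x ^ (p - 1) * cov u w * g (cubic c x)
      + lin w x ^ p * (g' (cubic c x) * (\<Sum>b\<in>A. 3 * c b * cov u (v b) * y b x ^ 2)))"
    unfolding weighted_gradient_sum W by (simp add: mult_ac)
  finally show ?thesis .
qed

text \<open>Integrating \<open>y a x ^ 3 * g\<close> by parts against one factor leaves
  \<open>2 * k a a * y a x * g\<close>, which is integrated by parts once more. The two gradient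
  terms have the weights \<open>y a x ^ 2\<close> and \<open>2 * k a a\<close>: the gradient of
  y^3/3 + 2 k y, which the negative Ornstein-Uhlenbeck operator sends to y^3.\<close>

lemma stein_identity:
  assumes g: "\<And>y. (g has_real_derivative g' y) (at y)"
    and tame: "tame (\<lambda>x. g (cubic c x))" "tame (\<lambda>x. g' (cubic c x))"
  shows "E (\<lambda>x. cubic c x * g (cubic c x)) = E (\<lambda>x. stein c x * g' (cubic c x))"
proof -
  let ?B = "\<lambda>a x. \<Sum>b\<in>A. 3 * c b * k a b * y b x ^ 2"
  have one: "E (\<lambda>x. y a x ^ 3 * g (cubic c x)) = E (\<lambda>x. (y a x ^ 2 + 2 * k a a) * ?B a x * g' (cubic c x))" for a
  proof -
    have "E (\<lambda>x. y a x ^ 3 * g (cubic c x)) = E (\<lambda>x. y a x * (y a x ^ 2 * g (cubic c x)))"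
      by (simp add: power3_eq_cube power2_eq_square mult_ac)
    also have "\<dots> = E (\<lambda>x. 2 * k a a * (y a x * g (cubic c x)) + y a x ^ 2 * (g' (cubic c x) * ?B a x))"
      by (subst ibp_cubic[OF g tame]) (simp add: mult_ac)
    also have "\<dots> = 2 * k a a * E (\<lambda>x. y a x * g (cubic c x)) + E (\<lambda>x. y a x ^ 2 * (g' (cubic c x) * ?B a x))"
      using tame by (simp add: integrable_P)
    also have "E (\<lambda>x. y a x * g (cubic c x)) = E (\<lambda>x. g' (cubic c x) * ?B a x)"
      using ibp_cubic[OF g tame, of "v a" _ 0] by simp
    also have "2 * k a a * E (\<lambda>x. g' (cubic c x) * ?B a x) + E (\<lambda>x. y a x ^ 2 * (g' (cubic c x) * ?B a x))
       = E (\<lambda>x. 2 * k a a * (g' (cubic c x) * ?B a x) + y a x ^ 2 * (g' (cubic c x) * ?B a x))"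
      using tame by (simp add: integrable_P)
    also have "\<dots> = E (\<lambda>x. (y a x ^ 2 + 2 * k a a) * ?B a x * g' (cubic c x))"
      by (simp add: algebra_simps)
    finally show ?thesis .
  qed
  have "E (\<lambda>x. cubic c x * g (cubic c x)) = E (\<lambda>x. \<Sum>a\<in>A. c a * (y a x ^ 3 * g (cubic c x)))"
    unfolding cubic_def[of c x for x] by (simp add: sum_distrib_right mult.assoc)
  also have "\<dots> = (\<Sum>a\<in>A. c a * E (\<lambda>x. y a x ^ 3 * g (cubic c x)))"
    using tame by (simp add: integrable_P)
  also have "\<dots> = (\<Sum>a\<in>A. c a * E (\<lambda>x. (y a x ^ 2 + 2 * k a a) * ?B a x * g' (cubic c x)))"
    by (simp only: one)
  also have "\<dots> = E (\<lambda>x. \<Sum>a\<in>A. c a * ((y a x ^ 2 + 2 * k a a) * ?B a x * g' (cubic c x)))"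
    using tame by (simp add: integrable_P)
  also have "\<dots> = E (\<lambda>x. stein c x * g' (cubic c x))"
    unfolding stein_def[of c x for x] by (simp add: sum_distrib_right mult.assoc)
  finally show ?thesis .
qed

lemma E_cubic_square: "E (\<lambda>x. (cubic c x)\<^sup>2) = E (stein c)"
  using stein_identity[of "\<lambda>y. y" "\<lambda>_. 1" c] by (simp add: power2_eq_square)

text \<open>For \<phi>(t), the mean of cos(t f), Stein's identity gives \<phi>' = - t E(T cos(t f))
  with T = \<open>stein c\<close>. If T were constantly \<mu>, the product of \<phi> with exp(t^2
  \<mu>/2) would be constant; its derivative measures the deviation of T from its mean. The sine is
  treated in the same way, starting from 0.\<close>

lemma characteristic_function_cubic:
  fixes c
  defines "\<mu> \<equiv> E (\<lambda>x. (cubic c x)\<^sup>2)"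
  shows "\<bar>E (\<lambda>x. cos (cubic c x)) - exp (- \<mu> / 2)\<bar> \<le> E (\<lambda>x. \<bar>stein c x - \<mu>\<bar>)"
    and "\<bar>E (\<lambda>x. sin (cubic c x))\<bar> \<le> E (\<lambda>x. \<bar>stein c x - \<mu>\<bar>)"
proof -
  define \<phi> where "\<phi> t = E (\<lambda>x. cos (t * cubic c x))" for t
  define \<sigma> where "\<sigma> t = E (\<lambda>x. sin (t * cubic c x))" for t
  have [measurable]: "cubic c \<in> borel_measurable (lebPi I)" by (rule tame_measurable) auto
  have tc: "tame (\<lambda>x. cos (t * cubic c x))" and ts: "tame (\<lambda>x. sin (t * cubic c x))" for t
    by (auto intro!: tame_bounded[where b = 1])
  have \<mu>0: "0 \<le> \<mu>" unfolding \<mu>_def by (intro Bochner_Integration.integral_nonneg) auto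
  let ?M = "E (\<lambda>x. \<bar>stein c x - \<mu>\<bar>)"
  have bound: "\<bar>E (\<lambda>x. (\<mu> - stein c x) * G x)\<bar> \<le> ?M" if "tame G" "\<And>x. \<bar>G x\<bar> \<le> 1" for G
  proof -
    have "\<bar>E (\<lambda>x. (\<mu> - stein c x) * G x)\<bar> \<le> E (\<lambda>x. \<bar>(\<mu> - stein c x) * G x\<bar>)"
      by (rule integral_abs_bound)
    also have "\<dots> \<le> ?M"
    proof (rule E_mono)
      show "\<bar>(\<mu> - stein c x) * G x\<bar> \<le> \<bar>stein c x - \<mu>\<bar>" for x
        using that(2)[of x] mult_left_mono[of "\<bar>G x\<bar>" 1 "\<bar>\<mu> - stein c x\<bar>"] by (simp add: abs_mult abs_minus_commute)
    qed (use that in auto)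
    finally show ?thesis .
  qed
  have d\<phi>: "(\<phi> has_real_derivative - E (\<lambda>x. cubic c x * sin (t * cubic c x))) (at t)" for t
  proof (rule has_real_derivative_quadratic_remainder[where C = "\<mu> / 2"])
    fix h
    define R where "R x = cos ((t + h) * cubic c x) - cos (t * cubic c x) + h * (cubic c x * sin (t * cubic c x))" for x
    have tR: "tame R" unfolding R_def[abs_def] using tc ts by auto
    have "\<phi> (t + h) - \<phi> t - h * - E (\<lambda>x. cubic c x * sin (t * cubic c x)) = E R"
      unfolding \<phi>_def R_def using tc ts by (simp add: integrable_P)
    moreover have "\<bar>E R\<bar> \<le> E (\<lambda>x. \<bar>R x\<bar>)" by (rule integral_abs_bound)
    moreover have "E (\<lambda>x. \<bar>R x\<bar>) \<le> E (\<lambda>x. h\<^sup>2 / 2 * (cubic c x)\<^sup>2)"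
    proof (rule E_mono)
      show "\<bar>R x\<bar> \<le> h\<^sup>2 / 2 * (cubic c x)\<^sup>2" for x
        using cos_sin_taylor1(1)[of "t * cubic c x" "h * cubic c x"]
        by (simp add: R_def distrib_right power_mult_distrib mult.assoc)
    qed (use tR in auto)
    moreover have "E (\<lambda>x. h\<^sup>2 / 2 * (cubic c x)\<^sup>2) = \<mu> / 2 * h\<^sup>2" by (simp add: \<mu>_def)
    ultimately show "\<bar>\<phi> (t + h) - \<phi> t - h * - E (\<lambda>x. cubic c x * sin (t * cubic c x))\<bar> \<le> \<mu> / 2 * h\<^sup>2" by linarith
  qed
  have d\<sigma>: "(\<sigma> has_real_derivative E (\<lambda>x. cubic c x * cos (t * cubic c x))) (at t)" for t
  proof (rule has_real_derivative_quadratic_remainder[where C = "\<mu> / 2"])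
    fix h
    define R where "R x = sin ((t + h) * cubic c x) - sin (t * cubic c x) - h * (cubic c x * cos (t * cubic c x))" for x
    have tR: "tame R" unfolding R_def[abs_def] using tc ts by auto
    have "\<sigma> (t + h) - \<sigma> t - h * E (\<lambda>x. cubic c x * cos (t * cubic c x)) = E R"
      unfolding \<sigma>_def R_def using tc ts by (simp add: integrable_P)
    moreover have "\<bar>E R\<bar> \<le> E (\<lambda>x. \<bar>R x\<bar>)" by (rule integral_abs_bound)
    moreover have "E (\<lambda>x. \<bar>R x\<bar>) \<le> E (\<lambda>x. h\<^sup>2 / 2 * (cubic c x)\<^sup>2)"
    proof (rule E_mono)
      show "\<bar>R x\<bar> \<le> h\<^sup>2 / 2 * (cubic c x)\<^sup>2" for x
        using cos_sin_taylor1(2)[of "t * cubic c x" "h * cubic c x"]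
        by (simp add: R_def distrib_right power_mult_distrib mult.assoc)
    qed (use tR in auto)
    moreover have "E (\<lambda>x. h\<^sup>2 / 2 * (cubic c x)\<^sup>2) = \<mu> / 2 * h\<^sup>2" by (simp add: \<mu>_def)
    ultimately show "\<bar>\<sigma> (t + h) - \<sigma> t - h * E (\<lambda>x. cubic c x * cos (t * cubic c x))\<bar> \<le> \<mu> / 2 * h\<^sup>2" by linarith
  qed
  have s\<phi>: "E (\<lambda>x. cubic c x * sin (t * cubic c x)) = t * E (\<lambda>x. stein c x * cos (t * cubic c x))" for t
  proof -
    have "E (\<lambda>x. cubic c x * sin (t * cubic c x)) = E (\<lambda>x. stein c x * (t * cos (t * cubic c x)))"
      by (rule stein_identity[where g = "\<lambda>y. sin (t * y)" and g' = "\<lambda>y. t * cos (t * y)"])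
        (use tc ts in \<open>auto intro!: derivative_eq_intros\<close>)
    then show ?thesis by (simp add: mult.left_commute)
  qed
  have s\<sigma>: "E (\<lambda>x. cubic c x * cos (t * cubic c x)) = - t * E (\<lambda>x. stein c x * sin (t * cubic c x))" for t
  proof -
    have "E (\<lambda>x. cubic c x * cos (t * cubic c x)) = E (\<lambda>x. stein c x * (- t * sin (t * cubic c x)))"
      by (rule stein_identity[where g = "\<lambda>y. cos (t * y)" and g' = "\<lambda>y. - t * sin (t * y)"])
        (use tc ts in \<open>auto intro!: derivative_eq_intros\<close>)
    then show ?thesis by (simp add: mult.left_commute)
  qed
  \<comment> \<open>The mean value theorem replaces integration over t. The factor
    \<open>exp (\<mu> / 2)\<close> lost here is regained exactly when the integrating factor at time
    1 is divided out.\<close>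
  have mv: "\<bar>\<psi> 1 - \<psi> 0\<bar> \<le> exp (\<mu> / 2) * ?M"
    if d\<psi>: "\<And>t. (\<psi> has_real_derivative t * exp (t\<^sup>2 * \<mu> / 2) * E (\<lambda>x. (\<mu> - stein c x) * G t x)) (at t)"
      "\<And>t. tame (G t)" "\<And>t x. \<bar>G t x\<bar> \<le> 1" for \<psi> :: "real \<Rightarrow> real" and G
  proof -
    obtain t where t: "0 < t" "t < 1" and eq: "\<psi> 1 - \<psi> 0 = (1 - 0) * (t * exp (t\<^sup>2 * \<mu> / 2) * E (\<lambda>x. (\<mu> - stein c x) * G t x))"
      using MVT2[of 0 1 \<psi> "\<lambda>t. t * exp (t\<^sup>2 * \<mu> / 2) * E (\<lambda>x. (\<mu> - stein c x) * G t x)"] d\<psi> by auto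
    have "t\<^sup>2 * \<mu> \<le> 1 * \<mu>" using t \<mu>0 by (intro mult_right_mono) (auto simp: power_le_one)
    then have "t * exp (t\<^sup>2 * \<mu> / 2) \<le> 1 * exp (\<mu> / 2)" using t by (intro mult_mono) auto
    then show ?thesis
      unfolding eq using t bound[OF that(2,3)] by (auto simp: abs_mult intro!: mult_mono)
  qed
  have de: "((\<lambda>t. exp (t\<^sup>2 * \<mu> / 2)) has_real_derivative t * \<mu> * exp (t\<^sup>2 * \<mu> / 2)) (at t)" for t
    by (auto intro!: derivative_eq_intros)
  have id: "E (\<lambda>x. (\<mu> - stein c x) * G x) = \<mu> * E G - E (\<lambda>x. stein c x * G x)" if "tame G" for G
    using that by (simp add: left_diff_distrib integrable_P)
  have "\<bar>\<phi> 1 * exp (1\<^sup>2 * \<mu> / 2) - \<phi> 0 * exp (0\<^sup>2 * \<mu> / 2)\<bar> \<le> exp (\<mu> / 2) * ?M"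
  proof (rule mv[of "\<lambda>t. \<phi> t * exp (t\<^sup>2 * \<mu> / 2)" "\<lambda>t x. cos (t * cubic c x)"])
    show "((\<lambda>t. \<phi> t * exp (t\<^sup>2 * \<mu> / 2)) has_real_derivative
        t * exp (t\<^sup>2 * \<mu> / 2) * E (\<lambda>x. (\<mu> - stein c x) * cos (t * cubic c x))) (at t)" for t
      by (rule DERIV_cong[OF DERIV_mult'[OF d\<phi> de]]) (simp only: id[OF tc] s\<phi>, simp add: \<phi>_def algebra_simps)
  qed (use tc in auto)
  then have 1: "\<bar>\<phi> 1 * exp (\<mu> / 2) - 1\<bar> \<le> exp (\<mu> / 2) * ?M"
    by (simp add: \<phi>_def prob_space[unfolded space_P])
  have "\<phi> 1 - exp (- \<mu> / 2) = (\<phi> 1 * exp (\<mu> / 2) - 1) * exp (- \<mu> / 2)"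
    by (simp add: algebra_simps exp_add[symmetric])
  then have "\<bar>\<phi> 1 - exp (- \<mu> / 2)\<bar> = \<bar>\<phi> 1 * exp (\<mu> / 2) - 1\<bar> * exp (- \<mu> / 2)" by (simp add: abs_mult)
  also have "\<dots> \<le> exp (\<mu> / 2) * ?M * exp (- \<mu> / 2)" using 1 by (intro mult_right_mono) auto
  also have "\<dots> = ?M" by (simp add: mult_ac exp_minus)
  finally show "\<bar>E (\<lambda>x. cos (cubic c x)) - exp (- \<mu> / 2)\<bar> \<le> ?M" by (simp add: \<phi>_def)
  have "\<bar>\<sigma> 1 * exp (1\<^sup>2 * \<mu> / 2) - \<sigma> 0 * exp (0\<^sup>2 * \<mu> / 2)\<bar> \<le> exp (\<mu> / 2) * ?M"
  proof (rule mv[of "\<lambda>t. \<sigma> t * exp (t\<^sup>2 * \<mu> / 2)" "\<lambda>t x. sin (t * cubic c x)"])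
    show "((\<lambda>t. \<sigma> t * exp (t\<^sup>2 * \<mu> / 2)) has_real_derivative
        t * exp (t\<^sup>2 * \<mu> / 2) * E (\<lambda>x. (\<mu> - stein c x) * sin (t * cubic c x))) (at t)" for t
      by (rule DERIV_cong[OF DERIV_mult'[OF d\<sigma> de]]) (simp only: id[OF ts] s\<sigma>, simp add: \<sigma>_def algebra_simps)
  qed (use ts in auto)
  then have "\<bar>\<sigma> 1\<bar> * exp (\<mu> / 2) \<le> ?M * exp (\<mu> / 2)"
    by (simp add: \<sigma>_def abs_mult mult.commute)
  then show "\<bar>E (\<lambda>x. sin (cubic c x))\<bar> \<le> ?M" by (simp add: \<sigma>_def)
qed

end

section \<open>Exponential moments and variance bounds\<close>

context gaussian_form
begin

text \<open>Writing \<open>1 + \<theta> cosh z\<close> as a positive combination of exponentials makes the expectation of the product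
  computable in spite of the correlations.\<close>
lemma E_prod_cosh_le:
  assumes "0 \<le> \<theta>"
  shows "E (\<lambda>x. \<Prod>i\<in>I. (1 + \<theta> * cosh (x i))) \<le> exp (real (card I) * (\<theta> * exp (1 / (2 * \<kappa>))))"
    and "tame (\<lambda>x. \<Prod>i\<in>I. (1 + \<theta> * cosh (x i)))"
proof -
  define p :: "real \<Rightarrow> real" where "p \<eta> = (if \<eta> = 0 then 1 else \<theta> / 2)" for \<eta>
  define B :: "real set" where "B = {-1, 0, 1}"
  have B: "finite B" by (simp add: B_def)
  have p0: "0 \<le> p \<eta>" for \<eta> using assms by (simp add: p_def)
  have one: "1 + \<theta> * cosh z = (\<Sum>\<eta>\<in>B. p \<eta> * exp (\<eta> * z))" for z
    by (simp add: B_def p_def cosh_def algebra_simps)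
  have expand: "(\<Prod>i\<in>I. (1 + \<theta> * cosh (x i))) = (\<Sum>\<eta>\<in>PiE I (\<lambda>_. B). (\<Prod>i\<in>I. p (\<eta> i)) * exp (lin \<eta> x))" for x
    unfolding one by (subst prod_sum_PiE[OF finite_I B]) (simp add: prod.distrib lin_def exp_sum)
  have ft: "finite (PiE I (\<lambda>_. B))" using B by (intro finite_PiE) auto
  show "tame (\<lambda>x. \<Prod>i\<in>I. (1 + \<theta> * cosh (x i)))" unfolding expand by auto
  have "E (\<lambda>x. \<Prod>i\<in>I. (1 + \<theta> * cosh (x i))) = (\<Sum>\<eta>\<in>PiE I (\<lambda>_. B). (\<Prod>i\<in>I. p (\<eta> i)) * E (\<lambda>x. exp (lin \<eta> x)))"
    unfolding expand by (simp add: integrable_P)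
  also have "\<dots> \<le> (\<Sum>\<eta>\<in>PiE I (\<lambda>_. B). (\<Prod>i\<in>I. p (\<eta> i) * exp ((\<eta> i)\<^sup>2 / (2 * \<kappa>))))"
  proof (rule sum_mono)
    fix \<eta>
    have "E (\<lambda>x. exp (lin \<eta> x)) \<le> exp ((\<Sum>i\<in>I. (\<eta> i)\<^sup>2) / \<kappa> / 2)"
      unfolding E_exp_lin using cov_le[of \<eta>] by simp
    also have "\<dots> = (\<Prod>i\<in>I. exp ((\<eta> i)\<^sup>2 / (2 * \<kappa>)))"
      by (simp add: exp_sum[symmetric] sum_divide_distrib mult.commute)
    finally show "(\<Prod>i\<in>I. p (\<eta> i)) * E (\<lambda>x. exp (lin \<eta> x)) \<le> (\<Prod>i\<in>I. p (\<eta> i) * exp ((\<eta> i)\<^sup>2 / (2 * \<kappa>)))"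
      unfolding prod.distrib using p0 by (intro mult_left_mono prod_nonneg) auto
  qed
  also have "\<dots> = (\<Prod>i\<in>I. \<Sum>\<eta>\<in>B. p \<eta> * exp (\<eta>\<^sup>2 / (2 * \<kappa>)))"
    by (subst prod_sum_PiE[OF finite_I B]) simp
  also have "\<dots> = (1 + \<theta> * exp (1 / (2 * \<kappa>))) ^ card I"
    by (simp add: B_def p_def add.commute)
  also have "\<dots> \<le> exp (\<theta> * exp (1 / (2 * \<kappa>))) ^ card I"
    using assms by (intro power_mono exp_ge_add_one_self) auto
  also have "\<dots> = exp (real (card I) * (\<theta> * exp (1 / (2 * \<kappa>))))"
    by (rule exp_of_nat_mult[symmetric])
  finally show "E (\<lambda>x. \<Prod>i\<in>I. (1 + \<theta> * cosh (x i))) \<le> exp (real (card I) * (\<theta> * exp (1 / (2 * \<kappa>))))" .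
qed

text \<open>A Chernoff bound; the sum of two exponentials covers both signs. The parameter \<eta>
  stays free so that it can later be tuned to a prescribed power of N.\<close>

lemma coord_tail:
  assumes i: "i \<in> I" and \<eta>: "0 \<le> \<eta>"
  shows "measure P {x \<in> space P. t < \<bar>x i\<bar>} \<le> 2 * exp (\<eta>\<^sup>2 / (2 * \<kappa>) - \<eta> * t)"
proof -
  define e where "e s j = (if j = i then s else 0)" for s :: real and j
  have lin_e: "lin (e s) x = s * x i" for s x
    using i by (simp add: lin_def e_def if_distrib[of "\<lambda>u. u * _"] cong: if_cong)
  have m: "{x \<in> space P. t < \<bar>x i\<bar>} \<in> sets P" using i by measurable
  have bd: "E (\<lambda>x. exp (lin (e s) x)) \<le> exp (\<eta>\<^sup>2 / (2 * \<kappa>))" if "s\<^sup>2 = \<eta>\<^sup>2" for s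
  proof -
    have "(\<Sum>j\<in>I. (e s j)\<^sup>2) = s\<^sup>2" using i by (simp add: e_def if_distrib[of "\<lambda>u. u\<^sup>2"] cong: if_cong)
    then show ?thesis unfolding E_exp_lin using cov_le[of "e s"] that by simp
  qed
  have "measure P {x \<in> space P. t < \<bar>x i\<bar>} = E (indicator {x \<in> space P. t < \<bar>x i\<bar>})"
    using m by simp
  also have "\<dots> \<le> E (\<lambda>x. exp (- \<eta> * t) * (exp (lin (e \<eta>) x) + exp (lin (e (-\<eta>)) x)))"
  proof (rule integral_mono)
    fix x
    have "1 \<le> exp (- \<eta> * t) * (exp (\<eta> * x i) + exp (- \<eta> * x i))" if "t < \<bar>x i\<bar>"
    proof -
      have "\<eta> * t \<le> \<eta> * \<bar>x i\<bar>" using that \<eta> by (intro mult_left_mono) auto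
      then have "1 \<le> exp (- \<eta> * t) * exp (\<eta> * \<bar>x i\<bar>)" by (simp add: exp_add[symmetric])
      also have "\<dots> \<le> exp (- \<eta> * t) * (exp (\<eta> * x i) + exp (- \<eta> * x i))"
        by (intro mult_left_mono) (auto simp: abs_if)
      finally show ?thesis .
    qed
    then show "indicator {x \<in> space P. t < \<bar>x i\<bar>} x \<le> exp (- \<eta> * t) * (exp (lin (e \<eta>) x) + exp (lin (e (-\<eta>)) x))"
      unfolding lin_e by (auto simp: indicator_def)
    show "integrable P (indicator {x \<in> space P. t < \<bar>x i\<bar>} :: _ \<Rightarrow> real)"
      using m by (intro integrable_real_indicator) (auto simp: emeasure_eq_measure)
  qed (auto intro!: integrable_P)
  also have "\<dots> = exp (- \<eta> * t) * (E (\<lambda>x. exp (lin (e \<eta>) x)) + E (\<lambda>x. exp (lin (e (-\<eta>)) x)))"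
    by (simp add: integrable_P)
  also have "\<dots> \<le> exp (- \<eta> * t) * (exp (\<eta>\<^sup>2 / (2 * \<kappa>)) + exp (\<eta>\<^sup>2 / (2 * \<kappa>)))"
    by (intro mult_left_mono add_mono bd) auto
  also have "\<dots> = 2 * exp (\<eta>\<^sup>2 / (2 * \<kappa>) - \<eta> * t)"
    by (simp add: exp_diff exp_minus field_simps)
  finally show ?thesis .
qed

end

context gaussian_family
begin

lemma stein_weight_le:
  assumes "\<And>a. a \<in> A \<Longrightarrow> \<bar>c a\<bar> \<le> \<beta>" "a \<in> A" "b \<in> A"
  shows "\<bar>3 * c a * c b * k a b\<bar> \<le> 3 * \<beta>\<^sup>2 * \<bar>k a b\<bar>"
proof -
  have "\<bar>c a\<bar> * \<bar>c b\<bar> \<le> \<beta> * \<beta>"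
    using assms(1)[OF assms(2)] assms(1)[OF assms(3)] by (intro mult_mono) auto
  then show ?thesis
    using mult_right_mono[of "\<bar>c a\<bar> * \<bar>c b\<bar>" "\<beta> * \<beta>" "\<bar>k a b\<bar>"]
    by (simp add: abs_mult power2_eq_square)
qed

text \<open>Sorting by degree turns \<open>stein\<close> into sums of products of linear forms, to
  which \<open>decorrelation\<close> applies. In the quadratic part the sum over a is contracted
  into the coefficient.\<close>

lemma stein_expansion:
  "stein c x = (\<Sum>(a, b)\<in>A \<times> A. 3 * c a * c b * k a b * lprod [v a, v a, v b, v b] x)
    + (\<Sum>b\<in>A. (\<Sum>a\<in>A. 3 * c a * c b * k a b * (2 * k a a)) * lprod [v b, v b] x)"
proof -
  have "stein c x = (\<Sum>a\<in>A. \<Sum>b\<in>A. 3 * c a * c b * k a b * lprod [v a, v a, v b, v b] x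
     + 3 * c a * c b * k a b * (2 * k a a) * lprod [v b, v b] x)"
    unfolding stein_def by (simp add: sum_distrib_left lprod_def power2_eq_square algebra_simps)
  also have "\<dots> = (\<Sum>a\<in>A. \<Sum>b\<in>A. 3 * c a * c b * k a b * lprod [v a, v a, v b, v b] x)
     + (\<Sum>b\<in>A. \<Sum>a\<in>A. 3 * c a * c b * k a b * (2 * k a a) * lprod [v b, v b] x)"
    by (simp only: sum.distrib) (subst sum.swap[of _ A A], rule refl)
  finally show ?thesis
    by (simp add: sum.cartesian_product sum_distrib_right)
qed

lemma E_stein: "E (stein c) = (\<Sum>(a, b)\<in>A \<times> A. 3 * c a * c b * k a b * E (lprod [v a, v a, v b, v b]))
    + (\<Sum>b\<in>A. (\<Sum>a\<in>A. 3 * c a * c b * k a b * (2 * k a a)) * E (lprod [v b, v b]))"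
  unfolding stein_expansion case_prod_unfold by (simp add: integrable_P)

lemma stein_linear_coefficient_le:
  assumes "\<And>a. a \<in> A \<Longrightarrow> \<bar>c a\<bar> \<le> \<beta>" and b: "b \<in> A"
  shows "\<bar>\<Sum>a\<in>A. 3 * c a * c b * k a b * (2 * k a a)\<bar> \<le> 6 * \<beta>\<^sup>2 * S * \<rho>"
proof -
  have "\<bar>\<Sum>a\<in>A. 3 * c a * c b * k a b * (2 * k a a)\<bar> \<le> (\<Sum>a\<in>A. \<bar>3 * c a * c b * k a b * (2 * k a a)\<bar>)"
    by (rule sum_abs)
  also have "\<dots> \<le> (\<Sum>a\<in>A. 3 * \<beta>\<^sup>2 * \<bar>k a b\<bar> * (2 * S))"
  proof (rule sum_mono)
    fix a assume a: "a \<in> A"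
    have "\<bar>3 * c a * c b * k a b * (2 * k a a)\<bar> = \<bar>3 * c a * c b * k a b\<bar> * (2 * k a a)"
      using cov_nonneg[of "v a"] by (simp add: abs_mult)
    also have "\<dots> \<le> 3 * \<beta>\<^sup>2 * \<bar>k a b\<bar> * (2 * S)"
      using stein_weight_le[OF assms(1) a b] cov_diag_le[OF a] cov_nonneg[of "v a"]
      by (intro mult_mono) auto
    finally show "\<bar>3 * c a * c b * k a b * (2 * k a a)\<bar> \<le> 3 * \<beta>\<^sup>2 * \<bar>k a b\<bar> * (2 * S)" .
  qed
  also have "\<dots> = 6 * \<beta>\<^sup>2 * S * (\<Sum>a\<in>A. \<bar>k a b\<bar>)"
    by (simp add: sum_distrib_left algebra_simps)
  also have "\<dots> \<le> 6 * \<beta>\<^sup>2 * S * \<rho>"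
    using k_col_le[OF b] S_ge_1 by (intro mult_left_mono) auto
  finally show ?thesis .
qed

lemma sum_abs_k_le: "(\<Sum>(a, b)\<in>A \<times> A. \<bar>k a b\<bar>) \<le> real (card A) * \<rho>"
proof -
  have "(\<Sum>(a, b)\<in>A \<times> A. \<bar>k a b\<bar>) = (\<Sum>a\<in>A. \<Sum>b\<in>A. \<bar>k a b\<bar>)"
    by (simp add: sum.cartesian_product)
  also have "\<dots> \<le> real (card A) * \<rho>"
    using cov_row_le by (intro sum_bounded_above) auto
  finally show ?thesis .
qed

text \<open>Passing through \<open>E (stein c)\<close> instead of sixth moments gives every term a
  factor \<open>k a b\<close>, so the double sum costs \<open>card A * \<rho>\<close> and not the
  square of \<open>card A\<close>. The constant is 84 = 3 * 24 + 6 * 2.\<close>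

lemma E_cubic_square_le:
  assumes c: "\<And>a. a \<in> A \<Longrightarrow> \<bar>c a\<bar> \<le> \<beta>"
  shows "E (\<lambda>x. (cubic c x)\<^sup>2) \<le> 84 * \<beta>\<^sup>2 * real (card A) * \<rho> * S ^ 4"
proof (cases "A = {}")
  case True
  then show ?thesis unfolding cubic_def by simp
next
  case False
  then have \<rho>: "0 \<le> \<rho>" using \<rho>_nonneg by auto
  have m4: "\<bar>E (lprod [v a, v a, v b, v b])\<bar> \<le> 24 * S ^ 4" if "a \<in> A" "b \<in> A" for a b
    using abs_E_lprod_le[OF S_ge_1, of "[v a, v a, v b, v b]"] that cov_diag_le by (auto simp: eval_nat_numeral)
  have m2: "\<bar>E (lprod [v b, v b])\<bar> \<le> 2 * S ^ 2" if "b \<in> A" for b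
    using abs_E_lprod_le[OF S_ge_1, of "[v b, v b]"] that cov_diag_le by (auto simp: eval_nat_numeral)
  have "E (\<lambda>x. (cubic c x)\<^sup>2) \<le> \<bar>E (stein c)\<bar>" unfolding E_cubic_square by simp
  also have "\<dots> \<le> \<bar>\<Sum>(a, b)\<in>A \<times> A. 3 * c a * c b * k a b * E (lprod [v a, v a, v b, v b])\<bar>
    + \<bar>\<Sum>b\<in>A. (\<Sum>a\<in>A. 3 * c a * c b * k a b * (2 * k a a)) * E (lprod [v b, v b])\<bar>"
    unfolding E_stein by (rule abs_triangle_ineq)
  also have "\<dots> \<le> (\<Sum>(a, b)\<in>A \<times> A. 3 * \<beta>\<^sup>2 * \<bar>k a b\<bar> * (24 * S ^ 4)) + (\<Sum>b\<in>A. 6 * \<beta>\<^sup>2 * S * \<rho> * (2 * S ^ 2))"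
  proof (intro add_mono; rule order_trans[OF sum_abs]; rule sum_mono)
    fix z assume "z \<in> A \<times> A"
    then obtain a b where z: "z = (a, b)" "a \<in> A" "b \<in> A" by auto
    show "\<bar>case z of (a, b) \<Rightarrow> 3 * c a * c b * k a b * E (lprod [v a, v a, v b, v b])\<bar>
       \<le> (case z of (a, b) \<Rightarrow> 3 * \<beta>\<^sup>2 * \<bar>k a b\<bar> * (24 * S ^ 4))"
      unfolding z(1) prod.case abs_mult[of _ "E _"]
      by (intro mult_mono stein_weight_le c m4 z) auto
  next
    fix b assume b: "b \<in> A"
    show "\<bar>(\<Sum>a\<in>A. 3 * c a * c b * k a b * (2 * k a a)) * E (lprod [v b, v b])\<bar> \<le> 6 * \<beta>\<^sup>2 * S * \<rho> * (2 * S ^ 2)"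
      unfolding abs_mult[of _ "E _"] using stein_linear_coefficient_le[OF c b] m2[OF b] S_ge_1 \<rho>
      by (intro mult_mono) auto
  qed
  also have "(\<Sum>(a, b)\<in>A \<times> A. 3 * \<beta>\<^sup>2 * \<bar>k a b\<bar> * (24 * S ^ 4)) = 72 * \<beta>\<^sup>2 * S ^ 4 * (\<Sum>(a, b)\<in>A \<times> A. \<bar>k a b\<bar>)"
    by (simp add: sum_distrib_left case_prod_unfold algebra_simps)
  also have "\<dots> \<le> 72 * \<beta>\<^sup>2 * S ^ 4 * (real (card A) * \<rho>)"
    using S_ge_1 by (intro mult_left_mono sum_abs_k_le) auto
  also have "(\<Sum>b\<in>A. 6 * \<beta>\<^sup>2 * S * \<rho> * (2 * S ^ 2)) = 12 * \<beta>\<^sup>2 * real (card A) * \<rho> * S ^ 3"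
    by (simp add: power3_eq_cube power2_eq_square)
  also have "12 * \<beta>\<^sup>2 * real (card A) * \<rho> * S ^ 3 \<le> 12 * \<beta>\<^sup>2 * real (card A) * \<rho> * S ^ 4"
    using S_ge_1 \<rho> by (intro mult_left_mono power_increasing) auto
  finally show ?thesis by (simp add: algebra_simps)
qed

text \<open>Each summand is a walk of three edges through four vertices. Summing the free end
  vertices first gives one factor \<rho> per edge; the symmetry of \<open>k\<close> reduces the four
  ways of linking the edges ab and cd to one.\<close>

lemma sum_k_chain_le:
  assumes "A \<noteq> {}"
  shows "(\<Sum>(a, b)\<in>A \<times> A. \<Sum>(c, d)\<in>A \<times> A. \<bar>k a b\<bar> * \<bar>k c d\<bar> * (\<bar>k a c\<bar> + \<bar>k a d\<bar> + \<bar>k b c\<bar> + \<bar>k b d\<bar>))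
    \<le> 4 * real (card A) * \<rho> ^ 3"
proof -
  define u where "u a b = \<bar>k a b\<bar>" for a b
  have sym: "u a b = u b a" for a b by (simp add: u_def cov_sym)
  have u0: "0 \<le> u a b" for a b by (simp add: u_def)
  have row: "a \<in> A \<Longrightarrow> (\<Sum>b\<in>A. u a b) \<le> \<rho>" for a unfolding u_def by (rule cov_row_le)
  have \<rho>: "0 \<le> \<rho>" using assms \<rho>_nonneg by auto
  have base: "(\<Sum>a\<in>A. \<Sum>b\<in>A. \<Sum>c\<in>A. \<Sum>d\<in>A. u a b * u c d * u a c) \<le> real (card A) * \<rho> ^ 3"
  proof -
    have "(\<Sum>d\<in>A. u a b * u c d * u a c) = u a b * (u a c * (\<Sum>d\<in>A. u c d))" for a b c
      by (simp add: sum_distrib_left mult_ac)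
    then have "(\<Sum>a\<in>A. \<Sum>b\<in>A. \<Sum>c\<in>A. \<Sum>d\<in>A. u a b * u c d * u a c) = (\<Sum>a\<in>A. (\<Sum>b\<in>A. u a b) * (\<Sum>c\<in>A. u a c * (\<Sum>d\<in>A. u c d)))"
      by (simp only: sum_product)
    also have "\<dots> \<le> (\<Sum>a\<in>A. \<rho> * (\<Sum>c\<in>A. u a c * \<rho>))"
      using \<rho> u0 row by (intro sum_mono mult_mono mult_left_mono sum_nonneg mult_nonneg_nonneg) auto
    also have "\<dots> \<le> (\<Sum>a\<in>A. \<rho> * (\<rho> * \<rho>))"
      using \<rho> row by (intro sum_mono mult_left_mono) (auto simp: sum_distrib_right[symmetric] intro!: mult_right_mono)
    finally show ?thesis by (simp add: power3_eq_cube)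
  qed
  have s1: "(\<Sum>a\<in>A. \<Sum>b\<in>A. \<Sum>c\<in>A. \<Sum>d\<in>A. u a b * u c d * u a d) = (\<Sum>a\<in>A. \<Sum>b\<in>A. \<Sum>c\<in>A. \<Sum>d\<in>A. u a b * u c d * u a c)"
  proof -
    have "(\<Sum>c\<in>A. \<Sum>d\<in>A. u a b * u c d * u a d) = (\<Sum>c\<in>A. \<Sum>d\<in>A. u a b * u c d * u a c)" for a b
      by (subst sum.swap) (intro sum.cong refl, metis sym)
    then show ?thesis by (simp only:)
  qed
  have s2: "(\<Sum>a\<in>A. \<Sum>b\<in>A. \<Sum>c\<in>A. \<Sum>d\<in>A. u a b * u c d * u b c) = (\<Sum>a\<in>A. \<Sum>b\<in>A. \<Sum>c\<in>A. \<Sum>d\<in>A. u a b * u c d * u a c)"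
    by (subst sum.swap) (intro sum.cong refl, metis sym)
  have s3: "(\<Sum>a\<in>A. \<Sum>b\<in>A. \<Sum>c\<in>A. \<Sum>d\<in>A. u a b * u c d * u b d) = (\<Sum>a\<in>A. \<Sum>b\<in>A. \<Sum>c\<in>A. \<Sum>d\<in>A. u a b * u c d * u a d)"
    by (subst sum.swap) (intro sum.cong refl, metis sym)
  have "(\<Sum>(a, b)\<in>A \<times> A. \<Sum>(c, d)\<in>A \<times> A. u a b * u c d * (u a c + u a d + u b c + u b d))
    = (\<Sum>a\<in>A. \<Sum>b\<in>A. \<Sum>c\<in>A. \<Sum>d\<in>A. u a b * u c d * (u a c + u a d + u b c + u b d))"
    by (simp only: sum.cartesian_product[symmetric])
  also have "\<dots> = (\<Sum>a\<in>A. \<Sum>b\<in>A. \<Sum>c\<in>A. \<Sum>d\<in>A. u a b * u c d * u a c) + (\<Sum>a\<in>A. \<Sum>b\<in>A. \<Sum>c\<in>A. \<Sum>d\<in>A. u a b * u c d * u a d)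
    + (\<Sum>a\<in>A. \<Sum>b\<in>A. \<Sum>c\<in>A. \<Sum>d\<in>A. u a b * u c d * u b c) + (\<Sum>a\<in>A. \<Sum>b\<in>A. \<Sum>c\<in>A. \<Sum>d\<in>A. u a b * u c d * u b d)"
    by (simp only: distrib_left sum.distrib)
  also have "\<dots> \<le> 4 * real (card A) * \<rho> ^ 3" using base unfolding s1 s2 s3 by simp
  finally show ?thesis unfolding u_def .
qed

text \<open>The covariance of two terms of \<open>stein\<close> is small unless their indices are
  linked, and the terms carry their own factors \<open>k\<close>; the sums thus run over chains of
  three covariances, whence \<open>\<rho> ^ 3\<close> with only one factor
  \<open>card A\<close>.\<close>

lemma variance_stein_le:
  assumes c: "\<And>a. a \<in> A \<Longrightarrow> \<bar>c a\<bar> \<le> \<beta>"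
  shows "E (\<lambda>x. (stein c x - E (stein c))\<^sup>2) \<le> 12000000 * \<beta> ^ 4 * real (card A) * \<rho> ^ 3 * S ^ 8"
proof (cases "A = {}")
  case True
  then show ?thesis unfolding stein_def by simp
next
  case False
  then have \<rho>: "0 \<le> \<rho>" using \<rho>_nonneg by auto
  define w where "w = (\<lambda>(a, b). 3 * c a * c b * k a b)"
  define L where "L = (\<lambda>(a, b). [v a, v a, v b, v b])"
  define e where "e b = (\<Sum>a\<in>A. 3 * c a * c b * k a b * (2 * k a a))" for b
  define X1 where "X1 x = (\<Sum>l\<in>A \<times> A. w l * (lprod (L l) x - E (lprod (L l))))" for x
  define X2 where "X2 x = (\<Sum>b\<in>A. e b * (lprod [v b, v b] x - E (lprod [v b, v b])))" for x
  have tX: "tame X1" "tame X2" unfolding X1_def[abs_def] X2_def[abs_def] by auto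
  have split: "stein c x - E (stein c) = X1 x + X2 x" for x
    unfolding X1_def X2_def E_stein stein_expansion[of c x] w_def L_def e_def case_prod_unfold
    by (simp only: right_diff_distrib sum_subtractf)
  have w_le: "\<bar>w (a, b)\<bar> \<le> 3 * \<beta>\<^sup>2 * \<bar>k a b\<bar>" if "a \<in> A" "b \<in> A" for a b
    using stein_weight_le[OF c that] by (simp add: w_def)
  have e_le: "\<bar>e b\<bar> \<le> 6 * \<beta>\<^sup>2 * S * \<rho>" if "b \<in> A" for b
    unfolding e_def by (rule stein_linear_coefficient_le[OF c that])
  have "E (\<lambda>x. (X1 x)\<^sup>2) \<le> (\<Sum>(a, b)\<in>A \<times> A. \<Sum>(a', b')\<in>A \<times> A. 9 * \<beta> ^ 4 * (161280 * S ^ 8) *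
      (\<bar>k a b\<bar> * \<bar>k a' b'\<bar> * (\<bar>k a a'\<bar> + \<bar>k a b'\<bar> + \<bar>k b a'\<bar> + \<bar>k b b'\<bar>)))"
    unfolding X1_def variance_lprod_sum[OF finite_cartesian_product[OF finite_A finite_A]] case_prod_unfold
  proof (intro sum_mono)
    fix l m assume lm: "l \<in> A \<times> A" "m \<in> A \<times> A"
    obtain a b a' b' where [simp]: "l = (a, b)" "m = (a', b')" by (cases l; cases m)
    have A: "a \<in> A" "b \<in> A" "a' \<in> A" "b' \<in> A" using lm by auto
    let ?X = "\<bar>k a a'\<bar> + \<bar>k a b'\<bar> + \<bar>k b a'\<bar> + \<bar>k b b'\<bar>"
    have "\<bar>E (lprod (L l @ L m)) - E (lprod (L l)) * E (lprod (L m))\<bar>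
      \<le> fact (length (L l) + length (L m)) * S ^ (length (L l) + length (L m)) * cross (L l) (L m)"
      by (rule decorrelation[OF S_ge_1]) (use A cov_diag_le in \<open>auto simp: L_def\<close>)
    \<comment> \<open>161280 = 8! * 4, since each of the four covariances occurs 2 * 2 times in
      \<open>cross\<close>.\<close>
    also have "\<dots> = 161280 * S ^ 8 * ?X"
      by (simp add: L_def cross_def eval_nat_numeral)
    finally have d: "\<bar>E (lprod (L l @ L m)) - E (lprod (L l)) * E (lprod (L m))\<bar> \<le> 161280 * S ^ 8 * ?X" .
    have "\<bar>w l * w m\<bar> \<le> (3 * \<beta>\<^sup>2 * \<bar>k a b\<bar>) * (3 * \<beta>\<^sup>2 * \<bar>k a' b'\<bar>)"
      unfolding abs_mult by (intro mult_mono) (use w_le A in auto)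
    then have "\<bar>w l * w m\<bar> * \<bar>E (lprod (L l @ L m)) - E (lprod (L l)) * E (lprod (L m))\<bar>
      \<le> (3 * \<beta>\<^sup>2 * \<bar>k a b\<bar>) * (3 * \<beta>\<^sup>2 * \<bar>k a' b'\<bar>) * (161280 * S ^ 8 * ?X)"
      using d by (intro mult_mono) auto
    also have "\<dots> = 9 * \<beta> ^ 4 * (161280 * S ^ 8) * (\<bar>k a b\<bar> * \<bar>k a' b'\<bar> * ?X)"
      by (simp add: power2_eq_square power4_eq_xxxx)
    finally have "w l * w m * (E (lprod (L l @ L m)) - E (lprod (L l)) * E (lprod (L m)))
      \<le> 9 * \<beta> ^ 4 * (161280 * S ^ 8) * (\<bar>k a b\<bar> * \<bar>k a' b'\<bar> * ?X)"
      by (rule order_trans[rotated]) (metis abs_ge_self abs_mult)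
    then show "w l * w m * (E (lprod (L l @ L m)) - E (lprod (L l)) * E (lprod (L m)))
      \<le> 9 * \<beta> ^ 4 * (161280 * S ^ 8) * (\<bar>k (fst l) (snd l)\<bar> * \<bar>k (fst m) (snd m)\<bar> *
        (\<bar>k (fst l) (fst m)\<bar> + \<bar>k (fst l) (snd m)\<bar> + \<bar>k (snd l) (fst m)\<bar> + \<bar>k (snd l) (snd m)\<bar>))"
      by (simp only: \<open>l = (a, b)\<close> \<open>m = (a', b')\<close> fst_conv snd_conv)
  qed
  also have "\<dots> = 9 * \<beta> ^ 4 * (161280 * S ^ 8) * (\<Sum>(a, b)\<in>A \<times> A. \<Sum>(a', b')\<in>A \<times> A.
      \<bar>k a b\<bar> * \<bar>k a' b'\<bar> * (\<bar>k a a'\<bar> + \<bar>k a b'\<bar> + \<bar>k b a'\<bar> + \<bar>k b b'\<bar>))"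
    by (simp only: sum_distrib_left case_prod_unfold)
  also have "\<dots> \<le> 9 * \<beta> ^ 4 * (161280 * S ^ 8) * (4 * real (card A) * \<rho> ^ 3)"
    using S_ge_1 by (intro mult_left_mono sum_k_chain_le[OF False]) auto
  finally have X1: "E (\<lambda>x. (X1 x)\<^sup>2) \<le> 5806080 * \<beta> ^ 4 * real (card A) * \<rho> ^ 3 * S ^ 8"
    by (simp add: mult_ac)
  have "E (\<lambda>x. (X2 x)\<^sup>2) \<le> (\<Sum>b\<in>A. \<Sum>d\<in>A. (6 * \<beta>\<^sup>2 * S * \<rho>) * (6 * \<beta>\<^sup>2 * S * \<rho>) * (96 * S ^ 4 * \<bar>k b d\<bar>))"
    unfolding X2_def variance_lprod_sum[OF finite_A]
  proof (intro sum_mono)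
    fix b d assume bd: "b \<in> A" "d \<in> A"
    have "\<bar>E (lprod ([v b, v b] @ [v d, v d])) - E (lprod [v b, v b]) * E (lprod [v d, v d])\<bar>
      \<le> fact (length [v b, v b] + length [v d, v d]) * S ^ (length [v b, v b] + length [v d, v d]) * cross [v b, v b] [v d, v d]"
      by (rule decorrelation[OF S_ge_1]) (use bd cov_diag_le in auto)
    then have d: "\<bar>E (lprod ([v b, v b] @ [v d, v d])) - E (lprod [v b, v b]) * E (lprod [v d, v d])\<bar> \<le> 96 * S ^ 4 * \<bar>k b d\<bar>"
      by (simp add: cross_def eval_nat_numeral)
    have "\<bar>e b * e d\<bar> \<le> (6 * \<beta>\<^sup>2 * S * \<rho>) * (6 * \<beta>\<^sup>2 * S * \<rho>)"
      unfolding abs_mult by (intro mult_mono e_le bd) (use S_ge_1 \<rho> in auto)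
    then have "\<bar>e b * e d\<bar> * \<bar>E (lprod ([v b, v b] @ [v d, v d])) - E (lprod [v b, v b]) * E (lprod [v d, v d])\<bar>
      \<le> (6 * \<beta>\<^sup>2 * S * \<rho>) * (6 * \<beta>\<^sup>2 * S * \<rho>) * (96 * S ^ 4 * \<bar>k b d\<bar>)"
      using d by (intro mult_mono) auto
    then show "e b * e d * (E (lprod ([v b, v b] @ [v d, v d])) - E (lprod [v b, v b]) * E (lprod [v d, v d]))
      \<le> (6 * \<beta>\<^sup>2 * S * \<rho>) * (6 * \<beta>\<^sup>2 * S * \<rho>) * (96 * S ^ 4 * \<bar>k b d\<bar>)"
      unfolding abs_mult[symmetric] by (rule order_trans[OF abs_ge_self])
  qed
  also have "\<dots> = (6 * \<beta>\<^sup>2 * S * \<rho>) * (6 * \<beta>\<^sup>2 * S * \<rho>) * (96 * S ^ 4) * (\<Sum>(b, d)\<in>A \<times> A. \<bar>k b d\<bar>)"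
    by (simp add: sum_distrib_left sum_distrib_right sum.cartesian_product case_prod_unfold mult_ac)
  also have "\<dots> \<le> (6 * \<beta>\<^sup>2 * S * \<rho>) * (6 * \<beta>\<^sup>2 * S * \<rho>) * (96 * S ^ 4) * (real (card A) * \<rho>)"
    using S_ge_1 \<rho> by (intro mult_left_mono sum_abs_k_le) auto
  also have "\<dots> = 3456 * \<beta> ^ 4 * real (card A) * \<rho> ^ 3 * S ^ 6"
    by (simp add: power2_eq_square power3_eq_cube power4_eq_xxxx eval_nat_numeral)
  also have "\<dots> \<le> 3456 * \<beta> ^ 4 * real (card A) * \<rho> ^ 3 * S ^ 8"
    using S_ge_1 \<rho> by (intro mult_left_mono power_increasing) auto
  finally have X2: "E (\<lambda>x. (X2 x)\<^sup>2) \<le> 3456 * \<beta> ^ 4 * real (card A) * \<rho> ^ 3 * S ^ 8" .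
  have "E (\<lambda>x. (X1 x + X2 x)\<^sup>2) \<le> E (\<lambda>x. 2 * (X1 x)\<^sup>2 + 2 * (X2 x)\<^sup>2)"
    using tX by (intro E_mono) (auto simp: power2_sum add.commute sum_squares_bound)
  also have "\<dots> = 2 * E (\<lambda>x. (X1 x)\<^sup>2) + 2 * E (\<lambda>x. (X2 x)\<^sup>2)"
    using tX by (simp add: integrable_P)
  \<comment> \<open>Twice the sum of 5806080 = 9 * 161280 * 4 and 3456 = 36 * 96.\<close>
  also have "\<dots> \<le> 11619072 * (\<beta> ^ 4 * real (card A) * \<rho> ^ 3 * S ^ 8)"
    using X1 X2 by (simp add: mult.assoc)
  also have "\<dots> \<le> 12000000 * (\<beta> ^ 4 * real (card A) * \<rho> ^ 3 * S ^ 8)"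
    using \<rho> S_ge_1 by (intro mult_right_mono) auto
  finally show ?thesis unfolding split by (simp add: mult.assoc)
qed

section \<open>Mean and variance of quartic forms\<close>

definition quartic :: "('a \<Rightarrow> real) \<Rightarrow> ('i \<Rightarrow> real) \<Rightarrow> real" where
  "quartic c x = (\<Sum>a\<in>A. c a * y a x ^ 4)"

lemma tame_quartic [simp, intro]: "tame (quartic c)"
  unfolding quartic_def[abs_def] by auto

lemma quartic_eq: "quartic c x = (\<Sum>a\<in>A. c a * lprod [v a, v a, v a, v a] x)"
  by (simp add: quartic_def lprod_def power4_eq_xxxx mult.assoc)

lemma E_quartic: "E (quartic c) = (\<Sum>a\<in>A. c a * E (lprod [v a, v a, v a, v a]))"
  unfolding quartic_eq by (simp add: integrable_P)

lemma E_quartic_le: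
  assumes c: "\<And>a. a \<in> A \<Longrightarrow> \<bar>c a\<bar> \<le> \<beta>"
  shows "E (quartic c) \<le> 24 * \<beta> * real (card A) * S ^ 4"
proof -
  have "E (quartic c) \<le> (\<Sum>a\<in>A. \<beta> * (24 * S ^ 4))"
    unfolding E_quartic
  proof (rule sum_mono)
    fix a assume a: "a \<in> A"
    have "\<bar>E (lprod [v a, v a, v a, v a])\<bar> \<le> 24 * S ^ 4"
      using abs_E_lprod_le[OF S_ge_1, of "[v a, v a, v a, v a]"] a cov_diag_le by (auto simp: eval_nat_numeral)
    then have "\<bar>c a\<bar> * \<bar>E (lprod [v a, v a, v a, v a])\<bar> \<le> \<beta> * (24 * S ^ 4)"
      using c[OF a] by (intro mult_mono) auto
    then show "c a * E (lprod [v a, v a, v a, v a]) \<le> \<beta> * (24 * S ^ 4)"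
      unfolding abs_mult[symmetric] by (rule order_trans[OF abs_ge_self])
  qed
  then show ?thesis by (simp add: mult_ac)
qed

text \<open>Decorrelation leaves one covariance per pair, so the double sum costs
  \<open>card A * \<rho>\<close>; 645120 = 8! * 16 because all 4 * 4 pairs of factors contribute the
  same covariance.\<close>

lemma variance_quartic_le:
  assumes c: "\<And>a. a \<in> A \<Longrightarrow> \<bar>c a\<bar> \<le> \<beta>"
  shows "E (\<lambda>x. (quartic c x - E (quartic c))\<^sup>2) \<le> 645120 * \<beta>\<^sup>2 * real (card A) * \<rho> * S ^ 8"
proof -
  define L where "L a = [v a, v a, v a, v a]" for a
  have "quartic c x - E (quartic c) = (\<Sum>a\<in>A. c a * (lprod (L a) x - E (lprod (L a))))" for x
    unfolding E_quartic quartic_eq[of c x] by (simp add: L_def right_diff_distrib sum_subtractf)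
  then have "E (\<lambda>x. (quartic c x - E (quartic c))\<^sup>2) =
      (\<Sum>a\<in>A. \<Sum>b\<in>A. c a * c b * (E (lprod (L a @ L b)) - E (lprod (L a)) * E (lprod (L b))))"
    by (simp only: variance_lprod_sum[OF finite_A])
  also have "\<dots> \<le> (\<Sum>a\<in>A. \<Sum>b\<in>A. \<beta> * \<beta> * (645120 * S ^ 8 * \<bar>k a b\<bar>))"
  proof (intro sum_mono)
    fix a b assume ab: "a \<in> A" "b \<in> A"
    have "\<bar>E (lprod (L a @ L b)) - E (lprod (L a)) * E (lprod (L b))\<bar>
      \<le> fact (length (L a) + length (L b)) * S ^ (length (L a) + length (L b)) * cross (L a) (L b)"
      by (rule decorrelation[OF S_ge_1]) (use ab cov_diag_le in \<open>auto simp: L_def\<close>)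
    then have d: "\<bar>E (lprod (L a @ L b)) - E (lprod (L a)) * E (lprod (L b))\<bar> \<le> 645120 * S ^ 8 * \<bar>k a b\<bar>"
      by (simp add: L_def cross_def eval_nat_numeral)
    have "\<bar>c a * c b\<bar> \<le> \<beta> * \<beta>"
      unfolding abs_mult using c ab by (intro mult_mono) (auto intro: order_trans[OF abs_ge_zero])
    then have "\<bar>c a * c b\<bar> * \<bar>E (lprod (L a @ L b)) - E (lprod (L a)) * E (lprod (L b))\<bar>
      \<le> \<beta> * \<beta> * (645120 * S ^ 8 * \<bar>k a b\<bar>)"
      using d by (intro mult_mono) auto
    then show "c a * c b * (E (lprod (L a @ L b)) - E (lprod (L a)) * E (lprod (L b))) \<le> \<beta> * \<beta> * (645120 * S ^ 8 * \<bar>k a b\<bar>)"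
      unfolding abs_mult[symmetric] by (rule order_trans[OF abs_ge_self])
  qed
  also have "\<dots> = \<beta> * \<beta> * (645120 * S ^ 8) * (\<Sum>(a, b)\<in>A \<times> A. \<bar>k a b\<bar>)"
    by (simp add: sum_distrib_left sum_distrib_right sum.cartesian_product case_prod_unfold mult_ac)
  also have "\<dots> \<le> \<beta> * \<beta> * (645120 * S ^ 8) * (real (card A) * \<rho>)"
    using S_ge_1 by (intro mult_left_mono sum_abs_k_le) auto
  finally show ?thesis by (simp add: power2_eq_square mult_ac)
qed

end

section \<open>The bipartite Gaussian model\<close>

context gaussian_form
begin

lemma cov_coord:
  assumes "i \<in> I" "j \<in> I"
  shows "cov (\<lambda>l. of_bool (l = i)) (\<lambda>l. of_bool (l = j)) = K i j"
proof -
  have "lin (\<lambda>l. of_bool (l = i)) x = x i" if "i \<in> I" for x i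
    using that by (simp add: lin_def)
  then show ?thesis unfolding E_lin_lin[symmetric] K_def using assms by simp
qed

lemma K_diag_le: "i \<in> I \<Longrightarrow> K i i \<le> 1 / \<kappa>"
  using cov_le[of "\<lambda>l. of_bool (l = i)"] cov_coord[of i i] by (simp add: power2_eq_square of_bool_conj[symmetric])

lemma H_diag_ge:
  assumes "i \<in> I" shows "\<kappa> \<le> H i i"
proof -
  have *: "(\<Sum>p\<in>I. \<Sum>q\<in>I. H p q * x p * x q) = (\<Sum>p\<in>I. x p * (\<Sum>q\<in>I. H p q * x q))" for x
    by (simp add: sum_distrib_left mult_ac)
  have "\<kappa> * (\<Sum>p\<in>I. (of_bool (p = i))\<^sup>2) \<le> (\<Sum>p\<in>I. of_bool (p = i) * (\<Sum>q\<in>I. H p q * of_bool (q = i)))"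
    using H_coercive[of "\<lambda>l. of_bool (l = i)"] by (simp only: *)
  then show ?thesis using assms by (simp add: power2_eq_square of_bool_conj[symmetric])
qed

text \<open>With \<open>H = D + W\<close>, \<open>D\<close> the diagonal of \<open>H\<close>, this is the resolvent expansion
  \<open>D K D = D - W + W K W\<close>, whose last term is controlled by the operator norm of \<open>K\<close>.\<close>
lemma K_off_diag_le:
  assumes ij: "i \<in> I" "j \<in> I" "i \<noteq> j"
    and w: "\<And>i j. i \<in> I \<Longrightarrow> j \<in> I \<Longrightarrow> i \<noteq> j \<Longrightarrow> \<bar>H i j\<bar> \<le> w"
  shows "\<bar>K i j\<bar> \<le> (w + real (card I) * w\<^sup>2 / \<kappa>) / \<kappa>\<^sup>2"
proof -
  define r where "r i l = (if l = i then 0 else H i l)" for i l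
  have Hr: "(\<Sum>l\<in>I. H i l * z l) = H i i * z i + (\<Sum>l\<in>I. r i l * z l)" if "i \<in> I" for i z
  proof -
    have "(\<Sum>l\<in>I. H i l * z l) = (\<Sum>l\<in>I. (if l = i then H i i * z i else 0) + r i l * z l)"
      by (intro sum.cong refl) (simp add: r_def)
    then show ?thesis using that by (simp add: sum.distrib)
  qed
  have 1: "H i i * K i j = - (\<Sum>l\<in>I. r i l * K l j)"
    using HK[OF ij(1,2)] Hr[OF ij(1), of "\<lambda>l. K l j"] ij(3) by simp
  have 2: "H j j * K l j = of_bool (l = j) - (\<Sum>p\<in>I. K l p * r j p)" if l: "l \<in> I" for l
  proof -
    have "of_bool (l = j) = (\<Sum>p\<in>I. H j p * K l p)"
      unfolding KH[OF l ij(2), symmetric] using ij by (intro sum.cong refl) (metis H_sym mult.commute)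
    also have "\<dots> = H j j * K l j + (\<Sum>p\<in>I. r j p * K l p)" by (rule Hr[OF ij(2)])
    finally show ?thesis by (simp add: mult.commute)
  qed
  have "H j j * (H i i * K i j) = - (\<Sum>l\<in>I. r i l * (H j j * K l j))"
    unfolding 1 by (simp add: sum_distrib_left mult_ac)
  also have "\<dots> = - (\<Sum>l\<in>I. r i l * of_bool (l = j)) + (\<Sum>l\<in>I. r i l * (\<Sum>p\<in>I. K l p * r j p))"
    by (simp add: 2 right_diff_distrib sum_subtractf)
  also have "(\<Sum>l\<in>I. r i l * of_bool (l = j)) = H i j" using ij by (simp add: r_def)
  also have "(\<Sum>l\<in>I. r i l * (\<Sum>p\<in>I. K l p * r j p)) = cov (r i) (r j)"
    by (simp add: cov_def sum_distrib_left mult.assoc)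
  finally have eq: "H j j * (H i i * K i j) = cov (r i) (r j) - H i j" by simp
  have w0: "0 \<le> w" using w[OF ij] by linarith
  \<comment> \<open>A row of off-diagonal entries has squared norm at most |I| w^2. When w is of
    order 1/|I| this is again of order w, so the quadratic term of the expansion is no worse than
    the linear one.\<close>
  have r2: "(\<Sum>l\<in>I. (r i l)\<^sup>2) \<le> real (card I) * w\<^sup>2" if "i \<in> I" for i
  proof -
    have "\<bar>r i l\<bar> \<le> w" if "l \<in> I" for l using w[of i l] w0 \<open>i \<in> I\<close> that by (auto simp: r_def)
    then have "(r i l)\<^sup>2 \<le> w\<^sup>2" if "l \<in> I" for l using that w0 by (metis abs_ge_zero power2_abs power_mono)
    then show ?thesis by (intro sum_bounded_above) auto
  qed
  have "\<bar>cov (r i) (r j)\<bar> \<le> (cov (r i) (r i) + cov (r j) (r j)) / 2" by (rule abs_cov_le)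
  also have "\<dots> \<le> (real (card I) * w\<^sup>2 / \<kappa> + real (card I) * w\<^sup>2 / \<kappa>) / 2"
  proof -
    have "cov (r l) (r l) \<le> real (card I) * w\<^sup>2 / \<kappa>" if "l \<in> I" for l
      using cov_le[of "r l"] divide_right_mono[OF r2[OF that], of \<kappa>] \<kappa>_pos by linarith
    then show ?thesis using ij by (intro divide_right_mono add_mono) auto
  qed
  finally have "\<bar>H j j * (H i i * K i j)\<bar> \<le> w + real (card I) * w\<^sup>2 / \<kappa>"
    unfolding eq using w[OF ij] by auto
  moreover have "\<kappa>\<^sup>2 * \<bar>K i j\<bar> \<le> \<bar>H j j * (H i i * K i j)\<bar>"
  proof -
    have "\<kappa>\<^sup>2 \<le> H j j * H i i"
      unfolding power2_eq_square using H_diag_ge[OF ij(1)] H_diag_ge[OF ij(2)] \<kappa>_pos by (intro mult_mono) auto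
    then have "\<kappa>\<^sup>2 * \<bar>K i j\<bar> \<le> (H j j * H i i) * \<bar>K i j\<bar>" by (intro mult_right_mono) auto
    also have "\<dots> = \<bar>H j j * (H i i * K i j)\<bar>"
      using H_diag_ge[OF ij(1)] H_diag_ge[OF ij(2)] \<kappa>_pos by (simp add: abs_mult)
    finally show ?thesis .
  qed
  ultimately have "\<kappa>\<^sup>2 * \<bar>K i j\<bar> \<le> w + real (card I) * w\<^sup>2 / \<kappa>" by simp
  then show ?thesis using \<kappa>_pos by (simp add: pos_le_divide_eq mult.commute)
qed

end

locale bipartite =
  fixes m n :: nat and a :: "nat \<Rightarrow> nat \<Rightarrow> real" and \<delta> a0 a1 :: real
  assumes m1: "1 \<le> m" and n1: "1 \<le> n"
    and \<delta>: "0 < \<delta>" "\<delta> \<le> 1"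
    and mn: "\<delta> * real n \<le> real m" and nm: "\<delta> * real m \<le> real n"
    and a0_pos: "0 < a0"
    and a_ge: "\<And>j k. j \<in> {1..m} \<Longrightarrow> k \<in> {1..n} \<Longrightarrow> a0 \<le> a j k"
    and a_le: "\<And>j k. j \<in> {1..m} \<Longrightarrow> k \<in> {1..n} \<Longrightarrow> a j k \<le> a1"
begin

abbreviation N :: real where "N \<equiv> real m + real n"

definition Ix :: "(nat + nat) set" where "Ix = {1..m} <+> {1..n}"

text \<open>The division by N makes the diagonal of order 1 and the off-diagonal entries of order
  1/N. The entries with \<open>a0\<close> come from the added square of the difference of the two
  coordinate sums, as \<open>Hx_form\<close> shows.\<close>

fun Hx :: "nat + nat \<Rightarrow> nat + nat \<Rightarrow> real" where
  "Hx (Inl j) (Inl j') = (of_bool (j = j') * (\<Sum>k=1..n. a j k) + a0) / N"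
| "Hx (Inr k) (Inr k') = (of_bool (k = k') * (\<Sum>j=1..m. a j k) + a0) / N"
| "Hx (Inl j) (Inr k) = (a j k - a0) / N"
| "Hx (Inr k) (Inl j) = (a j k - a0) / N"

lemma N_pos: "0 < N" using m1 by simp

lemma finite_Ix [simp]: "finite Ix" by (simp add: Ix_def)

lemma card_Ix: "real (card Ix) = N" by (simp add: Ix_def card_Plus)

lemma sum_Ix: "(\<Sum>i\<in>Ix. g i) = (\<Sum>j=1..m. g (Inl j)) + (\<Sum>k=1..n. g (Inr k))" for g :: "nat + nat \<Rightarrow> 'b::comm_monoid_add"
  unfolding Ix_def by (subst sum.Plus) auto

lemma sum_product_scaled:
  fixes c d :: real
  shows "(\<Sum>i\<in>A. \<Sum>j\<in>B. c * (f i * g j) / d) = c * sum f A * sum g B / d"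
  by (subst mult.assoc, subst sum_product) (simp only: sum_distrib_left sum_divide_distrib)

lemma Hx_form: "(\<Sum>i\<in>Ix. \<Sum>j\<in>Ix. Hx i j * x i * x j) =
    ((\<Sum>j=1..m. \<Sum>k=1..n. a j k * (x (Inl j) + x (Inr k))\<^sup>2)
     + a0 * ((\<Sum>j=1..m. x (Inl j)) - (\<Sum>k=1..n. x (Inr k)))\<^sup>2) / N"
proof -
  let ?X = "\<lambda>j. x (Inl j)" and ?Y = "\<lambda>k. x (Inr k)"
  have ll: "(\<Sum>j=1..m. \<Sum>j'=1..m. Hx (Inl j) (Inl j') * ?X j * ?X j')
      = (\<Sum>j=1..m. \<Sum>k=1..n. a j k * ?X j * ?X j) / N + a0 * (\<Sum>j=1..m. ?X j) * (\<Sum>j=1..m. ?X j) / N"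
  proof -
    have "(\<Sum>j=1..m. \<Sum>j'=1..m. Hx (Inl j) (Inl j') * ?X j * ?X j')
      = (\<Sum>j=1..m. \<Sum>j'=1..m. (if j' = j then (\<Sum>k=1..n. a j k) * ?X j * ?X j / N else 0) + a0 * (?X j * ?X j') / N)"
      by (intro sum.cong refl) (auto simp: add_divide_distrib algebra_simps)
    also have "\<dots> = (\<Sum>j=1..m. (\<Sum>k=1..n. a j k) * ?X j * ?X j / N) + (\<Sum>j=1..m. \<Sum>j'=1..m. a0 * (?X j * ?X j') / N)"
      by (simp add: sum.distrib)
    finally show ?thesis
      by (simp only: sum_product_scaled sum_distrib_right sum_divide_distrib)
  qed
  have rr: "(\<Sum>k=1..n. \<Sum>k'=1..n. Hx (Inr k) (Inr k') * ?Y k * ?Y k')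
      = (\<Sum>k=1..n. \<Sum>j=1..m. a j k * ?Y k * ?Y k) / N + a0 * (\<Sum>k=1..n. ?Y k) * (\<Sum>k=1..n. ?Y k) / N"
  proof -
    have "(\<Sum>k=1..n. \<Sum>k'=1..n. Hx (Inr k) (Inr k') * ?Y k * ?Y k')
      = (\<Sum>k=1..n. \<Sum>k'=1..n. (if k' = k then (\<Sum>j=1..m. a j k) * ?Y k * ?Y k / N else 0) + a0 * (?Y k * ?Y k') / N)"
      by (intro sum.cong refl) (auto simp: add_divide_distrib algebra_simps)
    also have "\<dots> = (\<Sum>k=1..n. (\<Sum>j=1..m. a j k) * ?Y k * ?Y k / N) + (\<Sum>k=1..n. \<Sum>k'=1..n. a0 * (?Y k * ?Y k') / N)"
      by (simp add: sum.distrib)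
    finally show ?thesis
      by (simp only: sum_product_scaled sum_distrib_right sum_divide_distrib)
  qed
  have lr: "(\<Sum>j=1..m. \<Sum>k=1..n. Hx (Inl j) (Inr k) * ?X j * ?Y k)
      = (\<Sum>j=1..m. \<Sum>k=1..n. a j k * ?X j * ?Y k) / N - a0 * (\<Sum>j=1..m. ?X j) * (\<Sum>k=1..n. ?Y k) / N"
  proof -
    have "(\<Sum>j=1..m. \<Sum>k=1..n. Hx (Inl j) (Inr k) * ?X j * ?Y k)
      = (\<Sum>j=1..m. \<Sum>k=1..n. a j k * ?X j * ?Y k / N - a0 * (?X j * ?Y k) / N)"
      by (intro sum.cong refl) (simp add: diff_divide_distrib left_diff_distrib mult.assoc)
    then show ?thesis by (simp only: sum_subtractf sum_product_scaled sum_divide_distrib)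
  qed
  have rl: "(\<Sum>k=1..n. \<Sum>j=1..m. Hx (Inr k) (Inl j) * ?Y k * ?X j) = (\<Sum>j=1..m. \<Sum>k=1..n. Hx (Inl j) (Inr k) * ?X j * ?Y k)"
    by (subst sum.swap) (simp add: mult_ac)
  have "(\<Sum>i\<in>Ix. \<Sum>j\<in>Ix. Hx i j * x i * x j) =
     ((\<Sum>j=1..m. \<Sum>k=1..n. a j k * ?X j * ?X j) + (\<Sum>k=1..n. \<Sum>j=1..m. a j k * ?Y k * ?Y k) + 2 * (\<Sum>j=1..m. \<Sum>k=1..n. a j k * ?X j * ?Y k)
      + a0 * ((\<Sum>j=1..m. ?X j) - (\<Sum>k=1..n. ?Y k))\<^sup>2) / N"
  proof -
    have "(A / s + c * u * u / s) + (C / s - c * u * w / s) + ((C / s - c * u * w / s) + (B / s + c * w * w / s))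
        = (A + B + 2 * C + c * (u - w)\<^sup>2) / s" for A B C c u w s :: real
      by (cases "s = 0") (auto simp: field_simps power2_eq_square)
    then show ?thesis unfolding sum_Ix sum.distrib rl lr ll rr .
  qed
  also have "(\<Sum>k=1..n. \<Sum>j=1..m. a j k * ?Y k * ?Y k) = (\<Sum>j=1..m. \<Sum>k=1..n. a j k * ?Y k * ?Y k)"
    by (rule sum.swap)
  also have "(\<Sum>j=1..m. \<Sum>k=1..n. a j k * ?X j * ?X j) + (\<Sum>j=1..m. \<Sum>k=1..n. a j k * ?Y k * ?Y k) + 2 * (\<Sum>j=1..m. \<Sum>k=1..n. a j k * ?X j * ?Y k)
      = (\<Sum>j=1..m. \<Sum>k=1..n. a j k * (?X j + ?Y k)\<^sup>2)"
    by (simp add: sum_distrib_left sum.distrib[symmetric] power2_eq_square algebra_simps)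
  finally show ?thesis .
qed

text \<open>The factor \<delta>/2 enters through m, n \<ge> (\<delta>/2) N, which is
  \<open>min_ge\<close>.\<close>

definition \<kappa>x :: real where "\<kappa>x = a0 * \<delta> / 2"

lemma \<kappa>x_pos: "0 < \<kappa>x" using a0_pos \<delta> by (simp add: \<kappa>x_def)

lemma min_ge: "\<delta> / 2 * N \<le> real m" "\<delta> / 2 * N \<le> real n"
proof -
  have "\<delta> * real m \<le> 1 * real m" "\<delta> * real n \<le> 1 * real n" using \<delta> by (intro mult_right_mono; simp)+
  then show "\<delta> / 2 * N \<le> real m" "\<delta> / 2 * N \<le> real n"
    using mn nm by (simp_all add: algebra_simps)
qed

text \<open>After lowering all weights to \<open>a0\<close>, the mixed products of the two
  coordinate sums cancel against those of the added square; this is why that square carries the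
  coefficient \<open>a0\<close>. What remains is a sum of squares with factors n and m, hence at
  least (\<delta>/2) N.\<close>

sublocale gaussian_form Ix Hx \<kappa>x
proof
  show "finite Ix" by simp
  show "Hx i j = Hx j i" for i j by (cases i; cases j) auto
  show "0 < \<kappa>x" by (rule \<kappa>x_pos)
  fix x :: "nat + nat \<Rightarrow> real"
  let ?X = "\<lambda>j. x (Inl j)" and ?Y = "\<lambda>k. x (Inr k)"
  have "\<kappa>x * N * (\<Sum>i\<in>Ix. (x i)\<^sup>2) = a0 * (\<delta> / 2 * N * (\<Sum>j=1..m. (?X j)\<^sup>2) + \<delta> / 2 * N * (\<Sum>k=1..n. (?Y k)\<^sup>2))"
    by (simp add: \<kappa>x_def sum_Ix algebra_simps)
  also have "\<dots> \<le> a0 * (real n * (\<Sum>j=1..m. (?X j)\<^sup>2) + real m * (\<Sum>k=1..n. (?Y k)\<^sup>2))"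
    using a0_pos min_ge by (intro mult_left_mono add_mono mult_right_mono sum_nonneg) auto
  also have "\<dots> \<le> a0 * (real n * (\<Sum>j=1..m. (?X j)\<^sup>2) + real m * (\<Sum>k=1..n. (?Y k)\<^sup>2)
      + (\<Sum>j=1..m. ?X j)\<^sup>2 + (\<Sum>k=1..n. ?Y k)\<^sup>2)"
    using a0_pos by (intro mult_left_mono) auto
  also have "\<dots> = a0 * (\<Sum>j=1..m. \<Sum>k=1..n. (?X j + ?Y k)\<^sup>2) + a0 * ((\<Sum>j=1..m. ?X j) - (\<Sum>k=1..n. ?Y k))\<^sup>2"
  proof -
    have "(\<Sum>j=1..m. \<Sum>k=1..n. (?X j + ?Y k)\<^sup>2) = (\<Sum>j=1..m. \<Sum>k=1..n. (?X j)\<^sup>2 + 2 * (?X j * ?Y k) + (?Y k)\<^sup>2)"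
      by (simp add: power2_sum algebra_simps)
    also have "\<dots> = real n * (\<Sum>j=1..m. (?X j)\<^sup>2) + 2 * ((\<Sum>j=1..m. ?X j) * (\<Sum>k=1..n. ?Y k)) + real m * (\<Sum>k=1..n. (?Y k)\<^sup>2)"
    proof -
      have p: "(\<Sum>j=1..m. \<Sum>k=1..n. 2 * (?X j * ?Y k)) = 2 * ((\<Sum>j=1..m. ?X j) * (\<Sum>k=1..n. ?Y k))"
        by (subst sum_product) (simp only: sum_distrib_left)
      show ?thesis unfolding sum.distrib p by (simp add: sum_distrib_left)
    qed
    finally show ?thesis by (simp add: power2_diff algebra_simps)
  qed
  also have "\<dots> \<le> (\<Sum>j=1..m. \<Sum>k=1..n. a j k * (?X j + ?Y k)\<^sup>2) + a0 * ((\<Sum>j=1..m. ?X j) - (\<Sum>k=1..n. ?Y k))\<^sup>2"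
    unfolding sum_distrib_left by (intro add_mono order_refl sum_mono mult_right_mono a_ge) auto
  finally show "\<kappa>x * (\<Sum>i\<in>Ix. (x i)\<^sup>2) \<le> (\<Sum>i\<in>Ix. \<Sum>j\<in>Ix. Hx i j * x i * x j)"
    unfolding Hx_form using N_pos by (simp add: pos_le_divide_eq mult_ac)
qed

lemma Hx_off_diag_le:
  assumes "i \<in> Ix" "j \<in> Ix" "i \<noteq> j" shows "\<bar>Hx i j\<bar> \<le> a1 / N"
proof -
  have a01: "a0 \<le> a1" using a_ge[of 1 1] a_le[of 1 1] m1 n1 by simp
  have aa: "\<bar>a j k - a0\<bar> \<le> a1" if "j \<in> {1..m}" "k \<in> {1..n}" for j k
    using a_ge[OF that] a_le[OF that] a0_pos by auto
  show ?thesis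
    using assms N_pos a01 a0_pos aa by (cases i; cases j) (auto simp: Ix_def divide_right_mono)
qed

text \<open>The bound of \<open>K_off_diag_le\<close> with off-diagonal size \<open>a1 / N\<close>
  and dimension N, multiplied by N.\<close>

definition C0 :: real where "C0 = (a1 + a1\<^sup>2 / \<kappa>x) / \<kappa>x\<^sup>2"

lemma K_off_le: "i \<in> Ix \<Longrightarrow> j \<in> Ix \<Longrightarrow> i \<noteq> j \<Longrightarrow> \<bar>K i j\<bar> \<le> C0 / N"
proof -
  assume ij: "i \<in> Ix" "j \<in> Ix" "i \<noteq> j"
  have "(a1 / s + s * (a1 / s)\<^sup>2 / \<kappa>x) / \<kappa>x\<^sup>2 = C0 / s" if "0 < s" for s
    using that \<kappa>x_pos by (simp add: C0_def field_simps power2_eq_square)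
  then have eq: "(a1 / N + N * (a1 / N)\<^sup>2 / \<kappa>x) / \<kappa>x\<^sup>2 = C0 / N" using N_pos by blast
  have "\<bar>K i j\<bar> \<le> (a1 / N + real (card Ix) * (a1 / N)\<^sup>2 / \<kappa>x) / \<kappa>x\<^sup>2"
    by (rule K_off_diag_le[OF ij Hx_off_diag_le])
  then show "\<bar>K i j\<bar> \<le> C0 / N" unfolding card_Ix eq .
qed

lemma a1_pos: "0 < a1" using a_ge[of 1 1] a_le[of 1 1] m1 n1 a0_pos by simp

lemma C0_nonneg: "0 \<le> C0" using a1_pos \<kappa>x_pos by (simp add: C0_def)

lemma K_diag_abs_le: "i \<in> Ix \<Longrightarrow> \<bar>K i i\<bar> \<le> 1 / \<kappa>x"
  using K_diag_le[of i] cov_coord[of i i] cov_nonneg[of "\<lambda>l. of_bool (l = i)"] by simp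

lemma sum_abs_K_le: 
  assumes "i \<in> Ix" "J \<subseteq> Ix"
  shows "(\<Sum>l\<in>J. \<bar>K i l\<bar>) \<le> 1 / \<kappa>x + C0"
proof -
  have "(\<Sum>l\<in>J. \<bar>K i l\<bar>) \<le> (\<Sum>l\<in>Ix. \<bar>K i l\<bar>)" using assms by (intro sum_mono2) auto
  also have "\<dots> \<le> (\<Sum>l\<in>Ix. (if l = i then 1 / \<kappa>x else 0) + C0 / N)"
    using assms(1) K_off_le K_diag_abs_le C0_nonneg N_pos by (intro sum_mono) (auto intro: add_increasing2)
  also have "\<dots> = 1 / \<kappa>x + real (card Ix) * (C0 / N)" using assms(1) by (simp add: sum.distrib)
  also have "\<dots> = 1 / \<kappa>x + C0" using N_pos by (simp add: card_Ix)
  finally show ?thesis .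
qed

text \<open>The incidence vector of the edge (j, k) of the complete bipartite graph; its linear form
  is the sum of the two end coordinates.\<close>

definition vx :: "nat \<times> nat \<Rightarrow> nat + nat \<Rightarrow> real" where
  "vx = (\<lambda>(j, k) i. of_bool (i = Inl j) + of_bool (i = Inr k))"

lemma lin_vx: "j \<in> {1..m} \<Longrightarrow> k \<in> {1..n} \<Longrightarrow> lin (vx (j, k)) x = x (Inl j) + x (Inr k)"
  unfolding lin_def vx_def sum_Ix by (simp add: distrib_right sum.distrib)

lemma cov_vx:
  assumes "j \<in> {1..m}" "k \<in> {1..n}" "j' \<in> {1..m}" "k' \<in> {1..n}"
  shows "cov (vx (j, k)) (vx (j', k')) = K (Inl j) (Inl j') + K (Inl j) (Inr k') + K (Inr k) (Inl j') + K (Inr k) (Inr k')"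
proof -
  have i: "Inl j \<in> Ix" "Inr k \<in> Ix" "Inl j' \<in> Ix" "Inr k' \<in> Ix" using assms by (auto simp: Ix_def)
  have "cov (vx (j, k)) (vx (j', k')) = E (\<lambda>x. x (Inl j) * x (Inl j') + x (Inl j) * x (Inr k') + x (Inr k) * x (Inl j') + x (Inr k) * x (Inr k'))"
    unfolding E_lin_lin[symmetric] lin_vx[OF assms(1,2)] lin_vx[OF assms(3,4)] by (simp add: algebra_simps)
  also have "\<dots> = K (Inl j) (Inl j') + K (Inl j) (Inr k') + K (Inr k) (Inl j') + K (Inr k) (Inr k')"
    unfolding K_def using i by (simp add: integrable_P)
  finally show ?thesis .
qed

definition Sx :: real where "Sx = max 1 (2 / \<kappa>x)"
definition \<rho>0 :: real where "\<rho>0 = 4 * (1 / \<kappa>x + C0)"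

lemma \<rho>0_pos: "0 < \<rho>0" using \<kappa>x_pos C0_nonneg by (simp add: \<rho>0_def add_pos_nonneg)

text \<open>\<open>Sx\<close> uses that an incidence vector has squared norm 2. In a row of the edge
  covariances, an edge sharing a vertex contributes O(1) and there are O(N) of these; each of the
  other O(N^2) edges contributes O(1/N). Both groups add up to O(N).\<close>

sublocale fam: gaussian_family Ix Hx \<kappa>x "{1..m} \<times> {1..n}" vx Sx "\<rho>0 * N"
proof
  show "finite ({1..m} \<times> {1..n})" by simp
  show "1 \<le> Sx" by (simp add: Sx_def)
next
  fix z assume "z \<in> {1..m} \<times> {1..n}"
  then obtain j k where z: "z = (j, k)" "j \<in> {1..m}" "k \<in> {1..n}" by auto
  have i: "Inl j \<in> Ix" "Inr k \<in> Ix" using z by (auto simp: Ix_def)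
  have sq: "(vx (j, k) i)\<^sup>2 = of_bool (i = Inl j) + of_bool (i = Inr k)" for i
    by (auto simp: vx_def)
  have "(\<Sum>i\<in>Ix. (vx z i)\<^sup>2) = 2"
    unfolding z(1) sq using i by (simp add: sum.distrib)
  then show "cov (vx z) (vx z) \<le> Sx" using cov_le[of "vx z"] by (simp add: Sx_def)
  have L: "Inl ` {1..m} \<subseteq> Ix" and R: "Inr ` {1..n} \<subseteq> Ix" by (auto simp: Ix_def)
  have sL: "(\<Sum>j'=1..m. \<bar>K i (Inl j')\<bar>) \<le> 1 / \<kappa>x + C0" if "i \<in> Ix" for i
    using sum_abs_K_le[OF that L] by (simp add: sum.reindex)
  have sR: "(\<Sum>k'=1..n. \<bar>K i (Inr k')\<bar>) \<le> 1 / \<kappa>x + C0" if "i \<in> Ix" for i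
    using sum_abs_K_le[OF that R] by (simp add: sum.reindex)
  have "(\<Sum>b\<in>{1..m} \<times> {1..n}. \<bar>cov (vx z) (vx b)\<bar>) = (\<Sum>j'=1..m. \<Sum>k'=1..n. \<bar>cov (vx z) (vx (j', k'))\<bar>)"
    by (simp add: sum.cartesian_product)
  also have "\<dots> \<le> (\<Sum>j'=1..m. \<Sum>k'=1..n. \<bar>K (Inl j) (Inl j')\<bar> + \<bar>K (Inl j) (Inr k')\<bar> + \<bar>K (Inr k) (Inl j')\<bar> + \<bar>K (Inr k) (Inr k')\<bar>)"
    unfolding z(1)
  proof (intro sum_mono)
    fix j' k' assume "j' \<in> {1..m}" "k' \<in> {1..n}"
    from cov_vx[OF z(2,3) this]
    show "\<bar>cov (vx (j, k)) (vx (j', k'))\<bar> \<le> \<bar>K (Inl j) (Inl j')\<bar> + \<bar>K (Inl j) (Inr k')\<bar> + \<bar>K (Inr k) (Inl j')\<bar> + \<bar>K (Inr k) (Inr k')\<bar>"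
      by linarith
  qed
  also have "\<dots> = real n * (\<Sum>j'=1..m. \<bar>K (Inl j) (Inl j')\<bar>) + real m * (\<Sum>k'=1..n. \<bar>K (Inl j) (Inr k')\<bar>)
     + real n * (\<Sum>j'=1..m. \<bar>K (Inr k) (Inl j')\<bar>) + real m * (\<Sum>k'=1..n. \<bar>K (Inr k) (Inr k')\<bar>)"
    by (simp add: sum.distrib sum_distrib_left)
  also have "\<dots> \<le> real n * (1 / \<kappa>x + C0) + real m * (1 / \<kappa>x + C0) + real n * (1 / \<kappa>x + C0) + real m * (1 / \<kappa>x + C0)"
    using i by (intro add_mono mult_left_mono sL sR) auto
  also have "\<dots> = 2 * N * (1 / \<kappa>x + C0)" by (simp add: algebra_simps)
  also have "\<dots> \<le> 4 * N * (1 / \<kappa>x + C0)"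
    using N_pos \<kappa>x_pos C0_nonneg by (intro mult_right_mono) auto
  also have "\<dots> = \<rho>0 * N" by (simp only: \<rho>0_def mult_ac)
  finally show "(\<Sum>b\<in>{1..m} \<times> {1..n}. \<bar>cov (vx z) (vx b)\<bar>) \<le> \<rho>0 * N" .
qed

end

section \<open>From the hyperplane to the full space\<close>

lemma sigma_finite_lebPi: "finite A \<Longrightarrow> sigma_finite_measure (lebPi A)"
  by (rule lb.sigma_finite)

lemma measurable_merge_sum [measurable]:
  "(\<lambda>(s, t). \<lambda>i\<in>A <+> B. case_sum s t i) \<in> lebPi A \<Otimes>\<^sub>M lebPi B \<rightarrow>\<^sub>M lebPi (A <+> B)"
  unfolding case_prod_unfold
proof (rule measurable_restrict)
  fix i assume "i \<in> A <+> B"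
  then show "(\<lambda>x. case_sum (fst x) (snd x) i) \<in> lebPi A \<Otimes>\<^sub>M lebPi B \<rightarrow>\<^sub>M lborel"
    by (cases i) auto
qed

lemma ball_Plus: "(\<forall>i\<in>A <+> B. R i) \<longleftrightarrow> (\<forall>i\<in>A. R (Inl i)) \<and> (\<forall>i\<in>B. R (Inr i))"
  by auto

lemma lebPi_Plus:
  assumes A: "finite A" and B: "finite B"
  shows "distr (lebPi A \<Otimes>\<^sub>M lebPi B) (lebPi (A <+> B)) (\<lambda>(s, t). \<lambda>i\<in>A <+> B. case_sum s t i) = lebPi (A <+> B)"
    (is "distr ?M _ ?f = _")
proof (rule lb.PiM_eqI)
  interpret B: sigma_finite_measure "lebPi B" by (rule sigma_finite_lebPi[OF B])
  fix F :: "_ \<Rightarrow> real set" assume F: "\<And>i. i \<in> A <+> B \<Longrightarrow> F i \<in> sets lborel"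
  have "Pi\<^sub>E (A <+> B) F \<in> sets (lebPi (A <+> B))"
    using F A B by (intro sets_PiM_I_finite) auto
  then have "emeasure (distr ?M (lebPi (A <+> B)) ?f) (Pi\<^sub>E (A <+> B) F) = emeasure ?M (?f -` Pi\<^sub>E (A <+> B) F \<inter> space ?M)"
    by (intro emeasure_distr) auto
  also have "?f -` Pi\<^sub>E (A <+> B) F \<inter> space ?M = Pi\<^sub>E A (F \<circ> Inl) \<times> Pi\<^sub>E B (F \<circ> Inr)"
    by (auto simp: space_pair_measure space_PiM PiE_iff ball_Plus)
  also have "emeasure ?M \<dots> = emeasure (lebPi A) (Pi\<^sub>E A (F \<circ> Inl)) * emeasure (lebPi B) (Pi\<^sub>E B (F \<circ> Inr))"
    using F A B by (intro B.emeasure_pair_measure_Times sets_PiM_I_finite) auto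
  also have "\<dots> = (\<Prod>i\<in>A. emeasure lborel (F (Inl i))) * (\<Prod>i\<in>B. emeasure lborel (F (Inr i)))"
    using F A B by (subst (1 2) lb.emeasure_PiM) auto
  also have "\<dots> = (\<Prod>i\<in>A <+> B. emeasure lborel (F i))"
    using A B by (subst prod.Plus) auto
  finally show "emeasure (distr ?M (lebPi (A <+> B)) ?f) (Pi\<^sub>E (A <+> B) F) = (\<Prod>i\<in>A <+> B. emeasure lborel (F i))" .
qed (use A B in simp_all)

lemma nn_integral_lebPi_Plus:
  assumes A: "finite A" and B: "finite B" and [measurable]: "u \<in> borel_measurable (lebPi (A <+> B))"
  shows "(\<integral>\<^sup>+x. u x \<partial>lebPi (A <+> B)) = (\<integral>\<^sup>+s. \<integral>\<^sup>+t. u (\<lambda>i\<in>A <+> B. case_sum s t i) \<partial>lebPi B \<partial>lebPi A)"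
proof -
  interpret B: sigma_finite_measure "lebPi B" by (rule sigma_finite_lebPi[OF B])
  have "(\<integral>\<^sup>+x. u x \<partial>lebPi (A <+> B)) = (\<integral>\<^sup>+p. u (case p of (s, t) \<Rightarrow> \<lambda>i\<in>A <+> B. case_sum s t i) \<partial>(lebPi A \<Otimes>\<^sub>M lebPi B))"
    by (subst lebPi_Plus[OF A B, symmetric], subst nn_integral_distr) auto
  also have "\<dots> = (\<integral>\<^sup>+s. \<integral>\<^sup>+t. u (\<lambda>i\<in>A <+> B. case_sum s t i) \<partial>lebPi B \<partial>lebPi A)"
    by (subst B.nn_integral_fst[symmetric]) auto
  finally show ?thesis .
qed

lemma nn_integral_lebPi_lborel_swap:
  assumes "finite A" and f: "(\<lambda>(w, s). f s w) \<in> borel_measurable (lborel \<Otimes>\<^sub>M lebPi A)"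
  shows "(\<integral>\<^sup>+s. \<integral>\<^sup>+w. f s w \<partial>lborel \<partial>lebPi A) = (\<integral>\<^sup>+w. \<integral>\<^sup>+s. f s w \<partial>lebPi A \<partial>(lborel :: real measure))"
proof -
  interpret A: sigma_finite_measure "lebPi A" by (rule sigma_finite_lebPi[OF assms(1)])
  interpret pair_sigma_finite "lborel :: real measure" "lebPi A" by unfold_locales
  show ?thesis using Fubini'[of "\<lambda>w s. f s w"] f by simp
qed

text \<open>Undoing the affine shifts turns the arguments of \<open>V\<close> into plain s and t and
  the argument of \<open>\<gamma>\<close> into an offset minus \<open>L * w\<close>. Then w occurs
  in \<open>\<gamma>\<close> only, and its integral does not depend on the offset. The 1 in
  \<open>L\<close> counts the coordinate w itself besides those in A and B.\<close>

lemma integrate_out_gauge_direction: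
  fixes V :: "('i \<Rightarrow> real) \<Rightarrow> ('j \<Rightarrow> real) \<Rightarrow> ennreal"
  assumes A: "finite A" and B: "finite B" and c: "0 < c"
    and V [measurable]: "(\<lambda>(s, t). V s t) \<in> borel_measurable (lebPi A \<Otimes>\<^sub>M lebPi B)"
    and \<gamma> [measurable]: "\<gamma> \<in> borel_measurable borel" and even: "\<And>z. \<gamma> (- z) = \<gamma> z"
  defines "L \<equiv> real (card A) + real (card B) + 1"
  shows "ennreal (c ^ card A) * ennreal (c ^ card B) *
      (\<integral>\<^sup>+s. \<integral>\<^sup>+w. \<integral>\<^sup>+t. V (\<lambda>i\<in>A. c * w + c * s i) (\<lambda>i\<in>B. - c * w + c * t i) * \<gamma> ((\<Sum>i\<in>A. s i) - (\<Sum>i\<in>B. t i) - w)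
        \<partial>lebPi B \<partial>lborel \<partial>lebPi A)
    = (\<integral>\<^sup>+w. \<gamma> (L * w) \<partial>lborel) * (\<integral>\<^sup>+s. \<integral>\<^sup>+t. V s t \<partial>lebPi B \<partial>lebPi A)"
proof -
  interpret SA: sigma_finite_measure "lebPi A" by (rule sigma_finite_lebPi[OF A])
  interpret SB: sigma_finite_measure "lebPi B" by (rule sigma_finite_lebPi[OF B])
  have aff [measurable]: "(\<lambda>p. \<lambda>i\<in>J. d * fst p + c * snd p i) \<in> lborel \<Otimes>\<^sub>M lebPi J \<rightarrow>\<^sub>M lebPi J" for d and J :: "'x set"
    by (rule measurable_restrict) measurable
  define D where "D s t = (\<Sum>i\<in>A. s i) - (\<Sum>i\<in>B. t i)" for s :: "'i \<Rightarrow> real" and t :: "'j \<Rightarrow> real"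
  \<comment> \<open>The integrand in the shifted variables: the shifts change the sum difference D
    by \<open>c\<close> times the number of coordinates times w, and the remaining -w completes
    \<open>L * w\<close>.\<close>
  define G where "G w s t = V s t * \<gamma> (D s t / c - L * w)" for w s t
  define sh where "sh w s = (\<lambda>i\<in>A. c * w + c * s i)" for w and s :: "'i \<Rightarrow> real"
  define th where "th w t = (\<lambda>i\<in>B. - c * w + c * t i)" for w and t :: "'j \<Rightarrow> real"
  have [measurable]: "(\<lambda>p. sh (fst p) (snd p)) \<in> lborel \<Otimes>\<^sub>M lebPi A \<rightarrow>\<^sub>M lebPi A"
    "(\<lambda>p. th (fst p) (snd p)) \<in> lborel \<Otimes>\<^sub>M lebPi B \<rightarrow>\<^sub>M lebPi B"
    unfolding sh_def th_def by (rule aff)+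
  have mD [measurable]: "(\<lambda>p. D (fst p) (snd p)) \<in> borel_measurable (lebPi A \<Otimes>\<^sub>M lebPi B)"
    unfolding D_def by measurable
  have mV: "(\<lambda>p. V (fst p) (snd p)) \<in> borel_measurable (lebPi A \<Otimes>\<^sub>M lebPi B)"
    using V by (simp add: case_prod_unfold)
  have mG: "(\<lambda>p. G (fst p) (fst (snd p)) (snd (snd p))) \<in> borel_measurable (lborel \<Otimes>\<^sub>M (lebPi A \<Otimes>\<^sub>M lebPi B))"
  proof -
    have [measurable]: "(\<lambda>p. V (fst (snd p)) (snd (snd p))) \<in> borel_measurable (lborel \<Otimes>\<^sub>M (lebPi A \<Otimes>\<^sub>M lebPi B))"
      using measurable_compose[OF measurable_snd mV] .
    have [measurable]: "(\<lambda>p. D (fst (snd p)) (snd (snd p))) \<in> borel_measurable (lborel \<Otimes>\<^sub>M (lebPi A \<Otimes>\<^sub>M lebPi B))"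
      using measurable_compose[OF measurable_snd mD] .
    show ?thesis unfolding G_def by measurable
  qed
  have Gc: "(\<lambda>x. G (f x) (g x) (h x)) \<in> borel_measurable M"
    if [measurable]: "f \<in> borel_measurable M" "g \<in> M \<rightarrow>\<^sub>M lebPi A" "h \<in> M \<rightarrow>\<^sub>M lebPi B" for f g h and M :: "'x measure"
  proof -
    have "(\<lambda>x. (f x, g x, h x)) \<in> M \<rightarrow>\<^sub>M lborel \<Otimes>\<^sub>M (lebPi A \<Otimes>\<^sub>M lebPi B)" by measurable
    from measurable_compose[OF this mG] show ?thesis by simp
  qed
  have shc: "(\<lambda>x. sh (f x) (g x)) \<in> M \<rightarrow>\<^sub>M lebPi A" if "f \<in> borel_measurable M" "g \<in> M \<rightarrow>\<^sub>M lebPi A" for f g and M :: "'x measure"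
  proof -
    have "(\<lambda>x. g x i) \<in> borel_measurable M" if "i \<in> A" for i
      using measurable_compose[OF \<open>g \<in> M \<rightarrow>\<^sub>M lebPi A\<close> measurable_component_singleton[OF that]] by simp
    then show ?thesis using \<open>f \<in> borel_measurable M\<close> unfolding sh_def by (intro measurable_restrict) simp
  qed
  have thc: "(\<lambda>x. th (f x) (g x)) \<in> M \<rightarrow>\<^sub>M lebPi B" if "f \<in> borel_measurable M" "g \<in> M \<rightarrow>\<^sub>M lebPi B" for f g and M :: "'x measure"
  proof -
    have "(\<lambda>x. g x i) \<in> borel_measurable M" if "i \<in> B" for i
      using measurable_compose[OF \<open>g \<in> M \<rightarrow>\<^sub>M lebPi B\<close> measurable_component_singleton[OF that]] by simp
    then show ?thesis using \<open>f \<in> borel_measurable M\<close> unfolding th_def by (intro measurable_restrict) simp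
  qed
  have point: "V (sh w s) (th w t) * \<gamma> ((\<Sum>i\<in>A. s i) - (\<Sum>i\<in>B. t i) - w) = G w (sh w s) (th w t)" for w s t
  proof -
    have "D (sh w s) (th w t) = c * ((\<Sum>i\<in>A. s i) - (\<Sum>i\<in>B. t i)) + c * (real (card A) + real (card B)) * w"
      by (simp add: D_def sh_def th_def sum.distrib sum_subtractf sum_distrib_left algebra_simps)
    then have "D (sh w s) (th w t) / c - L * w = (\<Sum>i\<in>A. s i) - (\<Sum>i\<in>B. t i) - w"
      using c by (simp add: L_def field_simps)
    then show ?thesis by (simp add: G_def)
  qed
  have mth: "(\<lambda>t. G w s (th w t)) \<in> borel_measurable (lebPi B)" if "s \<in> space (lebPi A)" for w s
    by (intro Gc thc) (use that in auto)
  have mst: "(\<lambda>p. G (fst p) (snd p) t) \<in> borel_measurable (lborel \<Otimes>\<^sub>M lebPi A)" if "t \<in> space (lebPi B)" for t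
    by (intro Gc) (use that in auto)
  have m1: "(\<lambda>p. \<integral>\<^sup>+t. G (fst p) (snd p) t \<partial>lebPi B) \<in> borel_measurable (lborel \<Otimes>\<^sub>M lebPi A)"
    by (intro SB.borel_measurable_nn_integral) (simp add: case_prod_unfold, intro Gc; measurable)
  have m2: "(\<lambda>p. \<integral>\<^sup>+t. G (fst p) (sh (fst p) (snd p)) (th (fst p) t) \<partial>lebPi B) \<in> borel_measurable (lborel \<Otimes>\<^sub>M lebPi A)"
    by (intro SB.borel_measurable_nn_integral) (simp add: case_prod_unfold, intro Gc shc thc; measurable)
  have m3: "(\<lambda>p. \<integral>\<^sup>+t. G (fst p) (snd p) (th (fst p) t) \<partial>lebPi B) \<in> borel_measurable (lborel \<Otimes>\<^sub>M lebPi A)"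
    by (intro SB.borel_measurable_nn_integral) (simp add: case_prod_unfold, intro Gc shc thc; measurable)
  let ?a = "ennreal (c ^ card A)" and ?b = "ennreal (c ^ card B)"
  have inner: "?b * (\<integral>\<^sup>+t. G w s (th w t) \<partial>lebPi B) = (\<integral>\<^sup>+t. G w s t \<partial>lebPi B)" if "s \<in> space (lebPi A)" for w s
    unfolding th_def by (rule nn_integral_lebPi_affine[OF B _ c]) (intro Gc; use that in simp)
  have outer: "?a * (\<integral>\<^sup>+s. (\<integral>\<^sup>+t. G w (sh w s) (th w t) \<partial>lebPi B) \<partial>lebPi A) = (\<integral>\<^sup>+s. (\<integral>\<^sup>+t. G w s (th w t) \<partial>lebPi B) \<partial>lebPi A)" for w
    unfolding sh_def
    by (rule nn_integral_lebPi_affine[OF A _ c]) (use measurable_compose[OF measurable_Pair1'[of w lborel "lebPi A"] m3] in simp)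
  have "?a * ?b * (\<integral>\<^sup>+s. \<integral>\<^sup>+w. \<integral>\<^sup>+t. V (sh w s) (th w t) * \<gamma> ((\<Sum>i\<in>A. s i) - (\<Sum>i\<in>B. t i) - w) \<partial>lebPi B \<partial>lborel \<partial>lebPi A)
    = ?a * ?b * (\<integral>\<^sup>+w. \<integral>\<^sup>+s. \<integral>\<^sup>+t. G w (sh w s) (th w t) \<partial>lebPi B \<partial>lebPi A \<partial>lborel)"
    unfolding point by (subst nn_integral_lebPi_lborel_swap[OF A]) (use m2 in \<open>simp_all add: case_prod_unfold\<close>)
  also have "\<dots> = (\<integral>\<^sup>+w. ?b * (?a * (\<integral>\<^sup>+s. \<integral>\<^sup>+t. G w (sh w s) (th w t) \<partial>lebPi B \<partial>lebPi A)) \<partial>lborel)"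
  proof -
    have "(\<lambda>w. \<integral>\<^sup>+s. \<integral>\<^sup>+t. G w (sh w s) (th w t) \<partial>lebPi B \<partial>lebPi A) \<in> borel_measurable lborel"
      by (intro SA.borel_measurable_nn_integral) (use m2 in \<open>simp add: case_prod_unfold\<close>)
    then show ?thesis by (subst nn_integral_cmult[symmetric]) (auto simp: mult_ac)
  qed
  also have "\<dots> = (\<integral>\<^sup>+w. ?b * (\<integral>\<^sup>+s. \<integral>\<^sup>+t. G w s (th w t) \<partial>lebPi B \<partial>lebPi A) \<partial>lborel)"
    by (simp only: outer)
  also have "\<dots> = (\<integral>\<^sup>+w. \<integral>\<^sup>+s. \<integral>\<^sup>+t. G w s t \<partial>lebPi B \<partial>lebPi A \<partial>lborel)"
  proof (rule nn_integral_cong)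
    fix w
    have "(\<lambda>s. \<integral>\<^sup>+t. G w s (th w t) \<partial>lebPi B) \<in> borel_measurable (lebPi A)"
      using measurable_compose[OF measurable_Pair1'[of w lborel "lebPi A"] m3] by simp
    then have "?b * (\<integral>\<^sup>+s. \<integral>\<^sup>+t. G w s (th w t) \<partial>lebPi B \<partial>lebPi A) = (\<integral>\<^sup>+s. ?b * (\<integral>\<^sup>+t. G w s (th w t) \<partial>lebPi B) \<partial>lebPi A)"
      by (rule nn_integral_cmult[symmetric])
    also have "\<dots> = (\<integral>\<^sup>+s. \<integral>\<^sup>+t. G w s t \<partial>lebPi B \<partial>lebPi A)"
      by (intro nn_integral_cong inner)
    finally show "?b * (\<integral>\<^sup>+s. \<integral>\<^sup>+t. G w s (th w t) \<partial>lebPi B \<partial>lebPi A) = (\<integral>\<^sup>+s. \<integral>\<^sup>+t. G w s t \<partial>lebPi B \<partial>lebPi A)" .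
  qed
  also have "\<dots> = (\<integral>\<^sup>+s. \<integral>\<^sup>+w. \<integral>\<^sup>+t. G w s t \<partial>lebPi B \<partial>lborel \<partial>lebPi A)"
    by (subst nn_integral_lebPi_lborel_swap[OF A]) (use m1 in \<open>simp_all add: case_prod_unfold\<close>)
  also have "\<dots> = (\<integral>\<^sup>+s. \<integral>\<^sup>+t. \<integral>\<^sup>+w. G w s t \<partial>lborel \<partial>lebPi B \<partial>lebPi A)"
  proof (rule nn_integral_cong)
    fix s assume s: "s \<in> space (lebPi A)"
    have "(\<lambda>p. G (fst p) s (snd p)) \<in> borel_measurable (lborel \<Otimes>\<^sub>M lebPi B)"
      using s by (intro Gc) auto
    then show "(\<integral>\<^sup>+w. \<integral>\<^sup>+t. G w s t \<partial>lebPi B \<partial>lborel) = (\<integral>\<^sup>+t. \<integral>\<^sup>+w. G w s t \<partial>lborel \<partial>lebPi B)"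
      by (subst nn_integral_lebPi_lborel_swap[OF B]) (simp_all add: case_prod_unfold)
  qed
  also have "\<dots> = (\<integral>\<^sup>+s. \<integral>\<^sup>+t. (\<integral>\<^sup>+w. \<gamma> (L * w) \<partial>lborel) * V s t \<partial>lebPi B \<partial>lebPi A)"
  proof (intro nn_integral_cong)
    fix s t
    have L: "0 < L" by (simp add: L_def add_nonneg_pos)
    \<comment> \<open>Evenness turns the coefficient of w positive, as the affine substitution
      requires.\<close>
    have e: "\<gamma> (D s t / c - L * w) = \<gamma> (- (D s t / c) + L * w)" for w
      using even[of "D s t / c - L * w"] by simp
    have "ennreal L * (\<integral>\<^sup>+w. \<gamma> (- (D s t / c) + L * w) \<partial>lborel) = ennreal L * (\<integral>\<^sup>+w. \<gamma> (0 + L * w) \<partial>lborel)"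
      unfolding nn_integral_lborel_affine[OF \<gamma> L] ..
    then have "(\<integral>\<^sup>+w. \<gamma> (- (D s t / c) + L * w) \<partial>lborel) = (\<integral>\<^sup>+w. \<gamma> (L * w) \<partial>lborel)"
      using L by (simp add: ennreal_mult_cancel_left)
    then show "(\<integral>\<^sup>+w. G w s t \<partial>lborel) = (\<integral>\<^sup>+w. \<gamma> (L * w) \<partial>lborel) * V s t"
      unfolding G_def e by (subst nn_integral_cmult) (auto simp: mult.commute)
  qed
  also have "\<dots> = (\<integral>\<^sup>+s. (\<integral>\<^sup>+w. \<gamma> (L * w) \<partial>lborel) * (\<integral>\<^sup>+t. V s t \<partial>lebPi B) \<partial>lebPi A)"
  proof (rule nn_integral_cong, rule nn_integral_cmult)
    fix s assume "s \<in> space (lebPi A)"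
    from measurable_compose[OF measurable_Pair1'[OF this] mV] show "V s \<in> borel_measurable (lebPi B)" by simp
  qed
  also have "\<dots> = (\<integral>\<^sup>+w. \<gamma> (L * w) \<partial>lborel) * (\<integral>\<^sup>+s. \<integral>\<^sup>+t. V s t \<partial>lebPi B \<partial>lebPi A)"
    by (rule nn_integral_cmult) (use V in measurable)
  finally show ?thesis unfolding sh_def th_def .
qed

section \<open>Integrals over the hyperplane\<close>

lemma measurable_extend_zero:
  fixes n :: nat
  assumes "1 \<le> n"
  shows "(\<lambda>t. t(n := 0)) \<in> lebPi {1..<n} \<rightarrow>\<^sub>M lebPi {1..n}"
  using assms by (intro measurable_fun_upd[where J = "{1..<n}"]) auto

lemma measurable_extend_zero_pair:
  fixes n :: nat
  assumes "1 \<le> n"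
  shows "(\<lambda>(s, t). (s, t(n := 0))) \<in> lebPi {1..m} \<Otimes>\<^sub>M lebPi {1..<n} \<rightarrow>\<^sub>M lebPair m n"
  unfolding case_prod_unfold
  by (rule measurable_Pair[OF measurable_fst measurable_compose[OF measurable_snd measurable_extend_zero[OF assms]]])

lemma nn_integral_hyperplane:
  assumes n: "1 \<le> n" and u: "u \<in> borel_measurable (lebPair m n)"
  shows "(\<integral>\<^sup>+p. u p \<partial>hyperplane_lebesgue m n) = (\<integral>\<^sup>+s. \<integral>\<^sup>+t. u (s, t(n := 0)) \<partial>lebPi {1..<n} \<partial>lebPi {1..m})"
proof -
  interpret B: sigma_finite_measure "lebPi {1..<n}" by (rule sigma_finite_lebPi) simp
  have "(\<integral>\<^sup>+p. u p \<partial>hyperplane_lebesgue m n) = (\<integral>\<^sup>+p. u (case p of (s, t) \<Rightarrow> (s, t(n := 0))) \<partial>(lebPi {1..m} \<Otimes>\<^sub>M lebPi {1..<n}))"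
    unfolding hyperplane_lebesgue_def by (rule nn_integral_distr[OF measurable_extend_zero_pair[OF n]]) (use u in \<open>simp only: measurable_distr_eq1\<close>)
  also have "\<dots> = (\<integral>\<^sup>+s. \<integral>\<^sup>+t. u (s, t(n := 0)) \<partial>lebPi {1..<n} \<partial>lebPi {1..m})"
    using B.nn_integral_fst[OF measurable_compose[OF measurable_extend_zero_pair[OF n] u]] by simp
  finally show ?thesis .
qed

lemma sets_hyperplane [simp, measurable_cong]:
  "sets (hyperplane_lebesgue m n) = sets (lebPair m n)"
  by (simp add: hyperplane_lebesgue_def)

lemma space_hyperplane [simp]:
  "space (hyperplane_lebesgue m n) = space (lebPair m n)"
  by (simp add: hyperplane_lebesgue_def)

lemma measurable_pair_coordinates:
  assumes "j \<in> A" "k \<in> B"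
  shows "(\<lambda>p. fst p j + snd p k) \<in> borel_measurable (lebPi A \<Otimes>\<^sub>M lebPi B)"
proof -
  have "(\<lambda>p. fst p j) \<in> lebPi A \<Otimes>\<^sub>M lebPi B \<rightarrow>\<^sub>M lborel"
    by (rule measurable_compose[OF measurable_fst measurable_component_singleton[OF assms(1)]])
  moreover have "(\<lambda>p. snd p k) \<in> lebPi A \<Otimes>\<^sub>M lebPi B \<rightarrow>\<^sub>M lborel"
    by (rule measurable_compose[OF measurable_snd measurable_component_singleton[OF assms(2)]])
  ultimately show ?thesis by (simp add: borel_measurable_add)
qed

lemma measurable_q_form [measurable]: "q_form m n Z \<in> borel_measurable (lebPair m n)"
  and measurable_f_form [measurable]: "f_form m n Z \<in> borel_measurable (lebPair m n)"
  and measurable_h_form [measurable]: "h_form m n Z \<in> borel_measurable (lebPair m n)"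
  unfolding q_form_def f_form_def h_form_def case_prod_unfold
  by (intro borel_measurable_times borel_measurable_const borel_measurable_sum borel_measurable_power measurable_pair_coordinates; assumption)+

lemma ennreal_cross_divide:
  fixes b x g y :: ennreal
  assumes "b * x = g * y" and b: "b \<noteq> 0" "b \<noteq> \<top>"
  shows "x = g / b * y"
proof -
  have "x = x * b / b" using b by (simp add: mult_divide_eq_ennreal)
  also have "x * b = g * y" using assms(1) by (simp only: mult.commute)
  also have "g * y / b = g / b * y" by (simp only: trans[OF ennreal_divide_times ennreal_times_divide])
  finally show ?thesis .
qed

locale margins =
  fixes m n :: nat and Z :: "nat \<Rightarrow> nat \<Rightarrow> real" and \<delta> \<tau> :: real
  assumes m1: "1 \<le> m" and n1: "1 \<le> n"
    and \<delta>: "0 < \<delta>" "\<delta> < 1"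
    and mn: "\<delta> * real n \<le> real m" and nm: "\<delta> * real m \<le> real n"
    and \<tau>: "\<delta> < \<tau>"
    and Z_ge: "\<And>j k. j \<in> {1..m} \<Longrightarrow> k \<in> {1..n} \<Longrightarrow> \<delta> * \<tau> \<le> Z j k"
    and Z_le: "\<And>j k. j \<in> {1..m} \<Longrightarrow> k \<in> {1..n} \<Longrightarrow> Z j k \<le> \<tau>"
begin

lemma \<tau>_pos: "0 < \<tau>" using \<delta> \<tau> by simp

lemma Z_pos: "j \<in> {1..m} \<Longrightarrow> k \<in> {1..n} \<Longrightarrow> 0 < Z j k"
  using Z_ge[of j k] mult_pos_pos[OF \<delta>(1) \<tau>_pos] by linarith

text \<open>Dividing the weights by \<open>\<tau>\<^sup>2\<close> leaves bounds that depend on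
  \<delta> only: \<zeta> \<ge> \<delta> \<tau> gives the lower one, and \<tau> > \<delta> gives
  \<zeta> \<le> \<tau> \<le> \<tau>^2 / \<delta> for the upper one.\<close>

sublocale bipartite m n "\<lambda>j k. ((Z j k)\<^sup>2 + Z j k) / \<tau>\<^sup>2" \<delta> "\<delta>\<^sup>2" "1 + 1 / \<delta>"
proof
  fix j k assume jk: "j \<in> {1..m}" "k \<in> {1..n}"
  have "(\<delta> * \<tau>)\<^sup>2 \<le> (Z j k)\<^sup>2" using Z_ge[OF jk] \<delta> \<tau>_pos by (intro power_mono) auto
  then have "\<delta>\<^sup>2 * \<tau>\<^sup>2 \<le> (Z j k)\<^sup>2 + Z j k" using Z_pos[OF jk] by (simp add: power_mult_distrib)
  then show "\<delta>\<^sup>2 \<le> ((Z j k)\<^sup>2 + Z j k) / \<tau>\<^sup>2" using \<tau>_pos by (simp add: pos_le_divide_eq)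
  have "\<tau> \<le> \<tau>\<^sup>2 / \<delta>" using \<tau> \<tau>_pos \<delta> by (simp add: pos_le_divide_eq power2_eq_square)
  moreover have "(Z j k)\<^sup>2 \<le> \<tau>\<^sup>2" using Z_le[OF jk] Z_pos[OF jk] by (intro power_mono) auto
  ultimately have "(Z j k)\<^sup>2 + Z j k \<le> (1 + 1 / \<delta>) * \<tau>\<^sup>2"
    using Z_le[OF jk] by (simp add: algebra_simps)
  then show "((Z j k)\<^sup>2 + Z j k) / \<tau>\<^sup>2 \<le> 1 + 1 / \<delta>" using \<tau>_pos by (simp add: pos_divide_le_eq)
qed (use m1 n1 \<delta> mn nm in auto)

text \<open>The scale in which \<open>q\<close> becomes the form of \<open>Hx\<close> without its
  added square.\<close>

definition b :: real where "b = 1 / (\<tau> * sqrt N)"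

lemma b_pos: "0 < b" using \<tau>_pos N_pos by (simp add: b_def)

text \<open>Adding \<open>x (Inr n)\<close> to the s and subtracting it from the t moves a point
  along the null direction until its last coordinate vanishes. The sums of an s and a t are only
  multiplied by \<open>b\<close>.\<close>

definition gmap :: "(nat + nat \<Rightarrow> real) \<Rightarrow> point" where
  "gmap x = (\<lambda>j\<in>{1..m}. b * (x (Inl j) + x (Inr n)), \<lambda>k\<in>{1..n}. b * (x (Inr k) - x (Inr n)))"

lemma In_Ix [simp]: "Inl j \<in> Ix \<longleftrightarrow> j \<in> {1..m}" "Inr k \<in> Ix \<longleftrightarrow> k \<in> {1..n}"
  by (auto simp: Ix_def)

lemma measurable_gmap [measurable]: "gmap \<in> lebPi Ix \<rightarrow>\<^sub>M lebPair m n"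
proof -
  have c: "(\<lambda>x. x i) \<in> borel_measurable (lebPi Ix)" if "i \<in> Ix" for i using that by simp
  have 1: "(\<lambda>x. \<lambda>j\<in>{1..m}. b * (x (Inl j) + x (Inr n))) \<in> lebPi Ix \<rightarrow>\<^sub>M lebPi {1..m}"
    using n1 by (intro measurable_restrict) (auto intro!: borel_measurable_times borel_measurable_add c)
  have 2: "(\<lambda>x. \<lambda>k\<in>{1..n}. b * (x (Inr k) - x (Inr n))) \<in> lebPi Ix \<rightarrow>\<^sub>M lebPi {1..n}"
    using n1 by (intro measurable_restrict) (auto intro!: borel_measurable_times borel_measurable_diff c)
  show ?thesis unfolding gmap_def[abs_def] using 1 2 by measurable
qed

lemma measurable_gmap_P [measurable]: "gmap \<in> P \<rightarrow>\<^sub>M lebPair m n"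
  by (subst measurable_cong_sets[OF sets_P refl]) (rule measurable_gmap)

lemma gmap_sum:
  assumes "j \<in> {1..m}" "k \<in> {1..n}"
  shows "fst (gmap x) j + snd (gmap x) k = b * lin (vx (j, k)) x"
  using assms by (simp add: gmap_def lin_vx algebra_simps)

lemma Q_gmap: "Q x = q_form m n Z (gmap x)
    + \<delta>\<^sup>2 / (2 * N) * ((\<Sum>j=1..m. x (Inl j)) - (\<Sum>k=1..n. x (Inr k)))\<^sup>2"
proof -
  have bb: "b\<^sup>2 = 1 / (\<tau>\<^sup>2 * N)" using N_pos by (simp add: b_def power_divide power_mult_distrib)
  have "q_form m n Z (gmap x) = 1/2 * (\<Sum>j=1..m. \<Sum>k=1..n. ((Z j k)\<^sup>2 + Z j k) * (fst (gmap x) j + snd (gmap x) k)\<^sup>2)"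
    by (simp add: q_form_def case_prod_unfold)
  also have "(\<Sum>j=1..m. \<Sum>k=1..n. ((Z j k)\<^sup>2 + Z j k) * (fst (gmap x) j + snd (gmap x) k)\<^sup>2)
     = (\<Sum>j=1..m. \<Sum>k=1..n. ((Z j k)\<^sup>2 + Z j k) / \<tau>\<^sup>2 * (x (Inl j) + x (Inr k))\<^sup>2 / N)"
    by (intro sum.cong refl) (simp add: gmap_sum lin_vx power_mult_distrib bb)
  also have "1/2 * \<dots> = (\<Sum>j=1..m. \<Sum>k=1..n. ((Z j k)\<^sup>2 + Z j k) / \<tau>\<^sup>2 * (x (Inl j) + x (Inr k))\<^sup>2) / N / 2"
    by (simp add: sum_divide_distrib)
  finally show ?thesis unfolding Q_def Hx_form by (simp add: add_divide_distrib)
qed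

text \<open>The integrand of the hyperplane integral is invariant along the null direction \<open>(1, \<dots>, 1; -1, \<dots>, -1)\<close>
  of the quadratic form, so that direction can be integrated out against the additional Gaussian
  factor of the form \<open>Q\<close>.\<close>
lemma nn_integral_gmap:
  obtains C where "\<And>U. U \<in> borel_measurable (lebPair m n) \<Longrightarrow>
    (\<integral>\<^sup>+x. U (gmap x) * ennreal (exp (- Q x)) \<partial>lebPi Ix) =
    C * (\<integral>\<^sup>+p. U p * ennreal (exp (- q_form m n Z p)) \<partial>hyperplane_lebesgue m n)"
proof -
  define \<gamma> where "\<gamma> z = ennreal (exp (- (\<delta>\<^sup>2 / (2 * N) * z\<^sup>2)))" for z
  define B where "B = ennreal (b ^ card {1..m}) * ennreal (b ^ card {1..<n})"
  have B: "B \<noteq> 0" "B \<noteq> \<top>" using b_pos by (auto simp: B_def ennreal_mult_eq_top_iff)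
  have \<gamma> [measurable]: "\<gamma> \<in> borel_measurable borel" unfolding \<gamma>_def by measurable
  define \<Gamma> where "\<Gamma> = (\<integral>\<^sup>+w. \<gamma> ((real (card {1..m}) + real (card {1..<n}) + 1) * w) \<partial>lborel)"
  have main: "B * (\<integral>\<^sup>+x. U (gmap x) * ennreal (exp (- Q x)) \<partial>lebPi Ix) =
    \<Gamma> * (\<integral>\<^sup>+p. U p * ennreal (exp (- q_form m n Z p)) \<partial>hyperplane_lebesgue m n)"
    if [measurable]: "U \<in> borel_measurable (lebPair m n)" for U
  proof -
    define V where "V s t = U (s, t(n := 0)) * ennreal (exp (- q_form m n Z (s, t(n := 0))))" for s t
    have mV: "(\<lambda>(s, t). V s t) \<in> borel_measurable (lebPi {1..m} \<Otimes>\<^sub>M lebPi {1..<n})"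
    proof -
      have "(\<lambda>p. U p * ennreal (exp (- q_form m n Z p))) \<in> borel_measurable (lebPair m n)"
        by measurable
      from measurable_compose[OF measurable_extend_zero_pair[OF n1] this]
      show ?thesis by (simp add: V_def case_prod_unfold)
    qed
    have n_ins: "{1..n} = insert n {1..<n}" using n1 by auto
    define sh where "sh w s = (\<lambda>j\<in>{1..m}. b * w + b * s j)" for w and s :: "nat \<Rightarrow> real"
    define th where "th w t = (\<lambda>k\<in>{1..<n}. - b * w + b * t k)" for w and t :: "nat \<Rightarrow> real"
    define D where "D s t = (\<Sum>j=1..m. s j) - (\<Sum>k\<in>{1..<n}. t k)" for s t :: "nat \<Rightarrow> real"
    \<comment> \<open>Here w is the coordinate \<open>x (Inr n)\<close>, singled out because
      \<open>gmap\<close> shifts by it. The integrand splits into a function on the hyperplane and a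
      Gaussian in the difference of the coordinate sums.\<close>
    have pt: "U (gmap x) * ennreal (exp (- Q x)) = V (sh w s) (th w t) * \<gamma> (D s t - w)"
      if x: "x = (\<lambda>i\<in>{1..m} <+> {1..n}. case_sum s (t(n := w)) i)" for x s t w
    proof -
      have g: "gmap x = (sh w s, (th w t)(n := 0))"
        using n1 by (auto simp: gmap_def x sh_def th_def fun_eq_iff algebra_simps)
      have s1: "(\<Sum>j=1..m. x (Inl j)) = (\<Sum>j=1..m. s j)" by (intro sum.cong refl) (auto simp: x)
      have s2: "(\<Sum>k=1..n. x (Inr k)) = w + (\<Sum>k\<in>{1..<n}. t k)"
      proof -
        have "(\<Sum>k=1..n. x (Inr k)) = (\<Sum>k=1..n. (t(n := w)) k)" by (intro sum.cong refl) (auto simp: x)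
        then show ?thesis unfolding n_ins by simp
      qed
      have "exp (- Q x) = exp (- q_form m n Z (gmap x)) * exp (- (\<delta>\<^sup>2 / (2 * N) * (D s t - w)\<^sup>2))"
        unfolding Q_gmap s1 s2 exp_add[symmetric] D_def by (simp add: algebra_simps)
      then show ?thesis by (simp add: V_def g \<gamma>_def ennreal_mult mult.assoc)
    qed
    have mU: "(\<lambda>x. U (gmap x) * ennreal (exp (- Q x))) \<in> borel_measurable (lebPi Ix)" by measurable
    have "(\<integral>\<^sup>+x. U (gmap x) * ennreal (exp (- Q x)) \<partial>lebPi Ix) =
      (\<integral>\<^sup>+s. \<integral>\<^sup>+t. (\<lambda>x. U (gmap x) * ennreal (exp (- Q x))) (\<lambda>i\<in>{1..m} <+> {1..n}. case_sum s t i) \<partial>lebPi {1..n} \<partial>lebPi {1..m})"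
      using mU unfolding Ix_def by (intro nn_integral_lebPi_Plus) auto
    also have "\<dots> = (\<integral>\<^sup>+s. \<integral>\<^sup>+w. \<integral>\<^sup>+t. V (sh w s) (th w t) * \<gamma> (D s t - w) \<partial>lebPi {1..<n} \<partial>lborel \<partial>lebPi {1..m})"
    proof (rule nn_integral_cong)
      fix s assume s: "s \<in> space (lebPi {1..m})"
      let ?u = "\<lambda>t. (\<lambda>x. U (gmap x) * ennreal (exp (- Q x))) (\<lambda>i\<in>{1..m} <+> {1..n}. case_sum s t i)"
      have mm: "(\<lambda>t. \<lambda>i\<in>{1..m} <+> {1..n}. case_sum s t i) \<in> lebPi {1..n} \<rightarrow>\<^sub>M lebPi Ix"
        using measurable_compose[OF measurable_Pair1'[OF s] measurable_merge_sum] by (simp add: Ix_def)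
      have "?u \<in> borel_measurable (lebPi {1..n})"
        using measurable_compose[OF mm mU] by simp
      then have "(\<integral>\<^sup>+t. ?u t \<partial>lebPi {1..n}) = (\<integral>\<^sup>+w. \<integral>\<^sup>+t. ?u (t(n := w)) \<partial>lebPi {1..<n} \<partial>lborel)"
        unfolding n_ins by (intro lb.product_nn_integral_insert_rev) auto
      also have "\<dots> = (\<integral>\<^sup>+w. \<integral>\<^sup>+t. V (sh w s) (th w t) * \<gamma> (D s t - w) \<partial>lebPi {1..<n} \<partial>lborel)"
        by (intro nn_integral_cong pt refl)
      finally show "(\<integral>\<^sup>+t. ?u t \<partial>lebPi {1..n}) = (\<integral>\<^sup>+w. \<integral>\<^sup>+t. V (sh w s) (th w t) * \<gamma> (D s t - w) \<partial>lebPi {1..<n} \<partial>lborel)" .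
    qed
    finally have eq: "(\<integral>\<^sup>+x. U (gmap x) * ennreal (exp (- Q x)) \<partial>lebPi Ix) =
      (\<integral>\<^sup>+s. \<integral>\<^sup>+w. \<integral>\<^sup>+t. V (sh w s) (th w t) * \<gamma> (D s t - w) \<partial>lebPi {1..<n} \<partial>lborel \<partial>lebPi {1..m})" .
    have "B * (\<integral>\<^sup>+x. U (gmap x) * ennreal (exp (- Q x)) \<partial>lebPi Ix) = \<Gamma> * (\<integral>\<^sup>+s. \<integral>\<^sup>+t. V s t \<partial>lebPi {1..<n} \<partial>lebPi {1..m})"
      unfolding eq B_def \<Gamma>_def sh_def th_def D_def
      by (rule integrate_out_gauge_direction) (use b_pos mV \<gamma> in \<open>auto simp: \<gamma>_def\<close>)
    also have "(\<integral>\<^sup>+s. \<integral>\<^sup>+t. V s t \<partial>lebPi {1..<n} \<partial>lebPi {1..m}) = (\<integral>\<^sup>+p. U p * ennreal (exp (- q_form m n Z p)) \<partial>hyperplane_lebesgue m n)"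
      unfolding V_def by (rule nn_integral_hyperplane[OF n1, symmetric]) measurable
    finally show ?thesis .
  qed
  show ?thesis
  proof (rule that[of "\<Gamma> / B"])
    fix U :: "point \<Rightarrow> ennreal" assume U: "U \<in> borel_measurable (lebPair m n)"
    show "(\<integral>\<^sup>+x. U (gmap x) * ennreal (exp (- Q x)) \<partial>lebPi Ix) =
      \<Gamma> / B * (\<integral>\<^sup>+p. U p * ennreal (exp (- q_form m n Z p)) \<partial>hyperplane_lebesgue m n)"
      by (rule ennreal_cross_divide[OF main[OF U] B])
  qed
qed

text \<open>The constant of \<open>nn_integral_gmap\<close> is never evaluated. The choice U = 1
  relates it to \<open>Zc\<close>, which is positive and finite; hence so are the constant and the
  hyperplane integral, and the constant cancels between the normalised measures.\<close>

lemma Xi_pos: "0 < Xi m n Z"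
  and integrable_exp_q_form: "integrable (hyperplane_lebesgue m n) (\<lambda>p. exp (- q_form m n Z p))"
  and distr_gmap: "distr P (lebPair m n) gmap = gaussian_measure m n Z"
proof -
  let ?M = "lebPair m n" and ?h = "hyperplane_lebesgue m n"
  obtain C where C: "\<And>U. U \<in> borel_measurable ?M \<Longrightarrow>
    (\<integral>\<^sup>+x. U (gmap x) * ennreal (exp (- Q x)) \<partial>lebPi Ix) = C * (\<integral>\<^sup>+p. U p * ennreal (exp (- q_form m n Z p)) \<partial>?h)"
    by (rule nn_integral_gmap) blast
  define J where "J = (\<integral>\<^sup>+p. ennreal (exp (- q_form m n Z p)) \<partial>?h)"
  have "(\<integral>\<^sup>+x. ennreal (exp (- Q x)) \<partial>lebPi Ix) = ennreal Zc"
    unfolding Zc_def using integrable_exp_Q by (intro nn_integral_eq_integral) auto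
  then have CJ: "C * J = ennreal Zc" using C[of "\<lambda>_. 1"] by (simp add: J_def)
  have J0: "J \<noteq> 0" and C0': "C \<noteq> 0" using CJ Zc_pos by auto
  have Jt: "J \<noteq> \<top>" and Ct: "C \<noteq> \<top>" using CJ J0 C0' by (auto simp: ennreal_top_mult ennreal_mult_top)
  show int: "integrable ?h (\<lambda>p. exp (- q_form m n Z p))"
  proof (rule integrableI_nonneg)
    show "(\<integral>\<^sup>+p. ennreal (exp (- q_form m n Z p)) \<partial>?h) < \<infinity>" using Jt by (simp add: J_def top.not_eq_extremum)
    show "(\<lambda>p. exp (- q_form m n Z p)) \<in> borel_measurable ?h" by measurable
  qed (rule AE_I2, rule exp_ge_zero)
  have JX: "J = ennreal (Xi m n Z)"
    unfolding J_def Xi_def using int by (intro nn_integral_eq_integral) auto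
  then show Xpos: "0 < Xi m n Z" using J0 by (auto simp: ennreal_eq_0_iff not_le)
  have mul: "ennreal (1 / Zc) * C = ennreal (1 / Xi m n Z)"
  proof -
    have "ennreal (1 / Zc) * C * J = 1"
      using Zc_pos by (simp add: mult.assoc CJ ennreal_mult[symmetric])
    then have "ennreal (1 / Zc) * C * J * ennreal (1 / Xi m n Z) = ennreal (1 / Xi m n Z)" by simp
    moreover have "J * ennreal (1 / Xi m n Z) = 1" using Xpos by (simp add: JX ennreal_mult[symmetric])
    ultimately show ?thesis by (simp add: mult.assoc)
  qed
  show "distr P ?M gmap = gaussian_measure m n Z"
  proof (rule measure_eqI)
    show "sets (distr P ?M gmap) = sets (gaussian_measure m n Z)" by (simp add: gaussian_measure_def)
    fix S assume Sd: "S \<in> sets (distr P ?M gmap)"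
    then have S [measurable]: "S \<in> sets ?M" by simp
    have "emeasure (distr P ?M gmap) S = (\<integral>\<^sup>+p. indicator S p \<partial>distr P ?M gmap)"
      by (rule nn_integral_indicator[symmetric]) fact
    also have "\<dots> = (\<integral>\<^sup>+x. indicator S (gmap x) \<partial>P)"
      by (rule nn_integral_distr[OF measurable_gmap_P]) measurable
    also have "\<dots> = (\<integral>\<^sup>+x. ennreal (exp (- Q x) / Zc) * indicator S (gmap x) \<partial>lebPi Ix)"
      unfolding P_def by (rule nn_integral_density) measurable
    also have "\<dots> = (\<integral>\<^sup>+x. ennreal (1 / Zc) * (indicator S (gmap x) * ennreal (exp (- Q x))) \<partial>lebPi Ix)"
    proof (rule nn_integral_cong)
      fix x
      have "ennreal (exp (- Q x) / Zc) = ennreal (1 / Zc) * ennreal (exp (- Q x))"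
        using Zc_pos by (simp add: ennreal_mult[symmetric])
      then show "ennreal (exp (- Q x) / Zc) * indicator S (gmap x) = ennreal (1 / Zc) * (indicator S (gmap x) * ennreal (exp (- Q x)))"
        by (simp add: mult_ac)
    qed
    also have "\<dots> = ennreal (1 / Zc) * (C * (\<integral>\<^sup>+p. indicator S p * ennreal (exp (- q_form m n Z p)) \<partial>?h))"
    proof -
      have "(\<lambda>x. indicator S (gmap x) * ennreal (exp (- Q x))) \<in> borel_measurable (lebPi Ix)" by measurable
      from nn_integral_cmult[OF this] show ?thesis
        by (simp only: C[OF borel_measurable_indicator[OF S]])
    qed
    also have "\<dots> = ennreal (1 / Xi m n Z) * (\<integral>\<^sup>+p. indicator S p * ennreal (exp (- q_form m n Z p)) \<partial>?h)"
      by (simp add: mult.assoc[symmetric] mul)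
    also have "\<dots> = (\<integral>\<^sup>+p. ennreal (1 / Xi m n Z) * (indicator S p * ennreal (exp (- q_form m n Z p))) \<partial>?h)"
      by (rule nn_integral_cmult[symmetric]) measurable
    also have "\<dots> = (\<integral>\<^sup>+p. ennreal (exp (- q_form m n Z p) / Xi m n Z) * indicator S p \<partial>?h)"
    proof (rule nn_integral_cong)
      fix p
      have "ennreal (exp (- q_form m n Z p) / Xi m n Z) = ennreal (1 / Xi m n Z) * ennreal (exp (- q_form m n Z p))"
        using Xpos by (simp add: ennreal_mult[symmetric])
      then show "ennreal (1 / Xi m n Z) * (indicator S p * ennreal (exp (- q_form m n Z p))) = ennreal (exp (- q_form m n Z p) / Xi m n Z) * indicator S p"
        by (simp add: mult_ac)
    qed
    also have "\<dots> = emeasure (gaussian_measure m n Z) S"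
      unfolding gaussian_measure_def by (subst emeasure_density) (use S in \<open>simp_all del: One_nat_def\<close>)
    finally show "emeasure (distr P ?M gmap) S = emeasure (gaussian_measure m n Z) S" .
  qed
qed

lemma integral_gaussian_measure:
  fixes g :: "point \<Rightarrow> 'c :: {banach, second_countable_topology}"
  assumes "g \<in> borel_measurable (lebPair m n)"
  shows "(LINT p|gaussian_measure m n Z. g p) = (LINT x|P. g (gmap x))"
  unfolding distr_gmap[symmetric] by (rule integral_distr[OF measurable_gmap_P assms])

text \<open>Multiplying by exp(q) undoes the Gaussian density. The transfer is one of measures, so
  integrability of g need not be known beforehand.\<close>

lemma integral_hyperplane:
  fixes g :: "point \<Rightarrow> 'c :: {banach, second_countable_topology}"
  assumes [measurable]: "g \<in> borel_measurable (lebPair m n)"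
  shows "(LINT p|hyperplane_lebesgue m n. g p) = Xi m n Z *\<^sub>R (LINT x|P. exp (q_form m n Z (gmap x)) *\<^sub>R g (gmap x))"
proof -
  have "(LINT x|P. exp (q_form m n Z (gmap x)) *\<^sub>R g (gmap x)) = (LINT p|gaussian_measure m n Z. exp (q_form m n Z p) *\<^sub>R g p)"
    by (rule integral_gaussian_measure[symmetric]) measurable
  also have "\<dots> = (LINT p|hyperplane_lebesgue m n. (exp (- q_form m n Z p) / Xi m n Z) *\<^sub>R exp (q_form m n Z p) *\<^sub>R g p)"
    unfolding gaussian_measure_def using Xi_pos by (intro integral_density) auto
  also have "\<dots> = (LINT p|hyperplane_lebesgue m n. (1 / Xi m n Z) *\<^sub>R g p)"
    by (simp add: exp_minus)
  also have "\<dots> = (1 / Xi m n Z) *\<^sub>R (LINT p|hyperplane_lebesgue m n. g p)" by simp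
  finally show ?thesis using Xi_pos by simp
qed

end

section \<open>Expansion of the integrand\<close>

text \<open>The logarithm of the characteristic function of the geometric law on 0, 1, 2, ... with
  mean \<zeta>. On the real axis the principal branch is safe, as the argument of \<open>Ln\<close>
  has real part at least 1.\<close>

definition geom_cgf :: "real \<Rightarrow> complex \<Rightarrow> complex" where
  "geom_cgf \<zeta> z = - Ln (1 + of_real \<zeta> - of_real \<zeta> * exp (\<i> * z))"

text \<open>The coefficients are the first four cumulants of that law; summed over all entries they
  give the margins, \<open>q\<close>, \<open>f\<close> and \<open>h\<close>.\<close>

definition cgf_taylor :: "real \<Rightarrow> real \<Rightarrow> complex" where
  "cgf_taylor \<zeta> x = \<i> * of_real (\<zeta> * x) - of_real ((\<zeta>\<^sup>2 + \<zeta>) * x\<^sup>2 / 2)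
     - \<i> * of_real (\<zeta> * (\<zeta> + 1) * (2 * \<zeta> + 1) * x ^ 3 / 6)
     + of_real (\<zeta> * (\<zeta> + 1) * (6 * \<zeta>\<^sup>2 + 6 * \<zeta> + 1) * x ^ 4 / 24)"

lemma Re_geom_denominator_ge_1:
  assumes "0 \<le> \<zeta>"
  shows "1 \<le> Re (1 + of_real \<zeta> - of_real \<zeta> * exp (\<i> * of_real t))"
proof -
  have "\<zeta> * cos t \<le> \<zeta> * 1" using assms by (intro mult_left_mono) auto
  then show ?thesis by (simp add: Re_exp)
qed

lemma exp_geom_cgf:
  assumes "0 \<le> \<zeta>"
  shows "exp (geom_cgf \<zeta> (of_real x)) = inverse (1 + of_real \<zeta> - of_real \<zeta> * exp (\<i> * of_real x))"
proof -
  have "1 + of_real \<zeta> - of_real \<zeta> * exp (\<i> * of_real x) \<noteq> 0"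
    using Re_geom_denominator_ge_1[OF assms, of x] by (metis not_one_le_zero zero_complex.sel(1))
  then show ?thesis by (simp add: geom_cgf_def exp_minus)
qed

text \<open>Up to the factor i, the first derivative is w, which satisfies w' = i w (1 + w). So all
  higher derivatives are polynomials in w, and |w| \<le> \<zeta> on the real axis bounds the fifth
  one. The list in \<open>f\<close> holds the derivatives of orders 0 to 5.\<close>

lemma geom_cgf_taylor:
  assumes \<zeta>: "0 \<le> \<zeta>"
  shows "cmod (geom_cgf \<zeta> (of_real x) - cgf_taylor \<zeta> x)
    \<le> \<zeta> * (1 + \<zeta>) * (1 + 2 * \<zeta>) * (1 + 12 * \<zeta> + 12 * \<zeta>\<^sup>2) * \<bar>x\<bar> ^ 5 / 24"
proof -
  define D where "D z = 1 + of_real \<zeta> - of_real \<zeta> * exp (\<i> * z)" for z :: complex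
  define w where "w z = of_real \<zeta> * exp (\<i> * z) / D z" for z :: complex
  define f where "f = (\<lambda>i z. [geom_cgf \<zeta> z, \<i> * w z, - (w z * (1 + w z)), - (\<i> * (w z * (1 + w z) * (1 + 2 * w z))),
    w z * (1 + w z) * (1 + 6 * w z + 6 * (w z)\<^sup>2),
    \<i> * (w z * (1 + w z) * (1 + 2 * w z) * (1 + 12 * w z + 12 * (w z)\<^sup>2))] ! i)"
  define S where "S = closed_segment 0 (complex_of_real x)"
  have S: "\<exists>t. z = of_real t" if "z \<in> S" for z
    using that unfolding S_def closed_segment_def by (auto simp: scaleR_conv_of_real simp flip: of_real_mult)
  have D1: "1 \<le> Re (D z)" if "z \<in> S" for z
    using S[OF that] Re_geom_denominator_ge_1[OF \<zeta>] unfolding D_def by blast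
  have D0: "D z \<noteq> 0" "D z \<notin> \<real>\<^sub>\<le>\<^sub>0" if "z \<in> S" for z
    using D1[OF that] by (auto simp: complex_nonpos_Reals_iff)
  have dD: "(D has_field_derivative - (\<i> * of_real \<zeta> * exp (\<i> * z))) (at z within S)" for z
    unfolding D_def by (auto intro!: derivative_eq_intros)
  have dw: "(w has_field_derivative \<i> * (w z * (1 + w z))) (at z within S)" if z: "z \<in> S" for z
  proof -
    have "(w has_field_derivative (of_real \<zeta> * (exp (\<i> * z) * \<i>) * D z - of_real \<zeta> * exp (\<i> * z) * - (\<i> * of_real \<zeta> * exp (\<i> * z))) / (D z * D z)) (at z within S)"
      unfolding w_def by (intro DERIV_divide dD D0 z) (auto intro!: derivative_eq_intros)
    then show ?thesis
      using D0[OF z] by (rule_tac DERIV_cong) (auto simp: w_def field_simps)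
  qed
  have df: "(f i has_field_derivative f (Suc i) z) (at z within S)" if z: "z \<in> S" and i: "i \<le> 4" for i z
  proof -
    consider "i = 0" | "i = 1" | "i = 2" | "i = 3" | "i = 4" using i by linarith
    then show ?thesis
    proof cases
      case 1
      have "((\<lambda>z. - Ln (D z)) has_field_derivative - (inverse (D z) * - (\<i> * of_real \<zeta> * exp (\<i> * z)))) (at z within S)"
        by (intro DERIV_minus DERIV_chain2[OF has_field_derivative_Ln[OF D0(2)[OF z]] dD])
      then show ?thesis
        by (rule_tac DERIV_cong) (auto simp: 1 f_def geom_cgf_def[abs_def] D_def[abs_def] w_def divide_inverse mult_ac)
    next
      case 2
      show ?thesis unfolding 2 f_def by (auto intro!: derivative_eq_intros dw[OF z] simp: algebra_simps)
    next
      case 3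
      show ?thesis unfolding 3 f_def
        by (auto intro!: derivative_eq_intros dw[OF z] simp: numeral_3_eq_3 numeral_2_eq_2) (simp add: algebra_simps power2_eq_square)
    next
      case 4
      show ?thesis unfolding 4 f_def
        by (auto intro!: derivative_eq_intros dw[OF z] simp: eval_nat_numeral) (simp add: algebra_simps power2_eq_square)
    next
      case 5
      show ?thesis unfolding 5 f_def
        by (auto intro!: derivative_eq_intros dw[OF z] simp: eval_nat_numeral) (simp add: algebra_simps power2_eq_square)
    qed
  qed
  let ?B = "\<zeta> * (1 + \<zeta>) * (1 + 2 * \<zeta>) * (1 + 12 * \<zeta> + 12 * \<zeta>\<^sup>2)"
  have bd: "cmod (f (Suc 4) z) \<le> ?B" if z: "z \<in> S" for z
  proof -
    obtain t where t: "z = of_real t" using S[OF z] by blast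
    have "1 \<le> cmod (D z)" using D1[OF z] complex_Re_le_cmod[of "D z"] by linarith
    then have w: "cmod (w z) \<le> \<zeta>"
      using \<zeta> by (simp add: w_def norm_divide norm_mult t divide_le_eq mult_le_cancel_left1)
    have 1: "cmod (1 + w z) \<le> 1 + \<zeta>" using norm_triangle_ineq[of 1 "w z"] w by simp
    have 2: "cmod (1 + 2 * w z) \<le> 1 + 2 * \<zeta>" using norm_triangle_ineq[of 1 "2 * w z"] w by (simp add: norm_mult)
    have 3: "cmod (1 + 12 * w z + 12 * (w z)\<^sup>2) \<le> 1 + 12 * \<zeta> + 12 * \<zeta>\<^sup>2"
    proof -
      have "cmod (1 + 12 * w z + 12 * (w z)\<^sup>2) \<le> cmod 1 + cmod (12 * w z) + cmod (12 * (w z)\<^sup>2)"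
        by (intro norm_triangle_le add_mono order_refl norm_triangle_ineq)
      also have "\<dots> \<le> 1 + 12 * \<zeta> + 12 * \<zeta>\<^sup>2"
        using w power_mono[OF w, of 2] by (simp add: norm_mult norm_power)
      finally show ?thesis .
    qed
    have "f (Suc 4) z = \<i> * (w z * (1 + w z) * (1 + 2 * w z) * (1 + 12 * w z + 12 * (w z)\<^sup>2))"
      by (simp add: f_def eval_nat_numeral)
    then have "cmod (f (Suc 4) z) = cmod (w z) * cmod (1 + w z) * cmod (1 + 2 * w z) * cmod (1 + 12 * w z + 12 * (w z)\<^sup>2)"
      by (simp only: norm_mult) simp
    also have "\<dots> \<le> ?B"
      using \<zeta> by (intro mult_mono w 1 2 3) auto
    finally show ?thesis .
  qed
  have "cmod (f 0 (of_real x) - (\<Sum>i\<le>4. f i 0 * (of_real x - 0) ^ i / fact i)) \<le> ?B * cmod (of_real x - 0) ^ Suc 4 / fact 4"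
    by (rule complex_Taylor[where S = S]) (use df bd in \<open>auto simp: S_def\<close>)
  also have "f 0 (of_real x) = geom_cgf \<zeta> (of_real x)" by (simp add: f_def)
  also have "(\<Sum>i\<le>4. f i 0 * (of_real x - 0) ^ i / fact i) = cgf_taylor \<zeta> x"
  proof -
    have "w 0 = of_real \<zeta>" by (simp add: w_def D_def)
    then show ?thesis
      by (simp add: f_def geom_cgf_def cgf_taylor_def eval_nat_numeral field_simps power2_eq_square)
  qed
  also have "?B * cmod (of_real x - 0) ^ Suc 4 / fact 4 = ?B * \<bar>x\<bar> ^ 5 / 24"
    by (simp add: fact_numeral)
  finally show ?thesis .
qed

definition taylor_rem :: "nat \<Rightarrow> nat \<Rightarrow> (nat \<Rightarrow> nat \<Rightarrow> real) \<Rightarrow> point \<Rightarrow> complex" where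
  "taylor_rem m n Z = (\<lambda>(s, t). \<Sum>j=1..m. \<Sum>k=1..n. geom_cgf (Z j k) (of_real (s j + t k)) - cgf_taylor (Z j k) (s j + t k))"

text \<open>By the row and column sums of Z, the first-order terms of the cumulant expansions add up
  to the phase of the prefactor and cancel it.\<close>

lemma F_integrand_expansion:
  assumes Z0: "\<And>j k. j \<in> {1..m} \<Longrightarrow> k \<in> {1..n} \<Longrightarrow> 0 \<le> Z j k"
    and R: "\<And>j. j \<in> {1..m} \<Longrightarrow> (\<Sum>k=1..n. Z j k) = real (R j)"
    and C: "\<And>k. k \<in> {1..n} \<Longrightarrow> (\<Sum>j=1..m. Z j k) = real (C k)"
  shows "F_integrand m n R C Z p = exp (of_real (- q_form m n Z p + h_form m n Z p) - \<i> * of_real (f_form m n Z p) + taylor_rem m n Z p)"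
proof -
  obtain s t where p: "p = (s, t)" by (cases p)
  let ?x = "\<lambda>j k. s j + t k"
  have pr: "(\<Prod>j=1..m. \<Prod>k=1..n. inverse (1 + of_real (Z j k) - of_real (Z j k) * exp (\<i> * of_real (?x j k))))
     = exp (\<Sum>j=1..m. \<Sum>k=1..n. geom_cgf (Z j k) (of_real (?x j k)))"
    unfolding exp_sum[OF finite_atLeastAtMost]
    by (intro prod.cong refl exp_geom_cgf[symmetric] Z0)
  have lin: "(\<Sum>j=1..m. \<Sum>k=1..n. Z j k * ?x j k) = (\<Sum>j=1..m. real (R j) * s j) + (\<Sum>k=1..n. real (C k) * t k)"
  proof -
    have "(\<Sum>j=1..m. \<Sum>k=1..n. Z j k * ?x j k) = (\<Sum>j=1..m. \<Sum>k=1..n. Z j k * s j) + (\<Sum>j=1..m. \<Sum>k=1..n. Z j k * t k)"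
      by (simp only: distrib_left sum.distrib)
    also have "(\<Sum>j=1..m. \<Sum>k=1..n. Z j k * t k) = (\<Sum>k=1..n. \<Sum>j=1..m. Z j k * t k)" by (rule sum.swap)
    also have "(\<Sum>j=1..m. \<Sum>k=1..n. Z j k * s j) + (\<Sum>k=1..n. \<Sum>j=1..m. Z j k * t k)
        = (\<Sum>j=1..m. real (R j) * s j) + (\<Sum>k=1..n. real (C k) * t k)"
      by (intro arg_cong2[where f = "(+)"] sum.cong refl) (simp_all only: sum_distrib_right[symmetric] R C)
    finally show ?thesis .
  qed
  have ct: "(\<Sum>j=1..m. \<Sum>k=1..n. cgf_taylor (Z j k) (?x j k)) =
     \<i> * of_real (\<Sum>j=1..m. \<Sum>k=1..n. Z j k * ?x j k) + of_real (- q_form m n Z p + h_form m n Z p) - \<i> * of_real (f_form m n Z p)"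
    unfolding cgf_taylor_def p q_form_def f_form_def h_form_def
    by (simp add: sum.distrib sum_subtractf sum_distrib_left mult_ac)
  have "F_integrand m n R C Z p = exp (- \<i> * of_real (\<Sum>j=1..m. \<Sum>k=1..n. Z j k * ?x j k)) * exp (\<Sum>j=1..m. \<Sum>k=1..n. geom_cgf (Z j k) (of_real (?x j k)))"
  proof -
    have sp: "- \<i> * complex_of_real (a + b) = - \<i> * of_real a - \<i> * of_real b" for a b
      by (simp add: algebra_simps)
    show ?thesis unfolding p F_integrand_def prod.case pr lin sp by simp
  qed
  also have "\<dots> = exp (- \<i> * of_real (\<Sum>j=1..m. \<Sum>k=1..n. Z j k * ?x j k) + ((\<Sum>j=1..m. \<Sum>k=1..n. cgf_taylor (Z j k) (?x j k)) + taylor_rem m n Z p))"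
    unfolding exp_add[symmetric] by (simp add: taylor_rem_def p sum_subtractf)
  also have "\<dots> = exp (of_real (- q_form m n Z p + h_form m n Z p) - \<i> * of_real (f_form m n Z p) + taylor_rem m n Z p)"
    unfolding ct by (simp add: algebra_simps)
  finally show ?thesis .
qed

section \<open>The lower bound for the Gaussian integral\<close>

lemma nn_integral_gaussian:
  assumes c: "0 < c"
  shows "(\<integral>\<^sup>+x. ennreal (exp (- (c / 2 * (x - d)\<^sup>2))) \<partial>lborel) = ennreal (sqrt (2 * pi / c))"
proof -
  define \<sigma> where "\<sigma> = 1 / sqrt c"
  have \<sigma>: "0 < \<sigma>" "\<sigma>\<^sup>2 = 1 / c" using c by (auto simp: \<sigma>_def power_divide)
  have e: "exp (- (c / 2 * (x - d)\<^sup>2)) = sqrt (2 * pi / c) * normal_density d \<sigma> x" for x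
    using c by (simp add: normal_density_def \<sigma>(2))
  have "(\<integral>\<^sup>+x. ennreal (exp (- (c / 2 * (x - d)\<^sup>2))) \<partial>lborel) = ennreal (\<integral>x. sqrt (2 * pi / c) * normal_density d \<sigma> x \<partial>lborel)"
    unfolding e using \<sigma> c by (intro nn_integral_eq_integral) auto
  also have "\<dots> = ennreal (sqrt (2 * pi / c))" using \<sigma> by simp
  finally show ?thesis .
qed

lemma nn_integral_gaussian_linear:
  assumes c: "0 < c"
  shows "(\<integral>\<^sup>+x. ennreal (exp (- (c / 2 * x\<^sup>2) + d * x)) \<partial>lborel) = ennreal (exp (d\<^sup>2 / (2 * c)) * sqrt (2 * pi / c))"
proof -
  have "- (c / 2 * x\<^sup>2) + d * x = d\<^sup>2 / (2 * c) + - (c / 2 * (x - d / c)\<^sup>2)" for x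
    using c by (simp add: field_simps power2_eq_square)
  then have "(\<integral>\<^sup>+x. ennreal (exp (- (c / 2 * x\<^sup>2) + d * x)) \<partial>lborel) = (\<integral>\<^sup>+x. ennreal (exp (d\<^sup>2 / (2 * c))) * ennreal (exp (- (c / 2 * (x - d / c)\<^sup>2))) \<partial>lborel)"
    by (simp only: exp_add ennreal_mult[OF exp_ge_zero exp_ge_zero])
  also have "\<dots> = ennreal (exp (d\<^sup>2 / (2 * c))) * ennreal (sqrt (2 * pi / c))"
    by (subst nn_integral_cmult) (use nn_integral_gaussian[OF c] in simp_all)
  finally show ?thesis using c by (simp add: ennreal_mult)
qed

lemma nn_integral_lebPi_exp_sum:
  assumes A: "finite A" and c: "0 < c"
  shows "(\<integral>\<^sup>+x. ennreal (exp (\<Sum>i\<in>A. - (c / 2 * (x i)\<^sup>2) + d * x i)) \<partial>lebPi A)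
    = ennreal ((exp (d\<^sup>2 / (2 * c)) * sqrt (2 * pi / c)) ^ card A)"
proof -
  have "(\<integral>\<^sup>+x. ennreal (exp (\<Sum>i\<in>A. - (c / 2 * (x i)\<^sup>2) + d * x i)) \<partial>lebPi A)
    = (\<integral>\<^sup>+x. (\<Prod>i\<in>A. ennreal (exp (- (c / 2 * (x i)\<^sup>2) + d * x i))) \<partial>lebPi A)"
    by (simp add: exp_sum[OF A] prod_ennreal)
  also have "\<dots> = (\<Prod>i\<in>A. \<integral>\<^sup>+y. ennreal (exp (- (c / 2 * y\<^sup>2) + d * y)) \<partial>lborel)"
    by (rule lb.product_nn_integral_prod[OF A]) simp
  also have "\<dots> = ennreal ((exp (d\<^sup>2 / (2 * c)) * sqrt (2 * pi / c)) ^ card A)"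
    unfolding nn_integral_gaussian_linear[OF c] prod_constant using c by (simp add: ennreal_power)
  finally show ?thesis .
qed

text \<open>The rank one term is linearised by an auxiliary Gaussian variable.\<close>
lemma nn_integral_centred_gaussian:
  assumes A: "finite A" and B: "0 < B"
  shows "(\<integral>\<^sup>+t. ennreal (exp (- (B / 2) * ((\<Sum>i\<in>A. (t i)\<^sup>2) - (\<Sum>i\<in>A. t i)\<^sup>2 / (real (card A) + 1)))) \<partial>lebPi A)
    = ennreal (sqrt (real (card A) + 1) * sqrt (2 * pi / B) ^ card A)"
proof -
  define p where "p = real (card A) + 1"
  have p: "0 < p" by (simp add: p_def add_nonneg_pos)
  define T where "T t = (\<Sum>i\<in>A. t i)" for t :: "'a \<Rightarrow> real"
  \<comment> \<open>The total mass of the auxiliary Gaussian variable x, whose precision is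
    \<open>B * p\<close>. Its linear term \<open>B * T t * x\<close> produces the square of T and
    decouples the coordinates of t.\<close>
  let ?s = "sqrt (2 * pi / (B * p))"
  have s0: "0 < ?s" using B p by simp
  have mT: "(\<lambda>q. T (snd q)) \<in> borel_measurable (lborel \<Otimes>\<^sub>M lebPi A)"
  proof -
    have "(\<lambda>q. snd q i) \<in> lborel \<Otimes>\<^sub>M lebPi A \<rightarrow>\<^sub>M lborel" if "i \<in> A" for i
      by (rule measurable_compose[OF measurable_snd measurable_component_singleton[OF that]])
    then show ?thesis unfolding T_def by simp
  qed
  have mV: "(\<lambda>q. \<Sum>i\<in>A. (snd q i)\<^sup>2) \<in> borel_measurable (lborel \<Otimes>\<^sub>M lebPi A)"
  proof -
    have "(\<lambda>q. snd q i) \<in> lborel \<Otimes>\<^sub>M lebPi A \<rightarrow>\<^sub>M lborel" if "i \<in> A" for i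
      by (rule measurable_compose[OF measurable_snd measurable_component_singleton[OF that]])
    then show ?thesis by simp
  qed
  define g where "g x t = exp (- (B * p / 2 * x\<^sup>2) + (B * T t) * x) * exp (- (B / 2 * (\<Sum>i\<in>A. (t i)\<^sup>2)))" for x t
  have mg: "(\<lambda>q. ennreal (g (fst q) (snd q))) \<in> borel_measurable (lborel \<Otimes>\<^sub>M lebPi A)"
  proof -
    note [measurable] = mT mV
    show ?thesis unfolding g_def by measurable
  qed
  have lhs: "ennreal ?s * ennreal (exp (- (B / 2) * ((\<Sum>i\<in>A. (t i)\<^sup>2) - (\<Sum>i\<in>A. t i)\<^sup>2 / (real (card A) + 1)))) = (\<integral>\<^sup>+x. ennreal (g x t) \<partial>lborel)" for t
  proof -
    have "(\<integral>\<^sup>+x. ennreal (g x t) \<partial>lborel) = (\<integral>\<^sup>+x. ennreal (exp (- (B * p / 2 * x\<^sup>2) + (B * T t) * x)) * ennreal (exp (- (B / 2 * (\<Sum>i\<in>A. (t i)\<^sup>2)))) \<partial>lborel)"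
      by (simp add: g_def ennreal_mult)
    also have "\<dots> = ennreal (exp ((B * T t)\<^sup>2 / (2 * (B * p))) * ?s) * ennreal (exp (- (B / 2 * (\<Sum>i\<in>A. (t i)\<^sup>2))))"
      using nn_integral_gaussian_linear[of "B * p" "B * T t"] B p by (subst nn_integral_multc) auto
    also have "\<dots> = ennreal (?s * exp ((B * T t)\<^sup>2 / (2 * (B * p)) - (B / 2 * (\<Sum>i\<in>A. (t i)\<^sup>2))))"
    proof -
      have "ennreal (u * r) * ennreal w = ennreal (r * (u * w))" if "0 \<le> u" "0 \<le> r" "0 \<le> w" for u r w :: real
        using that by (simp add: ennreal_mult mult_ac)
      from this[OF exp_ge_zero less_imp_le[OF s0] exp_ge_zero] show ?thesis
        by (simp only: diff_conv_add_uminus exp_add)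
    qed
    also have "(B * T t)\<^sup>2 / (2 * (B * p)) - (B / 2 * (\<Sum>i\<in>A. (t i)\<^sup>2)) = - (B / 2) * ((\<Sum>i\<in>A. (t i)\<^sup>2) - (\<Sum>i\<in>A. t i)\<^sup>2 / p)"
      using B p by (simp add: T_def[symmetric] power_mult_distrib field_simps power2_eq_square)
    finally show ?thesis using s0 by (simp add: ennreal_mult p_def)
  qed
  have "ennreal ?s * (\<integral>\<^sup>+t. ennreal (exp (- (B / 2) * ((\<Sum>i\<in>A. (t i)\<^sup>2) - (\<Sum>i\<in>A. t i)\<^sup>2 / (real (card A) + 1)))) \<partial>lebPi A)
      = (\<integral>\<^sup>+t. \<integral>\<^sup>+x. ennreal (g x t) \<partial>lborel \<partial>lebPi A)"
  proof -
    have "(\<lambda>t. ennreal (exp (- (B / 2) * ((\<Sum>i\<in>A. (t i)\<^sup>2) - (\<Sum>i\<in>A. t i)\<^sup>2 / (real (card A) + 1))))) \<in> borel_measurable (lebPi A)"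
      by measurable
    from nn_integral_cmult[OF this, symmetric] show ?thesis by (simp only: lhs)
  qed
  also have "\<dots> = (\<integral>\<^sup>+x. \<integral>\<^sup>+t. ennreal (g x t) \<partial>lebPi A \<partial>lborel)"
    by (rule nn_integral_lebPi_lborel_swap[OF A]) (use mg in \<open>simp add: case_prod_unfold\<close>)
  also have "\<dots> = (\<integral>\<^sup>+x. ennreal (sqrt (2 * pi / B) ^ card A) * ennreal (exp (- (B / 2 * (x - 0)\<^sup>2))) \<partial>lborel)"
  proof (rule nn_integral_cong)
    fix x :: real
    have ge: "g x t = exp (- (B * p / 2 * x\<^sup>2)) * exp (\<Sum>i\<in>A. - (B / 2 * (t i)\<^sup>2) + (B * x) * t i)" for t
    proof -
      have e: "(\<Sum>i\<in>A. - (B / 2 * (t i)\<^sup>2) + (B * x) * t i) = - (B / 2 * (\<Sum>i\<in>A. (t i)\<^sup>2)) + (B * T t) * x"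
        unfolding sum.distrib sum_negf T_def sum_distrib_left[symmetric] by simp
      show ?thesis unfolding g_def e exp_add by (simp only: mult_ac)
    qed
    have "(\<integral>\<^sup>+t. ennreal (g x t) \<partial>lebPi A) = (\<integral>\<^sup>+t. ennreal (exp (- (B * p / 2 * x\<^sup>2))) * ennreal (exp (\<Sum>i\<in>A. - (B / 2 * (t i)\<^sup>2) + (B * x) * t i)) \<partial>lebPi A)"
      unfolding ge by (simp add: ennreal_mult)
    also have "\<dots> = ennreal (exp (- (B * p / 2 * x\<^sup>2))) * ennreal ((exp ((B * x)\<^sup>2 / (2 * B)) * sqrt (2 * pi / B)) ^ card A)"
      using nn_integral_lebPi_exp_sum[OF A B, of "B * x"] by (subst nn_integral_cmult) simp_all
    also have "\<dots> = ennreal (exp (- (B * p / 2 * x\<^sup>2)) * exp (real (card A) * ((B * x)\<^sup>2 / (2 * B))) * sqrt (2 * pi / B) ^ card A)"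
    proof -
      have "ennreal u * ennreal (w * r) = ennreal (u * w * r)" if "0 \<le> u" "0 \<le> r" "0 \<le> w" for u r w :: real
        using that by (simp add: ennreal_mult mult_ac)
      moreover have "0 \<le> sqrt (2 * pi / B) ^ card A" using B by simp
      ultimately show ?thesis
        unfolding power_mult_distrib exp_of_nat_mult[symmetric] by simp
    qed
    \<comment> \<open>Each of the \<open>card A\<close> coordinates returns B x^2 / 2; since p
      exceeds \<open>card A\<close> by one, exactly a Gaussian of precision B is left over.\<close>
    also have "exp (- (B * p / 2 * x\<^sup>2)) * exp (real (card A) * ((B * x)\<^sup>2 / (2 * B))) = exp (- (B / 2 * (x - 0)\<^sup>2))"
      unfolding exp_add[symmetric] using B by (simp add: p_def field_simps power2_eq_square)
    finally show "(\<integral>\<^sup>+t. ennreal (g x t) \<partial>lebPi A) = ennreal (sqrt (2 * pi / B) ^ card A) * ennreal (exp (- (B / 2 * (x - 0)\<^sup>2)))"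
      using B by (simp add: ennreal_mult mult.commute)
  qed
  also have "\<dots> = ennreal (sqrt (2 * pi / B) ^ card A) * ennreal (sqrt (2 * pi / B))"
    by (subst nn_integral_cmult) (use nn_integral_gaussian[OF B, of 0] in simp_all)
  also have "\<dots> = ennreal ?s * ennreal (sqrt p * sqrt (2 * pi / B) ^ card A)"
  proof -
    have "sqrt (2 * pi / B) = ?s * sqrt p"
      using B p by (simp add: real_sqrt_mult[symmetric])
    then show ?thesis using B p by (simp add: ennreal_mult[symmetric] mult_ac)
  qed
  finally show ?thesis
    using s0 B by (simp add: ennreal_mult_cancel_left p_def)
qed

text \<open>For fixed t the form separates over the s_j, each with a linear term given by the sum of
  t. Integrating s out leaves the centred form of \<open>nn_integral_centred_gaussian\<close>; its
  divisor \<open>card A + 1\<close> is n because the vanishing coordinate t_n counts in the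
  mean.\<close>

lemma nn_integral_hyperplane_constant_gaussian:
  assumes n: "1 \<le> n" and m: "1 \<le> m" and a: "0 < a"
  shows "(\<integral>\<^sup>+p. ennreal (exp (- (a / 2 * (\<Sum>j=1..m. \<Sum>k=1..n. (fst p j + snd p k)\<^sup>2)))) \<partial>hyperplane_lebesgue m n)
    = ennreal (sqrt (2 * pi / (a * real n)) ^ m * (sqrt (real n) * sqrt (2 * pi / (a * real m)) ^ (n - 1)))"
proof -
  interpret SA: sigma_finite_measure "lebPi {1..m}" by (rule sigma_finite_lebPi) simp
  interpret SB: sigma_finite_measure "lebPi {1..<n}" by (rule sigma_finite_lebPi) simp
  interpret pair_sigma_finite "lebPi {1..m}" "lebPi {1..<n}" by unfold_locales
  let ?u = "\<lambda>p::point. ennreal (exp (- (a / 2 * (\<Sum>j=1..m. \<Sum>k=1..n. (fst p j + snd p k)\<^sup>2))))"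
  have mu: "?u \<in> borel_measurable (lebPair m n)"
  proof -
    have "(\<lambda>p. \<Sum>j=1..m. \<Sum>k=1..n. (fst p j + snd p k)\<^sup>2) \<in> borel_measurable (lebPair m n)"
      by (intro borel_measurable_sum borel_measurable_power measurable_pair_coordinates)
    then show ?thesis by simp
  qed
  have inner: "(\<integral>\<^sup>+s. ?u (s, t(n := 0)) \<partial>lebPi {1..m}) = ennreal (sqrt (2 * pi / (a * real n)) ^ m) *
      ennreal (exp (- ((a * real m) / 2) * ((\<Sum>k\<in>{1..<n}. (t k)\<^sup>2) - (\<Sum>k\<in>{1..<n}. t k)\<^sup>2 / (real (card {1..<n}) + 1))))" for t
  proof -
    define T where "T = (\<Sum>k\<in>{1..<n}. t k)"
    define V where "V = (\<Sum>k\<in>{1..<n}. (t k)\<^sup>2)"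
    have n_ins: "{1..n} = insert n {1..<n}" using n by auto
    have row: "(\<Sum>k=1..n. (x + (t(n := 0)) k)\<^sup>2) = real n * x\<^sup>2 + 2 * T * x + V" for x
    proof -
      have "(\<Sum>k=1..n. (x + (t(n := 0)) k)\<^sup>2) = x\<^sup>2 + (\<Sum>k\<in>{1..<n}. (x + t k)\<^sup>2)"
      proof -
        have "(\<Sum>k\<in>{1..<n}. (x + (t(n := 0)) k)\<^sup>2) = (\<Sum>k\<in>{1..<n}. (x + t k)\<^sup>2)"
          by (intro sum.cong refl) auto
        then show ?thesis unfolding n_ins by simp
      qed
      also have "(\<Sum>k\<in>{1..<n}. (x + t k)\<^sup>2) = (\<Sum>k\<in>{1..<n}. x\<^sup>2 + t k * (2 * x) + (t k)\<^sup>2)"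
        by (simp add: power2_sum mult_ac add_ac)
      also have "\<dots> = real (n - 1) * x\<^sup>2 + T * (2 * x) + V"
        by (simp add: sum.distrib T_def V_def sum_distrib_right)
      finally show ?thesis using n by (simp add: of_nat_diff algebra_simps)
    qed
    have "?u (s, t(n := 0)) = ennreal (exp (- (a / 2 * real m * V))) *
        ennreal (exp (\<Sum>j=1..m. - ((a * real n) / 2 * (s j)\<^sup>2) + (- a * T) * s j))" for s
    proof -
      have e: "- (a / 2 * (\<Sum>j=1..m. real n * (s j)\<^sup>2 + 2 * T * s j + V)) =
        - (a / 2 * real m * V) + (\<Sum>j=1..m. - ((a * real n) / 2 * (s j)\<^sup>2) + (- a * T) * s j)"
        by (simp add: sum.distrib sum_distrib_left sum_negf sum_subtractf algebra_simps)
      show ?thesis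
        unfolding fst_conv snd_conv row e exp_add by (rule ennreal_mult) simp_all
    qed
    then have "(\<integral>\<^sup>+s. ?u (s, t(n := 0)) \<partial>lebPi {1..m}) = (\<integral>\<^sup>+s. ennreal (exp (- (a / 2 * real m * V))) *
        ennreal (exp (\<Sum>j=1..m. - ((a * real n) / 2 * (s j)\<^sup>2) + (- a * T) * s j)) \<partial>lebPi {1..m})" by (simp only:)
    also have "\<dots> = ennreal (exp (- (a / 2 * real m * V))) * ennreal ((exp ((- a * T)\<^sup>2 / (2 * (a * real n))) * sqrt (2 * pi / (a * real n))) ^ m)"
      using nn_integral_lebPi_exp_sum[of "{1..m}" "a * real n" "- a * T"] a n by (subst nn_integral_cmult) simp_all
    also have "\<dots> = ennreal (sqrt (2 * pi / (a * real n)) ^ m * (exp (- (a / 2 * real m * V)) * exp (real m * ((- a * T)\<^sup>2 / (2 * (a * real n))))))"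
    proof -
      have "ennreal u * ennreal (w * r) = ennreal (r * (u * w))" if "0 \<le> u" "0 \<le> r" "0 \<le> w" for u r w :: real
        using that by (simp add: ennreal_mult mult_ac)
      moreover have "0 \<le> sqrt (2 * pi / (a * real n)) ^ m" using a by simp
      ultimately show ?thesis
        unfolding power_mult_distrib exp_of_nat_mult[symmetric] by simp
    qed
    also have "exp (- (a / 2 * real m * V)) * exp (real m * ((- a * T)\<^sup>2 / (2 * (a * real n)))) =
        exp (- ((a * real m) / 2) * (V - T\<^sup>2 / (real (card {1..<n}) + 1)))"
      unfolding exp_add[symmetric] using a n by (simp add: of_nat_diff field_simps power2_eq_square)
    finally show ?thesis using a by (simp add: ennreal_mult T_def V_def)
  qed
  have "(\<integral>\<^sup>+p. ?u p \<partial>hyperplane_lebesgue m n) = (\<integral>\<^sup>+s. \<integral>\<^sup>+t. ?u (s, t(n := 0)) \<partial>lebPi {1..<n} \<partial>lebPi {1..m})"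
    by (rule nn_integral_hyperplane[OF n mu])
  also have "\<dots> = (\<integral>\<^sup>+t. \<integral>\<^sup>+s. ?u (s, t(n := 0)) \<partial>lebPi {1..m} \<partial>lebPi {1..<n})"
    using Fubini'[of "\<lambda>s t. ?u (s, t(n := 0))"] measurable_compose[OF measurable_extend_zero_pair[OF n] mu]
    by (simp add: case_prod_unfold)
  also have "\<dots> = ennreal (sqrt (2 * pi / (a * real n)) ^ m) * (\<integral>\<^sup>+t. ennreal (exp (- ((a * real m) / 2) * ((\<Sum>k\<in>{1..<n}. (t k)\<^sup>2) - (\<Sum>k\<in>{1..<n}. t k)\<^sup>2 / (real (card {1..<n}) + 1)))) \<partial>lebPi {1..<n})"
    unfolding inner by (rule nn_integral_cmult) measurable
  also have "\<dots> = ennreal (sqrt (2 * pi / (a * real n)) ^ m) * ennreal (sqrt (real (card {1..<n}) + 1) * sqrt (2 * pi / (a * real m)) ^ card {1..<n})"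
    using a m by (subst nn_integral_centred_gaussian) auto
  finally show ?thesis
    using a n by (simp add: ennreal_mult[symmetric] of_nat_diff)
qed

lemma (in margins) Xi_lower_bound:
  "(2 * pi) powr ((real m + real n - 1) / 2) /
     (real m powr ((real n - 1) / 2) * real n powr ((real m - 1) / 2) * (\<tau> + \<tau>\<^sup>2) powr ((real m + real n - 1) / 2)) \<le> Xi m n Z"
proof -
  define a where "a = \<tau> + \<tau>\<^sup>2"
  have a: "0 < a" using \<tau>_pos by (simp add: a_def add_pos_pos)
  have q: "q_form m n Z p \<le> a / 2 * (\<Sum>j=1..m. \<Sum>k=1..n. (fst p j + snd p k)\<^sup>2)" for p
  proof -
    have "(\<Sum>j=1..m. \<Sum>k=1..n. ((Z j k)\<^sup>2 + Z j k) * (fst p j + snd p k)\<^sup>2) \<le> (\<Sum>j=1..m. \<Sum>k=1..n. a * (fst p j + snd p k)\<^sup>2)"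
    proof (intro sum_mono mult_right_mono)
      fix j k assume jk: "j \<in> {1..m}" "k \<in> {1..n}"
      show "(Z j k)\<^sup>2 + Z j k \<le> a"
        using Z_le[OF jk] power_mono[OF Z_le[OF jk] less_imp_le[OF Z_pos[OF jk]], of 2] by (simp add: a_def)
    qed auto
    then have le: "(\<Sum>j=1..m. \<Sum>k=1..n. ((Z j k)\<^sup>2 + Z j k) * (fst p j + snd p k)\<^sup>2) \<le> a * (\<Sum>j=1..m. \<Sum>k=1..n. (fst p j + snd p k)\<^sup>2)"
      by (simp only: sum_distrib_left)
    have "q_form m n Z p = 1/2 * (\<Sum>j=1..m. \<Sum>k=1..n. ((Z j k)\<^sup>2 + Z j k) * (fst p j + snd p k)\<^sup>2)"
      by (simp only: q_form_def case_prod_unfold)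
    also have "\<dots> \<le> 1/2 * (a * (\<Sum>j=1..m. \<Sum>k=1..n. (fst p j + snd p k)\<^sup>2))"
      using le by (rule mult_left_mono) simp
    finally show ?thesis by (simp only: mult.assoc[symmetric] times_divide_eq_left mult_1)
  qed
  define L where "L = sqrt (2 * pi / (a * real n)) ^ m * (sqrt (real n) * sqrt (2 * pi / (a * real m)) ^ (n - 1))"
  have "ennreal L = (\<integral>\<^sup>+p. ennreal (exp (- (a / 2 * (\<Sum>j=1..m. \<Sum>k=1..n. (fst p j + snd p k)\<^sup>2)))) \<partial>hyperplane_lebesgue m n)"
    unfolding L_def by (rule nn_integral_hyperplane_constant_gaussian[OF n1 m1 a, symmetric])
  also have "\<dots> \<le> (\<integral>\<^sup>+p. ennreal (exp (- q_form m n Z p)) \<partial>hyperplane_lebesgue m n)"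
    using q by (intro nn_integral_mono ennreal_leI) simp
  also have "\<dots> = ennreal (Xi m n Z)"
    unfolding Xi_def using integrable_exp_q_form by (intro nn_integral_eq_integral) auto
  finally have "L \<le> Xi m n Z" using Xi_pos by simp
  moreover have "L = (2 * pi) powr ((real m + real n - 1) / 2) /
     (real m powr ((real n - 1) / 2) * real n powr ((real m - 1) / 2) * a powr ((real m + real n - 1) / 2))"
  proof -
    have sp: "sqrt x ^ k = x powr (real k / 2)" if "0 < x" for x k
      using that by (simp add: powr_half_sqrt[symmetric] powr_powr flip: powr_realpow)
    have pos: "0 < real m" "0 < real n" using m1 n1 by auto
    have "L = (2 * pi / (a * real n)) powr (real m / 2) * (real n powr (1 / 2) * (2 * pi / (a * real m)) powr ((real n - 1) / 2))"
      unfolding L_def using a pos n1 by (simp add: sp powr_half_sqrt of_nat_diff)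
    also have "\<dots> = (2 * pi) powr (real m / 2) * (2 * pi) powr ((real n - 1) / 2) * real n powr (1 / 2) /
       (a powr (real m / 2) * a powr ((real n - 1) / 2) * real n powr (real m / 2) * real m powr ((real n - 1) / 2))"
      using a pos by (simp add: powr_divide powr_mult mult_ac)
    also have "\<dots> = (2 * pi) powr ((real m + real n - 1) / 2) * real n powr (1 / 2) /
       (a powr ((real m + real n - 1) / 2) * real n powr (real m / 2) * real m powr ((real n - 1) / 2))"
      by (simp add: powr_add[symmetric] add_divide_distrib[symmetric] add_diff_eq)
    also have "real n powr (real m / 2) = real n powr (1 / 2) * real n powr ((real m - 1) / 2)"
      by (simp add: powr_add[symmetric] add_divide_distrib[symmetric])
    finally show ?thesis using pos by (simp add: mult_ac)
  qed
  ultimately show ?thesis by (simp add: a_def)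
qed

section \<open>Moment estimates for the forms\<close>

text \<open>Along the segment from 0 to u the real part lies between 0 and \<open>Re u\<close>, so
  the derivative is bounded by the larger, hence by the sum, of the end values.\<close>

lemma norm_exp_minus_one_le: "cmod (exp u - 1) \<le> cmod u * (1 + exp (Re u))"
proof -
  let ?S = "closed_segment 0 u"
  have "cmod ((\<lambda>i::nat. exp) 0 u - (\<Sum>i\<le>0. (\<lambda>i::nat. exp) i 0 * (u - 0) ^ i / fact i))
     \<le> (1 + exp (Re u)) * cmod (u - 0) ^ Suc 0 / fact 0"
  proof (rule complex_Taylor[where S = ?S])
    fix x assume "x \<in> ?S"
    then obtain t where t: "x = t *\<^sub>R u" "0 \<le> t" "t \<le> 1" by (auto simp: closed_segment_def)
    have "t * Re u \<le> max 0 (Re u)"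
      using t mult_left_le_one_le[of "Re u" t] by (cases "0 \<le> Re u") (auto simp: mult_nonneg_nonpos)
    then have "exp (Re x) \<le> exp (max 0 (Re u))" by (simp add: t)
    also have "\<dots> \<le> 1 + exp (Re u)" by (auto simp: max_def)
    finally show "cmod (exp x) \<le> 1 + exp (Re u)" by simp
  qed (auto intro!: derivative_eq_intros)
  then show ?thesis by (simp add: mult.commute)
qed

lemma norm_exp_diff_le: "cmod (exp z - exp (of_real w)) \<le> cmod (z - of_real w) * (exp w + exp (Re z))"
proof -
  have "exp z - exp (of_real w) = exp (of_real w) * (exp (z - of_real w) - 1)"
    by (simp add: right_diff_distrib exp_add[symmetric])
  then have "cmod (exp z - exp (of_real w)) = exp w * cmod (exp (z - of_real w) - 1)"
    by (simp add: norm_mult)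
  also have "\<dots> \<le> exp w * (cmod (z - of_real w) * (1 + exp (Re (z - of_real w))))"
    by (intro mult_left_mono norm_exp_minus_one_le) auto
  also have "\<dots> = cmod (z - of_real w) * (exp w + exp w * exp (Re z - w))"
    by (simp add: algebra_simps)
  also have "exp w * exp (Re z - w) = exp (Re z)" by (simp add: exp_add[symmetric])
  finally show ?thesis .
qed

lemma power4_le_cosh: "x ^ 4 \<le> 512 * cosh (x :: real)"
proof -
  have "\<bar>x\<bar> / 4 \<le> exp (\<bar>x\<bar> / 4)" using exp_ge_add_one_self[of "\<bar>x\<bar> / 4"] by linarith
  then have "(\<bar>x\<bar> / 4) ^ 4 \<le> exp (\<bar>x\<bar> / 4) ^ 4" by (intro power_mono) auto
  also have "\<dots> = exp \<bar>x\<bar>" by (simp add: exp_of_nat_mult[symmetric])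
  finally have "x ^ 4 \<le> 256 * exp \<bar>x\<bar>" by (simp add: power_divide)
  also have "\<dots> \<le> 256 * (2 * cosh x)"
    by (intro mult_left_mono) (auto simp: cosh_def abs_if)
  finally show ?thesis by simp
qed

lemma ln_le_root:
  assumes "1 \<le> x" and "0 < (k::real)"
  shows "ln x \<le> k * x powr (1 / k)"
proof -
  have "ln (x powr (1 / k)) \<le> x powr (1 / k)" using ln_bound[of "x powr (1/k)"] assms by simp
  then show ?thesis using assms by (simp add: ln_powr field_simps)
qed

text \<open>If either summand exceeds L in modulus, the truncated maximum is L and the hypothesis
  applies; otherwise truncation changes nothing.\<close>

lemma sum_fourth_power_le:
  assumes "\<bar>u + w\<bar> \<le> 2 * (L::real)" "0 \<le> L"
  shows "(u + w) ^ 4 \<le> 16 * ((min L \<bar>u\<bar>) ^ 4 + (min L \<bar>w\<bar>) ^ 4)"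
proof -
  define M where "M = max (min L \<bar>u\<bar>) (min L \<bar>w\<bar>)"
  have M: "\<bar>u + w\<bar> \<le> 2 * M" using assms by (auto simp: M_def max_def min_def)
  have "(u + w) ^ 4 = \<bar>u + w\<bar> ^ 4" by simp
  also have "\<dots> \<le> (2 * M) ^ 4" using M by (intro power_mono) auto
  also have "\<dots> = 16 * M ^ 4" by (simp add: power_mult_distrib)
  also have "M ^ 4 \<le> (min L \<bar>u\<bar>) ^ 4 + (min L \<bar>w\<bar>) ^ 4"
    using assms(2) by (auto simp: M_def max_def)
  finally show ?thesis by simp
qed

lemma power_ratio:
  fixes x :: real
  assumes "0 < x"
  shows "1 / x ^ 6 * (x\<^sup>2 * x ^ 3) = 1 / x" "1 / x ^ 4 * (x\<^sup>2 * x) = 1 / x" "1 / x ^ 3 * (x\<^sup>2 * x) = 1"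
  using assms by (simp_all add: eval_nat_numeral)

text \<open>Otherwise the simplifier rewrites the index ranges \<open>{1..m}\<close> and \<open>{1..n}\<close> inside locale parameters,
  and facts about the interpreted locales no longer match.\<close>
declare One_nat_def [simp del]

context margins
begin

definition e :: real where "e = 1 / \<delta>"

lemma e_ge_1: "1 \<le> e" using \<delta> by (simp add: e_def)

lemma e_pos: "0 < e" using e_ge_1 by simp

lemma N_ge_2: "2 \<le> N" using m1 n1 by (simp add: of_nat_mono flip: of_nat_add)

definition r :: real where "r = 1 / sqrt N"

lemma r_pos: "0 < r" and r_sq: "r\<^sup>2 = 1 / N" and b_eq: "b = r / \<tau>"
  using N_pos \<tau>_pos by (auto simp: r_def b_def power_divide)

lemma card_A_le: "real (card ({1..m} \<times> {1..n})) \<le> N\<^sup>2"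
proof -
  have "real m * real n \<le> N * N" by (intro mult_mono) auto
  then show ?thesis by (simp add: power2_eq_square)
qed

text \<open>From \<tau> > \<delta> one has 1 \<le> \<open>e * \<tau>\<close>, so constants can be
  raised to powers of \<tau>. The bounds become homogeneous in \<tau>, and these powers later cancel
  against those in \<open>b = r / \<tau>\<close>.\<close>

lemma Z_bounds:
  assumes "j \<in> {1..m}" "k \<in> {1..n}"
  shows "0 < Z j k" "Z j k \<le> \<tau>" "Z j k + 1 \<le> 2 * e * \<tau>" "2 * Z j k + 1 \<le> 3 * e * \<tau>"
    "6 * (Z j k)\<^sup>2 + 6 * Z j k + 1 \<le> 13 * e\<^sup>2 * \<tau>\<^sup>2" "1 + 12 * Z j k + 12 * (Z j k)\<^sup>2 \<le> 25 * e\<^sup>2 * \<tau>\<^sup>2"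
proof -
  show z: "0 < Z j k" "Z j k \<le> \<tau>" using Z_pos[OF assms] Z_le[OF assms] by auto
  have one: "1 \<le> e * \<tau>" using \<tau> \<delta> by (simp add: e_def)
  have t: "\<tau> \<le> e * \<tau>" using mult_right_mono[OF e_ge_1, of \<tau>] \<tau>_pos by simp
  show "Z j k + 1 \<le> 2 * e * \<tau>" "2 * Z j k + 1 \<le> 3 * e * \<tau>" using z one t by linarith+
  have one2: "1 \<le> e\<^sup>2 * \<tau>\<^sup>2" using power_mono[OF one, of 2] by (simp only: power_mult_distrib) simp
  have zt: "Z j k \<le> e\<^sup>2 * \<tau>\<^sup>2"
  proof -
    have "Z j k \<le> e * \<tau> * 1" using order_trans[OF z(2) t] by simp
    also have "\<dots> \<le> e * \<tau> * (e * \<tau>)" using one by (intro mult_left_mono) auto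
    finally show ?thesis by (simp add: power2_eq_square mult_ac)
  qed
  have z2: "(Z j k)\<^sup>2 \<le> e\<^sup>2 * \<tau>\<^sup>2"
    using power_mono[OF order_trans[OF z(2) t] less_imp_le[OF z(1)], of 2] by (simp only: power_mult_distrib)
  show "6 * (Z j k)\<^sup>2 + 6 * Z j k + 1 \<le> 13 * e\<^sup>2 * \<tau>\<^sup>2" "1 + 12 * Z j k + 12 * (Z j k)\<^sup>2 \<le> 25 * e\<^sup>2 * \<tau>\<^sup>2"
    using one2 zt z2 by auto
qed

section \<open>Coefficients and moments of f and h in scaled coordinates\<close>

definition cf :: "nat \<times> nat \<Rightarrow> real" where
  "cf = (\<lambda>(j, k). Z j k * (Z j k + 1) * (2 * Z j k + 1) / 6 * b ^ 3)"

definition ch :: "nat \<times> nat \<Rightarrow> real" where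
  "ch = (\<lambda>(j, k). Z j k * (Z j k + 1) * (6 * (Z j k)\<^sup>2 + 6 * Z j k + 1) / 24 * b ^ 4)"

lemma cf_le: "z \<in> {1..m} \<times> {1..n} \<Longrightarrow> \<bar>cf z\<bar> \<le> e\<^sup>2 * r ^ 3"
proof -
  assume "z \<in> {1..m} \<times> {1..n}"
  then obtain j k where z: "z = (j, k)" and jk: "j \<in> {1..m}" "k \<in> {1..n}" by auto
  note B = Z_bounds[OF jk]
  have "Z j k * (Z j k + 1) * (2 * Z j k + 1) \<le> \<tau> * (2 * e * \<tau>) * (3 * e * \<tau>)"
    using B \<tau>_pos e_pos by (intro mult_mono) auto
  then have "Z j k * (Z j k + 1) * (2 * Z j k + 1) / 6 * b ^ 3 \<le> (e\<^sup>2 * \<tau> ^ 3) * b ^ 3"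
    using b_pos by (intro mult_right_mono) (auto simp: power2_eq_square power3_eq_cube mult_ac)
  also have "\<dots> = e\<^sup>2 * r ^ 3" using \<tau>_pos by (simp add: b_eq power_divide)
  finally show ?thesis using B b_pos by (simp add: z cf_def)
qed

lemma ch_bounds: "z \<in> {1..m} \<times> {1..n} \<Longrightarrow> 0 \<le> ch z \<and> \<bar>ch z\<bar> \<le> 2 * e ^ 3 * r ^ 4"
proof -
  assume "z \<in> {1..m} \<times> {1..n}"
  then obtain j k where z: "z = (j, k)" and jk: "j \<in> {1..m}" "k \<in> {1..n}" by auto
  note B = Z_bounds[OF jk]
  have "Z j k * (Z j k + 1) * (6 * (Z j k)\<^sup>2 + 6 * Z j k + 1) \<le> \<tau> * (2 * e * \<tau>) * (13 * e\<^sup>2 * \<tau>\<^sup>2)"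
    using B \<tau>_pos e_pos by (intro mult_mono) auto
  also have "\<dots> \<le> 48 * (e ^ 3 * \<tau> ^ 4)"
    using \<tau>_pos e_pos by (simp add: power2_eq_square power3_eq_cube power4_eq_xxxx)
  finally have "Z j k * (Z j k + 1) * (6 * (Z j k)\<^sup>2 + 6 * Z j k + 1) / 24 * b ^ 4 \<le> (2 * (e ^ 3 * \<tau> ^ 4)) * b ^ 4"
    using b_pos by (intro mult_right_mono) auto
  also have "\<dots> = 2 * e ^ 3 * r ^ 4" using \<tau>_pos by (simp add: b_eq power_divide)
  finally show ?thesis using B b_pos by (simp add: z ch_def)
qed

lemma f_form_gmap: "f_form m n Z (gmap x) = fam.cubic cf x"
proof -
  have "f_form m n Z (gmap x) = (\<Sum>j=1..m. \<Sum>k=1..n. 1/6 * (Z j k * (Z j k + 1) * (2 * Z j k + 1) * (fst (gmap x) j + snd (gmap x) k) ^ 3))"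
    by (simp add: f_form_def case_prod_unfold sum_distrib_left)
  also have "\<dots> = (\<Sum>j=1..m. \<Sum>k=1..n. cf (j, k) * lin (vx (j, k)) x ^ 3)"
    by (intro sum.cong refl) (simp add: gmap_sum cf_def power_mult_distrib)
  finally show ?thesis by (simp add: fam.cubic_def sum.cartesian_product case_prod_unfold)
qed

lemma h_form_gmap: "h_form m n Z (gmap x) = fam.quartic ch x"
proof -
  have "h_form m n Z (gmap x) = (\<Sum>j=1..m. \<Sum>k=1..n. 1/24 * (Z j k * (Z j k + 1) * (6 * (Z j k)\<^sup>2 + 6 * Z j k + 1) * (fst (gmap x) j + snd (gmap x) k) ^ 4))"
    by (simp add: h_form_def case_prod_unfold sum_distrib_left)
  also have "\<dots> = (\<Sum>j=1..m. \<Sum>k=1..n. ch (j, k) * lin (vx (j, k)) x ^ 4)"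
    by (intro sum.cong refl) (simp add: gmap_sum ch_def power_mult_distrib)
  finally show ?thesis by (simp add: fam.quartic_def sum.cartesian_product case_prod_unfold)
qed

lemma mu_eq: "mu m n Z = E (\<lambda>x. (fam.cubic cf x)\<^sup>2)"
  unfolding mu_def f_form_gmap[symmetric] by (rule integral_gaussian_measure) (intro borel_measurable_power measurable_f_form)

lemma nu_eq: "nu m n Z = E (fam.quartic ch)"
  unfolding nu_def h_form_gmap[symmetric, abs_def] by (rule integral_gaussian_measure) (rule measurable_h_form)

text \<open>These constants and those introduced below depend on \<open>\<delta>\<close> only, which makes the final \<open>\<gamma>\<close> uniform in
  \<open>m\<close>, \<open>n\<close>, \<open>\<tau>\<close> and the margins.\<close>
definition M\<mu> :: real where "M\<mu> = 84 * e ^ 4 * \<rho>0 * Sx ^ 4"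
definition M\<nu> :: real where "M\<nu> = 48 * e ^ 3 * Sx ^ 4"
definition V1 :: real where "V1 = 12000000 * e ^ 8 * \<rho>0 ^ 3 * Sx ^ 8"
definition V2 :: real where "V2 = 2580480 * e ^ 6 * \<rho>0 * Sx ^ 8"

lemma r_powers: "r ^ 4 = 1 / N\<^sup>2" "r ^ 6 = 1 / N ^ 3" "r ^ 8 = 1 / N ^ 4" "r ^ 12 = 1 / N ^ 6"
proof -
  have "r ^ (2 * p) = 1 / N ^ p" for p by (simp add: power_mult r_sq power_divide)
  from this[of 2] this[of 3] this[of 4] this[of 6]
  show "r ^ 4 = 1 / N\<^sup>2" "r ^ 6 = 1 / N ^ 3" "r ^ 8 = 1 / N ^ 4" "r ^ 12 = 1 / N ^ 6" by simp_all
qed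

lemma Sx_ge_1: "1 \<le> Sx" by (simp add: Sx_def)

text \<open>Orders of magnitude: squared coefficients N^(-3), at most N^2 edges, row sums N; the
  product is O(1).\<close>

lemma mu_bounds: "0 \<le> mu m n Z" "mu m n Z \<le> M\<mu>"
proof -
  show "0 \<le> mu m n Z" unfolding mu_eq by (intro Bochner_Integration.integral_nonneg) auto
  have "mu m n Z \<le> 84 * (e\<^sup>2 * r ^ 3)\<^sup>2 * real (card ({1..m} \<times> {1..n})) * (\<rho>0 * N) * Sx ^ 4"
    unfolding mu_eq by (rule fam.E_cubic_square_le[OF cf_le])
  also have "\<dots> \<le> 84 * (e\<^sup>2 * r ^ 3)\<^sup>2 * N\<^sup>2 * (\<rho>0 * N) * Sx ^ 4"
    using card_A_le \<rho>0_pos Sx_ge_1 N_pos by (intro mult_right_mono mult_left_mono) auto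
  also have "\<dots> = 84 * e ^ 4 * \<rho>0 * Sx ^ 4 * (r ^ 6 * (N\<^sup>2 * N))"
    by (simp add: power_mult_distrib power_mult[symmetric])
  also have "r ^ 6 * (N\<^sup>2 * N) = 1" using N_pos by (simp only: r_powers power_ratio(3))
  finally show "mu m n Z \<le> M\<mu>" by (simp add: M\<mu>_def)
qed

text \<open>Coefficients of order N^(-2) over at most N^2 edges.\<close>

lemma nu_bounds: "0 \<le> nu m n Z" "nu m n Z \<le> M\<nu>"
proof -
  show "0 \<le> nu m n Z" unfolding nu_eq fam.quartic_def
    using ch_bounds by (intro Bochner_Integration.integral_nonneg sum_nonneg mult_nonneg_nonneg) auto
  have "nu m n Z \<le> 24 * (2 * e ^ 3 * r ^ 4) * real (card ({1..m} \<times> {1..n})) * Sx ^ 4"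
    unfolding nu_eq by (rule fam.E_quartic_le) (use ch_bounds in blast)
  also have "\<dots> \<le> 24 * (2 * e ^ 3 * r ^ 4) * N\<^sup>2 * Sx ^ 4"
    using card_A_le Sx_ge_1 e_pos r_pos by (intro mult_right_mono mult_left_mono) auto
  also have "\<dots> = 48 * e ^ 3 * Sx ^ 4 * (r ^ 4 * N\<^sup>2)" by simp
  also have "r ^ 4 * N\<^sup>2 = 1" using N_pos by (simp only: r_powers) simp
  finally show "nu m n Z \<le> M\<nu>" by (simp add: M\<nu>_def)
qed

lemma V_nonneg: "0 \<le> V1" "0 \<le> V2" "0 \<le> M\<mu>" "0 \<le> M\<nu>"
  using \<rho>0_pos Sx_ge_1 e_pos by (auto simp: V1_def V2_def M\<mu>_def M\<nu>_def)

text \<open>The fourth power of the coefficients is N^(-6), against N^2 for the edges and N^3 for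
  the row sums, so the variance is O(1/N).\<close>

lemma stein_deviation: "E (\<lambda>x. \<bar>fam.stein cf x - mu m n Z\<bar>) \<le> sqrt (V1 / N)"
proof (rule E_abs_le_sqrt)
  have \<mu>: "mu m n Z = E (fam.stein cf)" unfolding mu_eq by (rule fam.E_cubic_square)
  have "E (\<lambda>x. (fam.stein cf x - mu m n Z)\<^sup>2) \<le> 12000000 * (e\<^sup>2 * r ^ 3) ^ 4 * real (card ({1..m} \<times> {1..n})) * (\<rho>0 * N) ^ 3 * Sx ^ 8"
    unfolding \<mu> by (rule fam.variance_stein_le[OF cf_le])
  also have "\<dots> \<le> 12000000 * (e\<^sup>2 * r ^ 3) ^ 4 * N\<^sup>2 * (\<rho>0 * N) ^ 3 * Sx ^ 8"
    using card_A_le \<rho>0_pos Sx_ge_1 N_pos by (intro mult_right_mono mult_left_mono) auto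
  also have "\<dots> = V1 * (r ^ 12 * (N\<^sup>2 * N ^ 3))"
    by (simp add: V1_def power_mult_distrib power_mult[symmetric])
  also have "r ^ 12 * (N\<^sup>2 * N ^ 3) = 1 / N"
    unfolding r_powers by (rule power_ratio(1)[OF N_pos])
  finally show "E (\<lambda>x. (fam.stein cf x - mu m n Z)\<^sup>2) \<le> V1 / N" by simp
qed auto

text \<open>Squared coefficients N^(-4), against N^2 edges and row sums of order N.\<close>

lemma quartic_variance: "E (\<lambda>x. (fam.quartic ch x - nu m n Z)\<^sup>2) \<le> V2 / N"
proof -
  have "E (\<lambda>x. (fam.quartic ch x - nu m n Z)\<^sup>2) \<le> 645120 * (2 * e ^ 3 * r ^ 4)\<^sup>2 * real (card ({1..m} \<times> {1..n})) * (\<rho>0 * N) * Sx ^ 8"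
    unfolding nu_eq by (rule fam.variance_quartic_le) (use ch_bounds in blast)
  also have "\<dots> \<le> 645120 * (2 * e ^ 3 * r ^ 4)\<^sup>2 * N\<^sup>2 * (\<rho>0 * N) * Sx ^ 8"
    using card_A_le \<rho>0_pos Sx_ge_1 N_pos by (intro mult_right_mono mult_left_mono) auto
  also have "\<dots> = V2 * (r ^ 8 * (N\<^sup>2 * N))"
    by (simp add: V2_def power_mult_distrib power_mult[symmetric])
  also have "r ^ 8 * (N\<^sup>2 * N) = 1 / N"
    unfolding r_powers by (rule power_ratio(2)[OF N_pos])
  finally show ?thesis by simp
qed

end

section \<open>Estimates on the truncated region\<close>

lemma measurable_fst_coord: "j \<in> A \<Longrightarrow> (\<lambda>p. fst p j) \<in> borel_measurable (lebPi A \<Otimes>\<^sub>M M)"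
  using measurable_compose[OF measurable_fst measurable_component_singleton[of j A "\<lambda>_. lborel :: real measure"]] by simp

lemma measurable_snd_coord: "j \<in> A \<Longrightarrow> (\<lambda>p. snd p j) \<in> borel_measurable (M \<Otimes>\<^sub>M lebPi A)"
  using measurable_compose[OF measurable_snd measurable_component_singleton[of j A "\<lambda>_. lborel :: real measure"]] by simp

lemma U_region_eq: "U_region m n \<tau> = {p \<in> space (lebPair m n). snd p n = 0 \<and>
   ((\<forall>j\<in>{1..m}. \<bar>fst p j\<bar> \<le> pi \<and> \<bar>fst p j\<bar> \<le> ln (real (m + n)) / (\<tau> * sqrt (real (m + n)))) \<and>
    (\<forall>k\<in>{1..n}. \<bar>snd p k\<bar> \<le> pi \<and> \<bar>snd p k\<bar> \<le> ln (real (m + n)) / (\<tau> * sqrt (real (m + n)))))}"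
proof -
  have "(- pi \<le> u \<and> u \<le> pi) = (\<bar>u\<bar> \<le> pi)" for u by auto
  then show ?thesis unfolding U_region_def Pi0_def by auto
qed

lemma sets_U_region: 
  fixes m n :: nat
  assumes "1 \<le> m" "1 \<le> n"
  shows "U_region m n \<tau> \<in> sets (lebPair m n)"
proof -
  have f: "{p \<in> space (lebPair m n). \<bar>fst p j\<bar> \<le> pi \<and> \<bar>fst p j\<bar> \<le> c} \<in> sets (lebPair m n)"
    if "j \<in> {1..m}" for j c
  proof -
    note [measurable] = measurable_fst_coord[OF that, of "lebPi {1..n}"]
    show ?thesis by measurable
  qed
  have s: "{p \<in> space (lebPair m n). \<bar>snd p j\<bar> \<le> pi \<and> \<bar>snd p j\<bar> \<le> c} \<in> sets (lebPair m n)"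
    if "j \<in> {1..n}" for j c
  proof -
    note [measurable] = measurable_snd_coord[OF that, of "lebPi {1..m}"]
    show ?thesis by measurable
  qed
  have z: "{p \<in> space (lebPair m n). snd p n = 0} \<in> sets (lebPair m n)"
  proof -
    have "n \<in> {1..n}" using assms by simp
    note [measurable] = measurable_snd_coord[OF this, of "lebPi {1..m}"]
    show ?thesis by measurable
  qed
  show ?thesis unfolding U_region_eq
    by (intro sets.sets_Collect_conj z sets.sets_Collect_finite_All' f s) (use assms in auto)
qed

lemma measurable_F_integrand: "F_integrand m n R C Z \<in> borel_measurable (lebPair m n)"
proof -
  let ?M = "lebPair m n"
  have ofr: "(\<lambda>p. complex_of_real (g p)) \<in> borel_measurable ?M" if "g \<in> borel_measurable ?M" for g
    using measurable_compose[OF that borel_measurable_of_real] by simp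
  have cexp: "(\<lambda>p. exp (g p)) \<in> borel_measurable ?M" if "g \<in> borel_measurable ?M" for g :: "_ \<Rightarrow> complex"
    using measurable_compose[OF that borel_measurable_exp] by simp
  have 1: "(\<lambda>p. exp (- \<i> * (\<Sum>j=1..m. of_nat (R j) * of_real (fst p j)) - \<i> * (\<Sum>k=1..n. of_nat (C k) * of_real (snd p k)))) \<in> borel_measurable ?M"
    by (intro cexp borel_measurable_diff borel_measurable_times borel_measurable_const borel_measurable_sum ofr measurable_fst_coord measurable_snd_coord)
  have 2: "(\<lambda>p. \<Prod>j=1..m. \<Prod>k=1..n. inverse (1 + of_real (Z j k) - of_real (Z j k) * exp (\<i> * of_real (fst p j + snd p k)))) \<in> borel_measurable ?M"
    by (intro borel_measurable_prod borel_measurable_inverse borel_measurable_diff borel_measurable_times borel_measurable_const cexp ofr measurable_pair_coordinates)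
  show ?thesis unfolding F_integrand_def case_prod_unfold by (rule borel_measurable_times[OF 1 2])
qed

context margins
begin

text \<open>The common error rate. The remainder bound ln(N)^5 / sqrt N rules out the rate N^(-1/2);
  the exponent 1/4 leaves room for the logarithms.\<close>

definition q :: real where "q = N powr (- 1 / 4)"

lemma q_pos: "0 < q" and q_le_1: "q \<le> 1" and q4: "q ^ 4 = 1 / N"
proof -
  show "0 < q" using N_pos by (simp add: q_def)
  have "N powr (- 1 / 4) \<le> N powr 0" using N_ge_2 by (intro powr_mono) auto
  then show "q \<le> 1" using N_pos by (simp add: q_def)
  have "q ^ 4 = N powr (of_nat 4 * (- 1 / 4))"
    unfolding q_def using N_pos by (intro powr_power) linarith
  also have "of_nat 4 * (- 1 / 4 :: real) = - 1" by simp
  finally show "q ^ 4 = 1 / N" unfolding powr_minus using N_pos by (simp add: divide_inverse)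
qed

lemma inverse_N_le_q: "1 / N \<le> q"
proof -
  have "q ^ 4 \<le> q ^ 1" using q_pos q_le_1 by (intro power_decreasing) auto
  then show ?thesis by (simp add: q4)
qed

lemma sqrt_inverse_N: "sqrt (1 / N) = q\<^sup>2"
proof (rule real_sqrt_unique)
  show "(q\<^sup>2)\<^sup>2 = 1 / N" using q4 by (simp add: power_mult[symmetric])
qed simp

abbreviation L :: real where "L \<equiv> ln N"

lemma L_pos: "0 < L" using N_ge_2 by simp

lemma L4_le: "L ^ 4 \<le> 256 * N"
proof -
  have "L \<le> 4 * N powr (1 / 4)" using N_ge_2 by (intro ln_le_root) auto
  then have "L ^ 4 \<le> (4 * N powr (1 / 4)) ^ 4" using L_pos by (intro power_mono) auto
  also have "\<dots> = 256 * N"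
    using N_pos by (simp only: power_mult_distrib) (simp add: powr_power)
  finally show ?thesis .
qed

text \<open>The root 20 is chosen because the fifth power of N^(1/20) is N^(1/4), half of the decay
  of r.\<close>

lemma L5_le: "L ^ 5 * r \<le> 20 ^ 5 * q"
proof -
  have "L \<le> 20 * N powr (1 / 20)" using N_ge_2 by (intro ln_le_root) auto
  then have "L ^ 5 \<le> (20 * N powr (1 / 20)) ^ 5" using L_pos by (intro power_mono) auto
  also have "\<dots> = 20 ^ 5 * N powr (1 / 4)"
    using N_pos by (simp only: power_mult_distrib) (simp add: powr_power)
  finally have "L ^ 5 * r \<le> (20 ^ 5 * N powr (1 / 4)) * r" using r_pos by (intro mult_right_mono) auto
  moreover have "r = N powr (- 1 / 2)" using N_pos by (simp add: r_def powr_half_sqrt[symmetric] powr_minus_divide)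
  then have "N powr (1 / 4) * r = q" using N_pos by (simp add: q_def powr_add[symmetric])
  ultimately show ?thesis by (simp only: mult.assoc)
qed

text \<open>For u the fourth root of N, ln N = 4 ln u \<le> 4 u - 4 \<le> u^2.\<close>

lemma L_le_sqrt: "L \<le> sqrt N"
proof -
  have "ln (sqrt N) \<le> sqrt N - 1" using N_pos by (intro ln_le_minus_one) auto
  moreover have "ln (sqrt (sqrt N)) \<le> sqrt (sqrt N) - 1" using N_pos by (intro ln_le_minus_one) auto
  moreover have "ln (sqrt N) = L / 2" "ln (sqrt (sqrt N)) = L / 4" using N_pos by (auto simp: ln_sqrt)
  moreover have "4 * sqrt (sqrt N) - 4 \<le> sqrt N"
  proof -
    have "4 * u - 4 \<le> u\<^sup>2" for u :: real
      using zero_le_power2[of "u - 2"] by (simp add: power2_eq_square algebra_simps)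
    from this[of "sqrt (sqrt N)"] show ?thesis using N_pos by simp
  qed
  ultimately show ?thesis by linarith
qed

lemma ln_bound_eq: "ln (real (m + n)) / (\<tau> * sqrt (real (m + n))) = b * L"
  by (simp add: b_def)

lemma U_lin_le:
  assumes "gmap x \<in> U_region m n \<tau>" "j \<in> {1..m}" "k \<in> {1..n}"
  shows "\<bar>lin (vx (j, k)) x\<bar> \<le> 2 * L"
proof -
  have "\<bar>fst (gmap x) j\<bar> \<le> b * L" "\<bar>snd (gmap x) k\<bar> \<le> b * L"
    using assms unfolding U_region_eq ln_bound_eq by auto
  then have "\<bar>fst (gmap x) j + snd (gmap x) k\<bar> \<le> b * (2 * L)" by linarith
  then have "b * \<bar>lin (vx (j, k)) x\<bar> \<le> b * (2 * L)"
    unfolding gmap_sum[OF assms(2,3)] using b_pos by (simp add: abs_mult)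
  then show ?thesis using b_pos by (rule mult_left_le_imp_le)
qed

text \<open>Chosen so that coordinates of size \<open>c' * L\<close> map into the region. The
  halving pays for the sum of two coordinates in \<open>gmap\<close>; the bound by
  \<open>pi * \<delta>\<close> keeps the point inside \<open>Pi0\<close>, because
  \<open>b * L\<close> is at most 1/\<tau> < 1/\<delta>.\<close>

definition c' :: real where "c' = min 1 (pi * \<delta>) / 2"

lemma c'_pos: "0 < c'" using \<delta> by (simp add: c'_def)

lemma U_region_if_small:
  assumes "x \<in> space P" "\<And>i. i \<in> Ix \<Longrightarrow> \<bar>x i\<bar> \<le> c' * L"
  shows "gmap x \<in> U_region m n \<tau>"
proof -
  have bL: "b * (2 * (c' * L)) \<le> b * L" "b * (2 * (c' * L)) \<le> pi"
  proof -
    have "2 * c' \<le> 1" "2 * c' \<le> pi * \<delta>" by (auto simp: c'_def)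
    then have 1: "2 * (c' * L) \<le> 1 * L" "2 * (c' * L) \<le> (pi * \<delta>) * L"
      using L_pos mult_right_mono[of "2 * c'" 1 L] mult_right_mono[of "2 * c'" "pi * \<delta>" L] by auto
    then show "b * (2 * (c' * L)) \<le> b * L" using b_pos by simp
    have "b * (2 * (c' * L)) \<le> b * (pi * \<delta> * L)" using 1 b_pos by (intro mult_left_mono) auto
    also have "\<dots> \<le> b * (pi * \<tau> * sqrt N)"
      using b_pos \<tau> \<delta> L_pos L_le_sqrt by (intro mult_left_mono mult_mono) auto
    also have "\<dots> = pi" using \<tau>_pos N_pos by (simp add: b_def)
    finally show "b * (2 * (c' * L)) \<le> pi" .
  qed
  have n: "n \<in> {1..n}" using n1 by simp
  have s: "\<bar>fst (gmap x) j\<bar> \<le> b * (2 * (c' * L))" if j: "j \<in> {1..m}" for j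
  proof -
    have "\<bar>x (Inl j) + x (Inr n)\<bar> \<le> 2 * (c' * L)" using assms(2)[of "Inl j"] assms(2)[of "Inr n"] j n by simp
    then show ?thesis using j b_pos by (simp add: gmap_def abs_mult)
  qed
  have t: "\<bar>snd (gmap x) k\<bar> \<le> b * (2 * (c' * L))" if k: "k \<in> {1..n}" for k
  proof -
    have "\<bar>x (Inr k) - x (Inr n)\<bar> \<le> 2 * (c' * L)" using assms(2)[of "Inr k"] assms(2)[of "Inr n"] k n by simp
    then show ?thesis using k b_pos by (simp add: gmap_def abs_mult)
  qed
  have "gmap x \<in> space (lebPair m n)"
    using measurable_space[OF measurable_gmap_P assms(1)] .
  moreover have "snd (gmap x) n = 0" using n by (simp add: gmap_def)
  moreover have "\<bar>fst (gmap x) j\<bar> \<le> pi" "\<bar>fst (gmap x) j\<bar> \<le> b * L" if "j \<in> {1..m}" for j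
    using s[OF that] bL by linarith+
  moreover have "\<bar>snd (gmap x) k\<bar> \<le> pi" "\<bar>snd (gmap x) k\<bar> \<le> b * L" if "k \<in> {1..n}" for k
    using t[OF that] bL by linarith+
  ultimately show ?thesis unfolding U_region_eq ln_bound_eq by blast
qed

section \<open>The probability of the complement of the region\<close>

definition J :: "(nat + nat \<Rightarrow> real) \<Rightarrow> real" where
  "J x = indicator (U_region m n \<tau>) (gmap x)"

lemma J_cases: "J x = 0 \<or> J x = 1" "0 \<le> J x" "J x \<le> 1"
  by (auto simp: J_def indicator_def)

lemma J_measurable [measurable]: "J \<in> borel_measurable (lebPi Ix)"
  unfolding J_def[abs_def] using measurable_compose[OF measurable_gmap borel_measurable_indicator[OF sets_U_region[OF m1 n1]]] .

lemma tame_J [simp, intro]: "tame J"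
  by (rule tame_bounded[of _ 1]) (use J_cases in auto)

definition V3 :: real where "V3 = 2 * exp ((2 / c')\<^sup>2 / (2 * \<kappa>x))"

text \<open>A union bound over N coordinates. With Chernoff parameter \<open>2 / c'\<close> the
  exponent at level \<open>c' * L\<close> is -2 ln N, so the total is O(1/N).\<close>

lemma E_not_J_le: "E (\<lambda>x. 1 - J x) \<le> V3 * q"
proof -
  let ?B = "\<lambda>i. {x \<in> space P. c' * L < \<bar>x i\<bar>}"
  have B: "?B i \<in> sets P" if "i \<in> Ix" for i using that by measurable
  have "E (\<lambda>x. 1 - J x) \<le> E (\<lambda>x. \<Sum>i\<in>Ix. indicator (?B i) x)"
  proof (rule integral_mono)
    show "integrable P (\<lambda>x. 1 - J x)" by (intro integrable_P) auto
    show "integrable P (\<lambda>x. \<Sum>i\<in>Ix. indicator (?B i) x :: real)"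
      using B by (intro Bochner_Integration.integrable_sum integrable_real_indicator) (auto simp: emeasure_eq_measure)
    fix x assume x: "x \<in> space P"
    have s0: "0 \<le> (\<Sum>i\<in>Ix. indicator (?B i) x :: real)" by (intro sum_nonneg) auto
    show "1 - J x \<le> (\<Sum>i\<in>Ix. indicator (?B i) x)"
    proof (cases "\<forall>i\<in>Ix. \<bar>x i\<bar> \<le> c' * L")
      case True
      then have "J x = 1" using U_region_if_small[OF x] by (simp add: J_def)
      then show ?thesis using s0 by simp
    next
      case False
      then obtain i where i: "i \<in> Ix" "c' * L < \<bar>x i\<bar>" by auto
      then have "1 = (indicator (?B i) x :: real)" using x by simp
      also have "\<dots> \<le> (\<Sum>i\<in>Ix. indicator (?B i) x)" using i by (intro member_le_sum) auto
      finally show ?thesis using J_cases(2)[of x] by linarith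
    qed
  qed
  also have "\<dots> = (\<Sum>i\<in>Ix. measure P (?B i))"
    using B by (subst Bochner_Integration.integral_sum) (auto simp: emeasure_eq_measure intro!: integrable_real_indicator)
  also have "\<dots> \<le> (\<Sum>i\<in>Ix. V3 / N\<^sup>2)"
  proof (rule sum_mono)
    fix i assume i: "i \<in> Ix"
    have "measure P (?B i) \<le> 2 * exp ((2 / c')\<^sup>2 / (2 * \<kappa>x) - 2 / c' * (c' * L))"
      using c'_pos by (intro coord_tail i) auto
    also have "2 / c' * (c' * L) = ln (N\<^sup>2)" using c'_pos N_pos by (simp add: ln_realpow)
    also have "2 * exp ((2 / c')\<^sup>2 / (2 * \<kappa>x) - ln (N\<^sup>2)) = V3 / N\<^sup>2"
      using N_pos by (simp add: V3_def exp_diff)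
    finally show "measure P (?B i) \<le> V3 / N\<^sup>2" .
  qed
  also have "\<dots> = V3 * (1 / N)" using N_pos by (simp add: card_Ix power2_eq_square)
  also have "\<dots> \<le> V3 * q" using inverse_N_le_q by (intro mult_left_mono) (auto simp: V3_def)
  finally show ?thesis .
qed

section \<open>Exponential moments and the Taylor remainder on the region\<close>

abbreviation hh :: "(nat + nat \<Rightarrow> real) \<Rightarrow> real" where "hh \<equiv> fam.quartic ch"
abbreviation ff :: "(nat + nat \<Rightarrow> real) \<Rightarrow> real" where "ff \<equiv> fam.cubic cf"
abbreviation rem :: "(nat + nat \<Rightarrow> real) \<Rightarrow> complex" where "rem x \<equiv> taylor_rem m n Z (gmap x)"

text \<open>64 = 2 * 2 * 16: from the exponent \<open>2 * hh\<close>, the bound on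
  \<open>ch\<close>, and \<open>sum_fourth_power_le\<close>. In \<open>\<theta>1\<close>, 512 comes
  from \<open>power4_le_cosh\<close>, and 256 from \<open>L4_le\<close>, which bounds the exponent
  contributed by one coordinate.\<close>

definition \<theta>0 :: real where "\<theta>0 = 64 * e ^ 3"
definition \<theta>1 :: real where "\<theta>1 = 512 * \<theta>0 * exp (256 * \<theta>0)"
definition M2 :: real where "M2 = exp (\<theta>1 * exp (1 / (2 * \<kappa>x)))"

text \<open>Only the sums \<open>x\<^sub>j + y\<^sub>k\<close> are bounded on the region, not the coordinates themselves, hence the truncation
  \<open>min L \<bar>x\<^sub>i\<bar>\<close>.\<close>
lemma exp_hh_le:
  assumes "gmap x \<in> U_region m n \<tau>"
  shows "exp (2 * hh x) \<le> (\<Prod>i\<in>Ix. (1 + \<theta>1 / N * cosh (x i)))"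
proof -
  define w where "w i = (min L \<bar>x i\<bar>) ^ 4" for i
  have \<theta>0: "0 < \<theta>0" using e_pos by (simp add: \<theta>0_def)
  have w0: "0 \<le> w i" for i using L_pos by (simp add: w_def)
  have wx: "w i \<le> x i ^ 4" for i
  proof -
    have "w i \<le> \<bar>x i\<bar> ^ 4" unfolding w_def using L_pos by (intro power_mono) auto
    then show ?thesis by simp
  qed
  have wL: "w i \<le> 256 * N" for i
  proof -
    have "w i \<le> L ^ 4" unfolding w_def using L_pos by (intro power_mono) auto
    then show ?thesis using L4_le by linarith
  qed
  have "hh x = (\<Sum>j=1..m. \<Sum>k=1..n. ch (j, k) * lin (vx (j, k)) x ^ 4)"
    by (simp add: fam.quartic_def sum.cartesian_product case_prod_unfold)
  also have "\<dots> \<le> (\<Sum>j=1..m. \<Sum>k=1..n. (2 * e ^ 3 * r ^ 4) * (16 * (w (Inl j) + w (Inr k))))"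
  proof (intro sum_mono mult_mono)
    fix j k assume jk: "j \<in> {1..m}" "k \<in> {1..n}"
    show "ch (j, k) \<le> 2 * e ^ 3 * r ^ 4" using ch_bounds[of "(j, k)"] jk by auto
    show "lin (vx (j, k)) x ^ 4 \<le> 16 * (w (Inl j) + w (Inr k))"
      using U_lin_le[OF assms jk] L_pos unfolding lin_vx[OF jk] w_def by (intro sum_fourth_power_le) auto
  qed (use e_pos in auto)
  also have "\<dots> = 32 * e ^ 3 * r ^ 4 * (\<Sum>j=1..m. \<Sum>k=1..n. w (Inl j) + w (Inr k))"
    unfolding sum_distrib_left[of "32 * e ^ 3 * r ^ 4"] by (intro sum.cong refl) simp
  also have "(\<Sum>j=1..m. \<Sum>k=1..n. w (Inl j) + w (Inr k)) = real n * (\<Sum>j=1..m. w (Inl j)) + real m * (\<Sum>k=1..n. w (Inr k))"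
    by (simp add: sum.distrib sum_distrib_left)
  \<comment> \<open>Each coordinate occurs in at most N edges; with r^4 = N^(-2) it receives a
    weight of order 1/N.\<close>
  also have "32 * e ^ 3 * r ^ 4 * \<dots> \<le> 32 * e ^ 3 * r ^ 4 * (N * (\<Sum>j=1..m. w (Inl j)) + N * (\<Sum>k=1..n. w (Inr k)))"
    using e_pos by (intro mult_left_mono add_mono mult_right_mono sum_nonneg w0) auto
  also have "\<dots> = 32 * e ^ 3 * (r ^ 4 * N) * (\<Sum>i\<in>Ix. w i)"
    by (simp add: sum_Ix algebra_simps)
  also have "r ^ 4 * N = 1 / N" using N_pos by (simp add: r_powers power2_eq_square)
  finally have hle: "hh x \<le> 32 * e ^ 3 * (1 / N) * (\<Sum>i\<in>Ix. w i)" .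
  have "(\<Sum>i\<in>Ix. \<theta>0 / N * w i) = \<theta>0 / N * (\<Sum>i\<in>Ix. w i)" by (simp only: sum_distrib_left)
  then have "2 * hh x \<le> (\<Sum>i\<in>Ix. \<theta>0 / N * w i)"
    using hle by (simp add: \<theta>0_def)
  then have "exp (2 * hh x) \<le> (\<Prod>i\<in>Ix. exp (\<theta>0 / N * w i))" by (simp flip: exp_sum)
  also have "\<dots> \<le> (\<Prod>i\<in>Ix. (1 + \<theta>1 / N * cosh (x i)))"
  proof (rule prod_mono, intro conjI)
    fix i
    define y where "y = \<theta>0 / N * w i"
    have y0: "0 \<le> y" using w0 \<theta>0 N_pos by (simp add: y_def)
    have y1: "y \<le> 256 * \<theta>0"
    proof -
      have "w i / N \<le> 256" using wL[of i] N_pos by (simp only: pos_divide_le_eq)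
      then have "\<theta>0 * (w i / N) \<le> \<theta>0 * 256" using \<theta>0 by (intro mult_left_mono) auto
      then show ?thesis by (simp add: y_def)
    qed
    \<comment> \<open>From 1 - y \<le> exp(-y) follows exp y \<le> 1 + y exp y. The factor y keeps
      the cosh term and the weight 1/N, while exp y is bounded by a constant.\<close>
    have "(1 - y) * exp y \<le> exp (- y) * exp y"
      using exp_ge_add_one_self[of "- y"] by (intro mult_right_mono) auto
    then have "exp y \<le> 1 + y * exp y" by (simp add: exp_minus left_diff_distrib)
    also have "\<dots> \<le> 1 + \<theta>0 / N * (512 * cosh (x i)) * exp (256 * \<theta>0)"
    proof -
      have "y \<le> \<theta>0 / N * (512 * cosh (x i))"
        unfolding y_def using \<theta>0 N_pos order_trans[OF wx power4_le_cosh] by (intro mult_left_mono) auto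
      then have "y * exp y \<le> \<theta>0 / N * (512 * cosh (x i)) * exp (256 * \<theta>0)"
        using y1 y0 by (intro mult_mono) (auto intro: order_trans)
      then show ?thesis by simp
    qed
    also have "\<dots> = 1 + \<theta>1 / N * cosh (x i)" by (simp add: \<theta>1_def)
    finally show "exp (\<theta>0 / N * w i) \<le> 1 + \<theta>1 / N * cosh (x i)" by (simp add: y_def)
  qed auto
  finally show ?thesis .
qed

lemma \<theta>1_pos: "0 < \<theta>1" using e_pos by (simp add: \<theta>1_def \<theta>0_def)

lemma J_exp_hh_le: "J x * exp (2 * hh x) \<le> (\<Prod>i\<in>Ix. (1 + \<theta>1 / N * cosh (x i)))"
proof (cases "gmap x \<in> U_region m n \<tau>")
  case True
  then show ?thesis using exp_hh_le by (simp add: J_def)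
next
  case False
  then show ?thesis using \<theta>1_pos N_pos by (auto simp: J_def intro!: prod_nonneg add_nonneg_nonneg)
qed

lemma hh_measurable [measurable]: "hh \<in> borel_measurable (lebPi Ix)"
  and ff_measurable [measurable]: "ff \<in> borel_measurable (lebPi Ix)"
  by (rule tame_measurable; simp)+

lemma tame_J_exp_hh: "tame (\<lambda>x. J x * exp (2 * hh x))"
proof (rule tame_dominated)
  show "tame (\<lambda>x. \<Prod>i\<in>Ix. (1 + \<theta>1 / N * cosh (x i)))"
    using \<theta>1_pos N_pos by (intro E_prod_cosh_le) auto
  show "\<bar>J x * exp (2 * hh x)\<bar> \<le> (\<Prod>i\<in>Ix. (1 + \<theta>1 / N * cosh (x i)))" for x
    using J_exp_hh_le[of x] J_cases(2)[of x] by simp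
qed measurable

lemma E_J_exp_hh_le: "E (\<lambda>x. J x * exp (2 * hh x)) \<le> M2"
proof -
  have "E (\<lambda>x. J x * exp (2 * hh x)) \<le> E (\<lambda>x. \<Prod>i\<in>Ix. (1 + \<theta>1 / N * cosh (x i)))"
    using \<theta>1_pos N_pos J_exp_hh_le by (intro E_mono tame_J_exp_hh E_prod_cosh_le) auto
  also have "\<dots> \<le> exp (real (card Ix) * (\<theta>1 / N * exp (1 / (2 * \<kappa>x))))"
    using \<theta>1_pos N_pos by (intro E_prod_cosh_le) auto
  also have "\<dots> = M2" using N_pos by (simp add: card_Ix M2_def)
  finally show ?thesis .
qed

definition V4 :: real where "V4 = 200 * e ^ 4 * 20 ^ 5"

text \<open>At most N^2 edges contribute N^(-5/2) L^5 each. The constant is 200 = 150/24 * 32, with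
  150 from the coefficient bounds, 24 from Taylor's theorem and 32 from the fifth power of
  \<open>2 * L\<close>; \<open>20 ^ 5\<close> comes from \<open>L5_le\<close>.\<close>

lemma rem_le:
  assumes "gmap x \<in> U_region m n \<tau>"
  shows "cmod (rem x) \<le> V4 * q"
proof -
  have "cmod (rem x) \<le> (\<Sum>j=1..m. \<Sum>k=1..n. 25 / 4 * (e ^ 4 * r ^ 5) * (32 * L ^ 5))"
    unfolding taylor_rem_def case_prod_unfold
  proof (intro order_trans[OF norm_sum] sum_mono)
    fix j k assume jk: "j \<in> {1..m}" "k \<in> {1..n}"
    let ?x = "fst (gmap x) j + snd (gmap x) k"
    note B = Z_bounds[OF jk]
    have "cmod (geom_cgf (Z j k) (of_real ?x) - cgf_taylor (Z j k) ?x)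
      \<le> Z j k * (1 + Z j k) * (1 + 2 * Z j k) * (1 + 12 * Z j k + 12 * (Z j k)\<^sup>2) * \<bar>?x\<bar> ^ 5 / 24"
      using B by (intro geom_cgf_taylor) auto
    also have "\<dots> = Z j k * (1 + Z j k) * (1 + 2 * Z j k) * (1 + 12 * Z j k + 12 * (Z j k)\<^sup>2) / 24 * (b ^ 5 * \<bar>lin (vx (j, k)) x\<bar> ^ 5)"
      unfolding gmap_sum[OF jk] using b_pos by (simp add: abs_mult power_mult_distrib)
    also have "\<dots> \<le> 25 / 4 * (e ^ 4 * \<tau> ^ 5) * (b ^ 5 * (2 * L) ^ 5)"
    proof (rule mult_mono)
      have "Z j k * (1 + Z j k) * (1 + 2 * Z j k) * (1 + 12 * Z j k + 12 * (Z j k)\<^sup>2) \<le> \<tau> * (2 * e * \<tau>) * (3 * e * \<tau>) * (25 * e\<^sup>2 * \<tau>\<^sup>2)"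
        using B \<tau>_pos e_pos by (intro mult_mono) (auto simp: add.commute)
      also have "\<dots> = 150 * (e ^ 4 * \<tau> ^ 5)" by (simp add: power2_eq_square power_numeral_reduce)
      finally show "Z j k * (1 + Z j k) * (1 + 2 * Z j k) * (1 + 12 * Z j k + 12 * (Z j k)\<^sup>2) / 24 \<le> 25 / 4 * (e ^ 4 * \<tau> ^ 5)" by simp
      show "b ^ 5 * \<bar>lin (vx (j, k)) x\<bar> ^ 5 \<le> b ^ 5 * (2 * L) ^ 5"
        using b_pos U_lin_le[OF assms jk] by (intro mult_left_mono power_mono) auto
    qed (use B b_pos e_pos \<tau>_pos in auto)
    also have "\<dots> = 25 / 4 * (e ^ 4 * r ^ 5) * (32 * L ^ 5)"
      using \<tau>_pos by (simp add: b_eq power_divide power_mult_distrib)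
    finally show "cmod (geom_cgf (Z j k) (of_real ?x) - cgf_taylor (Z j k) ?x) \<le> 25 / 4 * (e ^ 4 * r ^ 5) * (32 * L ^ 5)" .
  qed
  also have "\<dots> = (real m * real n) * (200 * (e ^ 4 * r ^ 5) * L ^ 5)" by simp
  also have "\<dots> \<le> N\<^sup>2 * (200 * (e ^ 4 * r ^ 5) * L ^ 5)"
    using card_A_le e_pos r_pos L_pos by (intro mult_right_mono) auto
  also have "\<dots> = 200 * e ^ 4 * ((N\<^sup>2 * r ^ 4) * (L ^ 5 * r))"
  proof -
    have "r ^ 5 = r ^ 4 * r" by (simp add: power_numeral_reduce)
    then show ?thesis by (simp only: mult_ac)
  qed
  also have "N\<^sup>2 * r ^ 4 = 1" using N_pos by (simp add: r_powers)
  also have "200 * e ^ 4 * (1 * (L ^ 5 * r)) \<le> 200 * e ^ 4 * (20 ^ 5 * q)"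
    using L5_le e_pos by (intro mult_left_mono) auto
  finally show ?thesis by (simp only: V4_def mult.assoc)
qed

end

section \<open>The main theorem\<close>

context margins
begin

text \<open>\<open>CD\<close> bounds the error on the region, \<open>CA\<close> adds the complement,
  and \<open>CB\<close> adds the error of the characteristic function, which only the oscillating
  integral has.\<close>

definition CD :: real where "CD = V2 + V4\<^sup>2 + exp (2 * M\<nu>) + exp (2 * V4) * M2"
definition CA :: real where "CA = CD + exp M\<nu> * V3"
definition CB :: real where "CB = CA + 2 * exp M\<nu> * sqrt V1"

lemma V4_nonneg: "0 \<le> V4" and M2_nonneg: "0 \<le> M2" and V3_nonneg: "0 \<le> V3"
  using e_pos by (auto simp: V4_def M2_def V3_def)

lemma CA_le_CB: "CA \<le> CB" using V_nonneg by (simp add: CB_def)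

abbreviation \<nu> :: real where "\<nu> \<equiv> nu m n Z"
abbreviation \<mu> :: real where "\<mu> \<equiv> mu m n Z"

text \<open>On the region this dominates the error of replacing exp(h + remainder) by exp(\<nu>),
  through \<open>norm_exp_diff_le\<close>.\<close>

definition dev :: "(nat + nat \<Rightarrow> real) \<Rightarrow> real" where
  "dev x = J x * ((\<bar>hh x - \<nu>\<bar> + V4 * q) * (exp \<nu> + exp V4 * exp (hh x)))"

lemma dev_nonneg: "0 \<le> dev x"
  using J_cases(2)[of x] V4_nonneg q_pos by (auto simp: dev_def)

text \<open>Young's inequality with weight q: the factor 1/q is paid by the variance of
  \<open>hh\<close>, which is O(q^4), while the exponential moment, merely bounded, is multiplied by
  q.\<close>

lemma dev_le: "dev x \<le> 1 / q * (hh x - \<nu>)\<^sup>2 + V4\<^sup>2 * q + q * exp (2 * M\<nu>) + q * exp (2 * V4) * (J x * exp (2 * hh x))"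
proof -
  define a where "a = \<bar>hh x - \<nu>\<bar> + V4 * q"
  define c where "c = exp \<nu> + exp V4 * exp (hh x)"
  have "(u + w)\<^sup>2 \<le> 2 * u\<^sup>2 + 2 * w\<^sup>2" for u w :: real
    using sum_squares_bound[of u w] by (simp add: power2_sum)
  note sq = this
  have a2: "a\<^sup>2 \<le> 2 * (hh x - \<nu>)\<^sup>2 + 2 * (V4\<^sup>2 * q\<^sup>2)"
    using sq[of "\<bar>hh x - \<nu>\<bar>" "V4 * q"] by (simp add: a_def power_mult_distrib)
  have c2: "c\<^sup>2 \<le> 2 * exp (2 * M\<nu>) + 2 * (exp (2 * V4) * exp (2 * hh x))"
  proof -
    have "c\<^sup>2 \<le> 2 * (exp \<nu>)\<^sup>2 + 2 * (exp V4 * exp (hh x))\<^sup>2" unfolding c_def by (rule sq)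
    also have "(exp \<nu>)\<^sup>2 = exp (2 * \<nu>)" by (simp add: exp_double)
    also have "exp (2 * \<nu>) \<le> exp (2 * M\<nu>)" using nu_bounds by simp
    also have "(exp V4 * exp (hh x))\<^sup>2 = exp (2 * V4) * exp (2 * hh x)" by (simp add: power_mult_distrib exp_double)
    finally show ?thesis by simp
  qed
  have "a * c \<le> (a\<^sup>2 / q + q * c\<^sup>2) / 2"
  proof -
    have "0 \<le> (a - q * c)\<^sup>2 / q" using q_pos by simp
    also have "(a - q * c)\<^sup>2 / q = a\<^sup>2 / q - 2 * (a * c) + q * c\<^sup>2"
      using q_pos by (simp add: power2_diff field_simps power2_eq_square)
    finally show ?thesis by simp
  qed
  also have "a\<^sup>2 / q \<le> (2 * (hh x - \<nu>)\<^sup>2 + 2 * (V4\<^sup>2 * q\<^sup>2)) / q"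
    using a2 q_pos by (intro divide_right_mono) auto
  also have "q * c\<^sup>2 \<le> q * (2 * exp (2 * M\<nu>) + 2 * (exp (2 * V4) * exp (2 * hh x)))"
    using c2 q_pos by (intro mult_left_mono) auto
  also have "((2 * (hh x - \<nu>)\<^sup>2 + 2 * (V4\<^sup>2 * q\<^sup>2)) / q + q * (2 * exp (2 * M\<nu>) + 2 * (exp (2 * V4) * exp (2 * hh x)))) / 2
     = 1 / q * (hh x - \<nu>)\<^sup>2 + V4\<^sup>2 * q + q * exp (2 * M\<nu>) + q * exp (2 * V4) * exp (2 * hh x)"
    using q_pos by (simp add: field_simps power2_eq_square)
  finally have ac: "a * c \<le> 1 / q * (hh x - \<nu>)\<^sup>2 + V4\<^sup>2 * q + q * exp (2 * M\<nu>) + q * exp (2 * V4) * exp (2 * hh x)"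
    by simp
  show ?thesis
  proof (cases "J x = 0")
    case True
    then show ?thesis using q_pos by (simp add: dev_def)
  next
    case False
    then have "J x = 1" using J_cases(1)[of x] by simp
    then show ?thesis using ac by (simp add: dev_def a_def c_def)
  qed
qed

lemma tame_dev_bound: "tame (\<lambda>x. 1 / q * (hh x - \<nu>)\<^sup>2 + V4\<^sup>2 * q + q * exp (2 * M\<nu>) + q * exp (2 * V4) * (J x * exp (2 * hh x)))"
  by (rule tame_add[OF tame_add[OF tame_add[OF tame_mult[OF tame_const tame_power[OF tame_diff[OF fam.tame_quartic tame_const]]]
      tame_const] tame_const] tame_mult[OF tame_const tame_J_exp_hh]])

lemma tame_dev: "tame dev"
proof (rule tame_dominated[OF _ tame_dev_bound])
  show "dev \<in> borel_measurable (lebPi Ix)" unfolding dev_def[abs_def] by measurable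
  show "\<bar>dev x\<bar> \<le> 1 / q * (hh x - \<nu>)\<^sup>2 + V4\<^sup>2 * q + q * exp (2 * M\<nu>) + q * exp (2 * V4) * (J x * exp (2 * hh x))" for x
    using dev_le[of x] dev_nonneg[of x] by simp
qed

lemma E_dev_le: "E dev \<le> CD * q"
proof -
  have "E dev \<le> E (\<lambda>x. 1 / q * (hh x - \<nu>)\<^sup>2 + V4\<^sup>2 * q + q * exp (2 * M\<nu>) + q * exp (2 * V4) * (J x * exp (2 * hh x)))"
    by (rule E_mono[OF tame_dev tame_dev_bound dev_le])
  also have "\<dots> = 1 / q * E (\<lambda>x. (hh x - \<nu>)\<^sup>2) + V4\<^sup>2 * q + q * exp (2 * M\<nu>) + q * exp (2 * V4) * E (\<lambda>x. J x * exp (2 * hh x))"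
    using tame_J_exp_hh by (simp add: integrable_P prob_space[unfolded space_P])
  also have "\<dots> \<le> 1 / q * (V2 / N) + V4\<^sup>2 * q + q * exp (2 * M\<nu>) + q * exp (2 * V4) * M2"
    using q_pos quartic_variance E_J_exp_hh_le by (intro add_mono mult_left_mono order_refl) auto
  finally have main: "E dev \<le> 1 / q * (V2 / N) + V4\<^sup>2 * q + q * exp (2 * M\<nu>) + q * exp (2 * V4) * M2" .
  have "1 / q * (V2 / N) = V2 * q ^ 3"
  proof -
    have e: "1 / N = q ^ 3 * q" using q4 power_Suc2[of q 3] by simp
    have "1 / q * (V2 / N) = 1 / q * (V2 * (1 / N))" by simp
    then show ?thesis unfolding e using q_pos by simp
  qed
  moreover have "V2 * q ^ 3 \<le> V2 * q"
    using V_nonneg power_decreasing[of 1 3 q] q_pos q_le_1 by (intro mult_left_mono) auto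
  ultimately show ?thesis using main by (simp add: CD_def algebra_simps)
qed

lemma E_deviation_le: "E (\<lambda>x. dev x + exp \<nu> * (1 - J x)) \<le> CA * q"
proof -
  have "E (\<lambda>x. dev x + exp \<nu> * (1 - J x)) = E dev + exp \<nu> * E (\<lambda>x. 1 - J x)"
    using tame_dev by (simp add: integrable_P)
  moreover have "exp \<nu> * E (\<lambda>x. 1 - J x) \<le> exp M\<nu> * (V3 * q)"
    using nu_bounds E_not_J_le J_cases(3) V3_nonneg q_pos
    by (intro mult_mono) (auto intro!: Bochner_Integration.integral_nonneg)
  moreover have "E dev \<le> CD * q" by (rule E_dev_le)
  ultimately show ?thesis by (simp add: CA_def algebra_simps)
qed

text \<open>The integrand divided by its Gaussian factor exp(-q), in scaled coordinates.\<close>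

definition gg :: "(nat + nat \<Rightarrow> real) \<Rightarrow> complex" where
  "gg x = exp (of_real (hh x) - \<i> * of_real (ff x) + rem x)"

text \<open>The phase exp(-i f) has modulus one and factors out of the first difference, so one
  estimate of exponentials serves both. Off the region the error is exp(\<nu>) itself.\<close>

lemma gg_diff_le: "cmod (J x *\<^sub>R gg x - of_real (exp \<nu>) * exp (- \<i> * of_real (ff x))) \<le> dev x + exp \<nu> * (1 - J x)"
  and abs_gg_diff_le: "\<bar>J x * cmod (gg x) - exp \<nu>\<bar> \<le> dev x + exp \<nu> * (1 - J x)"
proof -
  consider "J x = 0" | "J x = 1" "gmap x \<in> U_region m n \<tau>" by (auto simp: J_def indicator_def)
  then have "cmod (J x *\<^sub>R gg x - of_real (exp \<nu>) * exp (- \<i> * of_real (ff x))) \<le> dev x + exp \<nu> * (1 - J x)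
    \<and> \<bar>J x * cmod (gg x) - exp \<nu>\<bar> \<le> dev x + exp \<nu> * (1 - J x)"
  proof cases
    case 1
    then show ?thesis using dev_nonneg[of x] by (simp add: norm_mult)
  next
    case 2
    have rem: "cmod (rem x) \<le> V4 * q" by (rule rem_le[OF 2(2)])
    also have "\<dots> \<le> V4 * 1" using V4_nonneg q_le_1 by (intro mult_left_mono) auto
    finally have rem1: "cmod (rem x) \<le> V4" by simp
    have Re1: "\<bar>Re (rem x)\<bar> \<le> V4" and Re2: "\<bar>Re (rem x)\<bar> \<le> V4 * q"
      using rem rem1 abs_Re_le_cmod[of "rem x"] by linarith+
    have e1: "exp (hh x + Re (rem x)) \<le> exp V4 * exp (hh x)"
      using Re1 by (simp add: exp_add[symmetric])
    have bnd: "cmod (exp z - exp (of_real \<nu>)) \<le> dev x"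
      if "cmod (z - of_real (hh x)) \<le> V4 * q" "Re z = hh x + Re (rem x)" for z
    proof -
      have "cmod (z - of_real \<nu>) \<le> \<bar>hh x - \<nu>\<bar> + V4 * q"
      proof -
        have "z - of_real \<nu> = of_real (hh x - \<nu>) + (z - of_real (hh x))" by simp
        then have "cmod (z - of_real \<nu>) \<le> cmod (of_real (hh x - \<nu>)) + cmod (z - of_real (hh x))"
          by (simp only: norm_triangle_ineq)
        then show ?thesis using that(1) by (simp only: norm_of_real)
      qed
      moreover have "exp \<nu> + exp (Re z) \<le> exp \<nu> + exp V4 * exp (hh x)" using e1 that(2) by simp
      ultimately have "cmod (z - of_real \<nu>) * (exp \<nu> + exp (Re z)) \<le> dev x"
        unfolding dev_def 2(1) mult_1 using V4_nonneg q_pos by (intro mult_mono) auto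
      then show ?thesis using norm_exp_diff_le[of z \<nu>] by linarith
    qed
    have A: "cmod (J x *\<^sub>R gg x - of_real (exp \<nu>) * exp (- \<i> * of_real (ff x))) \<le> dev x"
    proof -
      have eq: "J x *\<^sub>R gg x - of_real (exp \<nu>) * exp (- \<i> * of_real (ff x)) =
          exp (- \<i> * of_real (ff x)) * (exp (of_real (hh x) + rem x) - exp (of_real \<nu>))"
        unfolding gg_def right_diff_distrib exp_add[symmetric] exp_of_real[symmetric] by (simp add: 2 algebra_simps)
      have "cmod (exp (of_real (hh x) + rem x) - exp (of_real \<nu>)) \<le> dev x"
        by (rule bnd) (use rem in auto)
      then show ?thesis unfolding eq by (simp add: norm_mult)
    qed
    have B: "\<bar>J x * cmod (gg x) - exp \<nu>\<bar> \<le> dev x"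
    proof -
      have "cmod (gg x) = exp (hh x + Re (rem x))" by (simp add: gg_def)
      then have "\<bar>J x * cmod (gg x) - exp \<nu>\<bar> = cmod (of_real (exp (hh x + Re (rem x)) - exp \<nu>))"
        unfolding norm_of_real by (simp add: 2)
      also have "\<dots> = cmod (exp (of_real (hh x + Re (rem x))) - exp (of_real \<nu>))"
        unfolding exp_of_real of_real_diff ..
      also have "\<dots> \<le> dev x"
      proof (rule bnd)
        have "cmod (of_real (hh x + Re (rem x)) - of_real (hh x)) = \<bar>Re (rem x)\<bar>"
          by (simp add: norm_of_real)
        then show "cmod (of_real (hh x + Re (rem x)) - of_real (hh x)) \<le> V4 * q" using Re2 by simp
      qed simp
      finally show ?thesis .
    qed
    show ?thesis using A B by (simp add: 2)
  qed
  then show "cmod (J x *\<^sub>R gg x - of_real (exp \<nu>) * exp (- \<i> * of_real (ff x))) \<le> dev x + exp \<nu> * (1 - J x)"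
    "\<bar>J x * cmod (gg x) - exp \<nu>\<bar> \<le> dev x + exp \<nu> * (1 - J x)" by auto
qed

lemma cos_sin_estimate: "cmod ((LINT x|P. exp (- \<i> * of_real (ff x))) - of_real (exp (- \<mu> / 2))) \<le> 2 * sqrt V1 * q"
proof -
  have tc: "tame (\<lambda>x. cos (ff x))" and ts: "tame (\<lambda>x. sin (ff x))"
    by (auto intro!: tame_bounded[where b = 1])
  have "exp (- \<i> * of_real t) = complex_of_real (cos t) - \<i> * of_real (sin t)" for t
    by (simp add: complex_eq_iff Re_exp Im_exp)
  then have "(LINT x|P. exp (- \<i> * of_real (ff x))) = (LINT x|P. complex_of_real (cos (ff x)) - \<i> * of_real (sin (ff x)))"
    by (simp only:)
  also have "\<dots> = of_real (E (\<lambda>x. cos (ff x))) - \<i> * of_real (E (\<lambda>x. sin (ff x)))"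
    using tc ts by (subst Bochner_Integration.integral_diff) (auto intro!: integrable_P integrable_mult_right integrable_of_real)
  finally have eq: "(LINT x|P. exp (- \<i> * of_real (ff x))) = of_real (E (\<lambda>x. cos (ff x))) - \<i> * of_real (E (\<lambda>x. sin (ff x)))" .
  have "cmod ((LINT x|P. exp (- \<i> * of_real (ff x))) - of_real (exp (- \<mu> / 2)))
     = cmod (of_real (E (\<lambda>x. cos (ff x)) - exp (- \<mu> / 2)) - \<i> * of_real (E (\<lambda>x. sin (ff x))))"
    unfolding eq by (simp add: algebra_simps)
  also have "\<dots> \<le> cmod (of_real (E (\<lambda>x. cos (ff x)) - exp (- \<mu> / 2))) + cmod (\<i> * of_real (E (\<lambda>x. sin (ff x))))"
    by (rule norm_triangle_ineq4)
  also have "\<dots> = \<bar>E (\<lambda>x. cos (ff x)) - exp (- \<mu> / 2)\<bar> + \<bar>E (\<lambda>x. sin (ff x))\<bar>"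
    by (simp only: norm_mult norm_of_real) simp
  also have "\<dots> \<le> sqrt (V1 / N) + sqrt (V1 / N)"
    using fam.characteristic_function_cubic[of cf] stein_deviation unfolding mu_eq by (intro add_mono) linarith+
  also have "\<dots> = 2 * sqrt V1 * q\<^sup>2"
    using sqrt_inverse_N real_sqrt_mult[of V1 "1 / N"] by simp
  also have "\<dots> \<le> 2 * sqrt V1 * q"
    using V_nonneg power_decreasing[of 1 2 q] q_pos q_le_1 by (intro mult_left_mono) auto
  finally show ?thesis .
qed

text \<open>In the oscillating integral, exp(h + remainder) is first replaced by exp(\<nu>) under
  the expectation with the phase kept; only then is the mean of the phase compared with
  exp(-\<mu>/2). No independence of f and h is involved: h is nearly constant. For the modulus the
  first step suffices.\<close>

lemma main_estimates:
  assumes R: "\<And>j. j \<in> {1..m} \<Longrightarrow> (\<Sum>k=1..n. Z j k) = real (R j)"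
    and C: "\<And>k. k \<in> {1..n} \<Longrightarrow> (\<Sum>j=1..m. Z j k) = real (C k)"
  shows "cmod ((LINT p:U_region m n \<tau>|hyperplane_lebesgue m n. F_integrand m n R C Z p)
                - of_real (exp (- \<mu> / 2 + \<nu>) * Xi m n Z)) \<le> CB * q * Xi m n Z"
    and "\<bar>(LINT p:U_region m n \<tau>|hyperplane_lebesgue m n. cmod (F_integrand m n R C Z p))
                - exp \<nu> * Xi m n Z\<bar> \<le> CA * q * Xi m n Z"
proof -
  let ?F = "F_integrand m n R C Z" and ?U = "U_region m n \<tau>"
  have FM: "?F \<in> borel_measurable (lebPair m n)" by (rule measurable_F_integrand)
  have FMr: "(\<lambda>p. cmod (?F p)) \<in> borel_measurable (lebPair m n)"
    by (rule measurable_compose[OF FM borel_measurable_norm])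
  have UM: "?U \<in> sets (lebPair m n)" by (rule sets_U_region[OF m1 n1])
  have Fg: "exp (q_form m n Z (gmap x)) *\<^sub>R ?F (gmap x) = gg x" for x
  proof -
    have "?F (gmap x) = exp (of_real (- q_form m n Z (gmap x) + h_form m n Z (gmap x)) - \<i> * of_real (f_form m n Z (gmap x)) + rem x)"
      by (rule F_integrand_expansion) (use Z_pos R C in \<open>auto intro: less_imp_le\<close>)
    then show ?thesis
      unfolding gg_def h_form_gmap[symmetric] f_form_gmap[symmetric] scaleR_conv_of_real exp_of_real[symmetric]
      by (simp add: exp_add[symmetric] algebra_simps)
  qed
  have mgg: "gg \<in> borel_measurable (lebPi Ix)"
  proof -
    have "(\<lambda>x. ?F (gmap x)) \<in> borel_measurable (lebPi Ix)" by (rule measurable_compose[OF measurable_gmap FM])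
    moreover have "(\<lambda>x. q_form m n Z (gmap x)) \<in> borel_measurable (lebPi Ix)" by (rule measurable_compose[OF measurable_gmap measurable_q_form])
    ultimately have "(\<lambda>x. exp (q_form m n Z (gmap x)) *\<^sub>R ?F (gmap x)) \<in> borel_measurable (lebPi Ix)"
      by (intro borel_measurable_scaleR borel_measurable_exp) auto
    then show ?thesis unfolding Fg .
  qed
  have mggP: "gg \<in> borel_measurable P" using mgg by (simp add: measurable_cong_sets[OF sets_P refl])
  have I1: "(LINT p:?U|hyperplane_lebesgue m n. ?F p) = Xi m n Z *\<^sub>R (LINT x|P. J x *\<^sub>R gg x)"
    unfolding set_lebesgue_integral_def
  proof (subst integral_hyperplane)
    show "(\<lambda>p. indicat_real ?U p *\<^sub>R ?F p) \<in> borel_measurable (lebPair m n)"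
      using FM UM by (intro borel_measurable_scaleR borel_measurable_indicator)
    show "Xi m n Z *\<^sub>R (LINT x|P. exp (q_form m n Z (gmap x)) *\<^sub>R indicat_real ?U (gmap x) *\<^sub>R ?F (gmap x)) = Xi m n Z *\<^sub>R (LINT x|P. J x *\<^sub>R gg x)"
      unfolding Fg[symmetric] J_def by (simp add: mult.commute)
  qed
  have I2: "(LINT p:?U|hyperplane_lebesgue m n. cmod (?F p)) = Xi m n Z *\<^sub>R E (\<lambda>x. J x * cmod (gg x))"
    unfolding set_lebesgue_integral_def
  proof (subst integral_hyperplane)
    show "(\<lambda>p. indicat_real ?U p *\<^sub>R cmod (?F p)) \<in> borel_measurable (lebPair m n)"
      using FMr UM by (intro borel_measurable_scaleR borel_measurable_indicator)
    show "Xi m n Z *\<^sub>R (LINT x|P. exp (q_form m n Z (gmap x)) *\<^sub>R indicat_real ?U (gmap x) *\<^sub>R cmod (?F (gmap x))) = Xi m n Z *\<^sub>R E (\<lambda>x. J x * cmod (gg x))"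
      unfolding Fg[symmetric] J_def by (simp add: mult_ac)
  qed
  let ?t = "\<lambda>x. dev x + exp \<nu> * (1 - J x)"
  have tt: "tame ?t" using tame_dev by auto
  have tA: "tame (\<lambda>x. J x * cmod (gg x))"
  proof (rule tame_dominated[of _ "\<lambda>x. exp \<nu> + ?t x"])
    show "(\<lambda>x. J x * cmod (gg x)) \<in> borel_measurable (lebPi Ix)"
      by (intro borel_measurable_times J_measurable measurable_compose[OF mgg borel_measurable_norm])
    show "\<bar>J x * cmod (gg x)\<bar> \<le> exp \<nu> + ?t x" for x using abs_gg_diff_le[of x] exp_gt_zero[of \<nu>] by linarith
  qed (use tt in auto)
  have "\<bar>E (\<lambda>x. J x * cmod (gg x)) - exp \<nu>\<bar> = \<bar>E (\<lambda>x. J x * cmod (gg x) - exp \<nu>)\<bar>"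
    using tA by (simp add: integrable_P prob_space[unfolded space_P])
  also have "\<dots> \<le> E (\<lambda>x. \<bar>J x * cmod (gg x) - exp \<nu>\<bar>)" by (rule integral_abs_bound)
  also have "\<dots> \<le> E ?t" using tA tt by (intro E_mono abs_gg_diff_le) auto
  also have "\<dots> \<le> CA * q" by (rule E_deviation_le)
  finally have A: "\<bar>E (\<lambda>x. J x * cmod (gg x)) - exp \<nu>\<bar> \<le> CA * q" .
  have "\<bar>(LINT p:?U|hyperplane_lebesgue m n. cmod (?F p)) - exp \<nu> * Xi m n Z\<bar> = \<bar>E (\<lambda>x. J x * cmod (gg x)) - exp \<nu>\<bar> * Xi m n Z"
  proof -
    have "Xi m n Z *\<^sub>R u - w * Xi m n Z = (u - w) * Xi m n Z" for u w :: real by (simp add: algebra_simps)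
    then show ?thesis unfolding I2 using Xi_pos by (simp only: abs_mult)
  qed
  also have "\<dots> \<le> CA * q * Xi m n Z" using A Xi_pos by (intro mult_right_mono) auto
  finally show "\<bar>(LINT p:?U|hyperplane_lebesgue m n. cmod (?F p)) - exp \<nu> * Xi m n Z\<bar> \<le> CA * q * Xi m n Z" .
  have iJ: "integrable P (\<lambda>x. J x *\<^sub>R gg x)"
  proof (rule Bochner_Integration.integrable_bound[OF integrable_P[OF tA]])
    show "(\<lambda>x. J x *\<^sub>R gg x) \<in> borel_measurable P"
      using mggP J_measurable by (intro borel_measurable_scaleR) (auto simp: measurable_cong_sets[OF sets_P refl])
    show "AE x in P. norm (J x *\<^sub>R gg x) \<le> norm (J x * cmod (gg x))"
      by (auto simp: abs_mult)
  qed
  have ie: "integrable P (\<lambda>x. exp (- \<i> * of_real (ff x)))"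
  proof (rule Bochner_Integration.integrable_bound[OF integrable_P[OF tame_const[of 1]]])
    have "ff \<in> borel_measurable P" using ff_measurable by (simp add: measurable_cong_sets[OF sets_P refl])
    then show "(\<lambda>x. exp (- \<i> * complex_of_real (ff x))) \<in> borel_measurable P" by measurable
  qed auto
  define e0 where "e0 = (LINT x|P. exp (- \<i> * of_real (ff x)))"
  have "cmod ((LINT x|P. J x *\<^sub>R gg x) - of_real (exp \<nu>) * e0) = cmod (LINT x|P. J x *\<^sub>R gg x - of_real (exp \<nu>) * exp (- \<i> * of_real (ff x)))"
    unfolding e0_def using iJ ie by simp
  also have "\<dots> \<le> E (\<lambda>x. cmod (J x *\<^sub>R gg x - of_real (exp \<nu>) * exp (- \<i> * of_real (ff x))))"
    by (rule integral_norm_bound)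
  also have "\<dots> \<le> E ?t"
    by (intro integral_mono integrable_norm Bochner_Integration.integrable_diff iJ integrable_mult_right ie integrable_P tt gg_diff_le)
  also have "\<dots> \<le> CA * q" by (rule E_deviation_le)
  finally have B1: "cmod ((LINT x|P. J x *\<^sub>R gg x) - of_real (exp \<nu>) * e0) \<le> CA * q" .
  have "cmod (of_real (exp \<nu>) * (e0 - of_real (exp (- \<mu> / 2)))) \<le> exp M\<nu> * (2 * sqrt V1 * q)"
    unfolding norm_mult using cos_sin_estimate nu_bounds by (intro mult_mono) (auto simp: e0_def)
  then have B2: "cmod (of_real (exp \<nu>) * e0 - of_real (exp (- \<mu> / 2 + \<nu>))) \<le> 2 * exp M\<nu> * sqrt V1 * q"
    by (simp only: exp_add of_real_mult right_diff_distrib mult_ac)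
  have "cmod ((LINT x|P. J x *\<^sub>R gg x) - of_real (exp (- \<mu> / 2 + \<nu>))) \<le> CA * q + 2 * exp M\<nu> * sqrt V1 * q"
    using norm_triangle_ineq[of "(LINT x|P. J x *\<^sub>R gg x) - of_real (exp \<nu>) * e0" "of_real (exp \<nu>) * e0 - of_real (exp (- \<mu> / 2 + \<nu>))"] B1 B2
    by simp
  then have B: "cmod ((LINT x|P. J x *\<^sub>R gg x) - of_real (exp (- \<mu> / 2 + \<nu>))) \<le> CB * q"
    by (simp add: CB_def algebra_simps)
  have "(LINT p:?U|hyperplane_lebesgue m n. ?F p) - of_real (exp (- \<mu> / 2 + \<nu>) * Xi m n Z) =
      Xi m n Z *\<^sub>R ((LINT x|P. J x *\<^sub>R gg x) - of_real (exp (- \<mu> / 2 + \<nu>)))"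
    unfolding I1 by (simp add: scaleR_conv_of_real algebra_simps)
  then have "cmod ((LINT p:?U|hyperplane_lebesgue m n. ?F p) - of_real (exp (- \<mu> / 2 + \<nu>) * Xi m n Z)) =
      Xi m n Z * cmod ((LINT x|P. J x *\<^sub>R gg x) - of_real (exp (- \<mu> / 2 + \<nu>)))"
    using Xi_pos by simp
  also have "\<dots> \<le> Xi m n Z * (CB * q)" using B Xi_pos by (intro mult_left_mono) auto
  finally show "cmod ((LINT p:?U|hyperplane_lebesgue m n. ?F p) - of_real (exp (- \<mu> / 2 + \<nu>) * Xi m n Z)) \<le> CB * q * Xi m n Z"
    by (simp add: mult_ac)
qed

text \<open>Since \<epsilon> \<le> 1/2, raising \<epsilon> to the power log_2 B gives at most 1/B,
  so a constant factor is absorbed by a larger exponent. The factor 4 in the condition on \<gamma>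
  undoes the rate N^(-1/4).\<close>

lemma q_small:
  assumes \<epsilon>: "0 < \<epsilon>" "\<epsilon> \<le> 1 / 2" and B: "1 \<le> B" and \<gamma>: "4 * (1 + log 2 B) \<le> \<gamma>"
    and N: "(1 / \<epsilon>) powr \<gamma> \<le> N"
  shows "B * q \<le> \<epsilon>"
proof -
  have l0: "0 \<le> log 2 B" using B by simp
  have "q \<le> ((1 / \<epsilon>) powr \<gamma>) powr (- 1 / 4)"
    unfolding q_def using N \<epsilon> by (intro powr_mono2') auto
  also have "\<dots> = \<epsilon> powr (\<gamma> / 4)"
    unfolding powr_neg_one[OF \<epsilon>(1), symmetric] powr_powr by simp
  also have "\<dots> \<le> \<epsilon> powr (1 + log 2 B)"
    using \<epsilon> \<gamma> by (intro powr_mono') auto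
  also have "\<dots> = \<epsilon> * \<epsilon> powr (log 2 B)" using \<epsilon> by (simp add: powr_add)
  also have "\<dots> \<le> \<epsilon> * (1 / 2) powr (log 2 B)"
    using \<epsilon> l0 by (intro mult_left_mono powr_mono2) auto
  also have "(1 / 2) powr (log 2 B) = 1 / B" using B by (simp add: powr_divide)
  finally have "B * q \<le> B * (\<epsilon> * (1 / B))" using B by (intro mult_left_mono) auto
  then show ?thesis using B by simp
qed

end

theorem theorem6p1:
  fixes \<delta> :: real
  assumes "0 < \<delta>" and "\<delta> < 1"
  shows "\<exists>\<gamma>::real. \<gamma> > 0 \<and>
    (\<forall>(m::nat) (n::nat) (R :: nat \<Rightarrow> nat) (C :: nat \<Rightarrow> nat) (Z :: nat \<Rightarrow> nat \<Rightarrow> real) (\<tau>::real).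
      1 \<le> m \<longrightarrow> 1 \<le> n \<longrightarrow>
      (\<forall>j\<in>{1..m}. 0 < R j) \<longrightarrow> (\<forall>k\<in>{1..n}. 0 < C k) \<longrightarrow>
      (\<Sum>j=1..m. R j) = (\<Sum>k=1..n. C k) \<longrightarrow>
      typical_matrix m n R C Z \<longrightarrow>
      real m \<ge> \<delta> * real n \<longrightarrow> real n \<ge> \<delta> * real m \<longrightarrow>
      \<tau> > \<delta> \<longrightarrow>
      (\<forall>j\<in>{1..m}. \<forall>k\<in>{1..n}. \<delta> * \<tau> \<le> Z j k \<and> Z j k \<le> \<tau>) \<longrightarrow>
        Xi m n Z \<ge> (2 * pi) powr ((real m + real n - 1) / 2) /
          (real m powr ((real n - 1) / 2) * real n powr ((real m - 1) / 2) *
           (\<tau> + \<tau>^2) powr ((real m + real n - 1) / 2)) \<and>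
        0 \<le> mu m n Z \<and> mu m n Z \<le> \<gamma> \<and> 0 \<le> nu m n Z \<and> nu m n Z \<le> \<gamma> \<and>
        (\<forall>\<epsilon>::real. 0 < \<epsilon> \<longrightarrow> \<epsilon> \<le> 1/2 \<longrightarrow> real (m + n) \<ge> (1 / \<epsilon>) powr \<gamma> \<longrightarrow>
          cmod ((LINT p:U_region m n \<tau>|hyperplane_lebesgue m n. F_integrand m n R C Z p)
                - of_real (exp (- mu m n Z / 2 + nu m n Z) * Xi m n Z)) \<le> \<epsilon> * Xi m n Z) \<and>
        (\<forall>\<epsilon>::real. 0 < \<epsilon> \<longrightarrow> \<epsilon> \<le> 1/2 \<longrightarrow> real (m + n) \<ge> (1 / \<epsilon>) powr \<gamma> \<longrightarrow>
          \<bar>(LINT p:U_region m n \<tau>|hyperplane_lebesgue m n. cmod (F_integrand m n R C Z p))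
                - exp (nu m n Z) * Xi m n Z\<bar> \<le> \<epsilon> * Xi m n Z))"
proof -
  \<comment> \<open>Seen from outside the locale, these constants take \<delta> as their only
    argument, which permits choosing \<gamma> before m, n, the margins and \<tau>. The maximum with
    1 keeps the logarithm of \<open>B\<close> nonnegative.\<close>
  define B where "B = max 1 (margins.CB \<delta>)"
  define \<gamma> where "\<gamma> = max (max 1 (4 * (1 + log 2 B))) (max (margins.M\<mu> \<delta>) (margins.M\<nu> \<delta>))"
  have B1: "1 \<le> B" by (simp add: B_def)
  have "max (max 1 u) (max v w) > 0 \<and> u \<le> max (max 1 u) (max v w) \<and> v \<le> max (max 1 u) (max v w) \<and> w \<le> max (max 1 u) (max v w)"
    for u v w :: real by linarith
  from this[of "4 * (1 + log 2 B)" "margins.M\<mu> \<delta>" "margins.M\<nu> \<delta>"]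
  have \<gamma>: "0 < \<gamma>" "4 * (1 + log 2 B) \<le> \<gamma>" "margins.M\<mu> \<delta> \<le> \<gamma>" "margins.M\<nu> \<delta> \<le> \<gamma>"
    unfolding \<gamma>_def by blast+
  show ?thesis
  proof (intro exI[of _ \<gamma>] conjI allI impI \<gamma>(1))
    fix m n :: nat and R C :: "nat \<Rightarrow> nat" and Z :: "nat \<Rightarrow> nat \<Rightarrow> real" and \<tau> :: real
    assume mn1: "1 \<le> m" "1 \<le> n" and tm: "typical_matrix m n R C Z"
      and mn: "\<delta> * real n \<le> real m" "\<delta> * real m \<le> real n" and \<tau>: "\<delta> < \<tau>"
      and Z: "\<forall>j\<in>{1..m}. \<forall>k\<in>{1..n}. \<delta> * \<tau> \<le> Z j k \<and> Z j k \<le> \<tau>"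
    interpret margins m n Z \<delta> \<tau>
      using assms mn1 mn \<tau> Z by unfold_locales auto
    have "Z \<in> transportation_polytope m n R C"
      using tm by (simp add: typical_matrix_def is_arg_max_def)
    then have RC: "\<And>j. j \<in> {1..m} \<Longrightarrow> (\<Sum>k=1..n. Z j k) = real (R j)"
        "\<And>k. k \<in> {1..n} \<Longrightarrow> (\<Sum>j=1..m. Z j k) = real (C k)"
      by (auto simp: transportation_polytope_def)
    note est = main_estimates[OF RC]
    show "(2 * pi) powr ((real m + real n - 1) / 2) /
          (real m powr ((real n - 1) / 2) * real n powr ((real m - 1) / 2) *
           (\<tau> + \<tau>^2) powr ((real m + real n - 1) / 2)) \<le> Xi m n Z"
      by (rule Xi_lower_bound)
    show "0 \<le> mu m n Z" "mu m n Z \<le> \<gamma>" "0 \<le> nu m n Z" "nu m n Z \<le> \<gamma>"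
      using mu_bounds nu_bounds \<gamma> by linarith+
    fix \<epsilon> :: real
    assume \<epsilon>: "0 < \<epsilon>" "\<epsilon> \<le> 1 / 2" and big: "(1 / \<epsilon>) powr \<gamma> \<le> real (m + n)"
    have Bq: "B * q \<le> \<epsilon>"
      using q_small[OF \<epsilon> B1 \<gamma>(2)] big by simp
    have "CB \<le> B" "CA \<le> B" using CA_le_CB by (auto simp: B_def)
    then have "CB * q \<le> \<epsilon>" "CA * q \<le> \<epsilon>"
      using Bq q_pos mult_right_mono[of CB B q] mult_right_mono[of CA B q] by linarith+
    then have le: "CB * q * Xi m n Z \<le> \<epsilon> * Xi m n Z" "CA * q * Xi m n Z \<le> \<epsilon> * Xi m n Z"
      using Xi_pos by (auto intro: mult_right_mono)
    show "cmod ((LINT p:U_region m n \<tau>|hyperplane_lebesgue m n. F_integrand m n R C Z p)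
                - of_real (exp (- mu m n Z / 2 + nu m n Z) * Xi m n Z)) \<le> \<epsilon> * Xi m n Z"
      using est(1) le(1) by (rule order_trans)
    show "\<bar>(LINT p:U_region m n \<tau>|hyperplane_lebesgue m n. cmod (F_integrand m n R C Z p))
                - exp (nu m n Z) * Xi m n Z\<bar> \<le> \<epsilon> * Xi m n Z"
      using est(2) le(2) by (rule order_trans)
  qed
qed

end
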